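(* Assume, in addition to the standing assumptions listed in the context, that $\pi_\star(V_\star)<\infty$, and suppose $\Phi_0\in\mathcal{V}(\kappa)$ for some $\kappa\in\mathbb{R}$, where $$\mathcal{V}(\kappa)=\{f\in\mathcal{L}(\mathbb{X})\cap\mathcal{O}(V_\star): f\ge V_\star-\kappa,\ \pi_\star(f)\le\kappa+1\}.$$ Let $\{\Phi_n\}$ be the value iteration sequence started at $\Phi_0$, i.e. $\Phi_{n+1}(x)=\min_{u\in\mathcal{U}(x)}[c(x,u)-\beta+\int\Phi_n(y)P(dy\,|\,x,u)]$, $n\ge0$. Then $$\Phi_n\;\longrightarrow\;V_\star+\lim_{n\to\infty}\pi_\star(\Phi_n-V_\star)\qquad\text{as }n\to\infty,\ \text{in }L^1(\mathbb{X};\pi_\star)\text{ and }\pi_\star\text{-a.s.}$$ Also, $$\lim_{n\to\infty}\bigl|\nu(\Phi_n)-\pi_\star(\Phi_n-V_\star)\bigr|=\beta.$$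
   Context: Notation. For a Polish space $\mathbb{Y}$, $\mathfrak{B}(\mathbb{Y})$ is its Borel $\sigma$-algebra, $\mathfrak{P}(\mathbb{Y})$ the Borel probability measures, $\mathcal{M}(\mathbb{Y})$ the real-valued Borel functions, $\mathcal{M}_b(\mathbb{Y})$ the bounded ones, $C_b(\mathbb{Y})$ the bounded continuous functions, and $\mathcal{L}(\mathbb{Y})$ the real-valued lower semicontinuous functions bounded from below. For a probability measure $\mu$, $\mu(f)=\int f\,d\mu$. For $f\in\mathcal{M}(\mathbb{X})$, $\|g\|_f=\sup_x\frac{|g(x)|}{1+|f(x)|}$ and $\mathcal{O}(f)=\{g\in\mathcal{M}(\mathbb{X}):\|g\|_f<\infty\}$. Model. A Markov decision process $(\mathbb{X},\mathbb{U},\mathcal{U},P,c)$: the state space $\mathbb{X}$ and the action space $\mathbb{U}$ are Polish; $\mathcal{U}:\mathbb{X}\to\mathfrak{B}(\mathbb{U})$ is a strict (nonempty-valued) measurable multifunction; $\mathbb{K}=\{(x,u):x\in\mathbb{X},\,u\in\mathcal{U}(x)\}$ has the relative topology of $\mathbb{X}\times\mathbb{U}$; $P(\cdot\,|\,x,u)$ is a stochastic kernel on $\mathbb{K}\times\mathfrak{B}(\mathbb{X})$; $c:\mathbb{K}\to[1,\infty]$ is the measurable running cost. Admissible strategies $\xi=\{\xi_t\}\in\mathfrak{U}$ are sequences of stochastic kernels on $\mathbb{U}$ given the history $h_t=(x_0,u_0,\dots,u_{t-1},x_t)$ with $\xi_t(\mathcal{U}(x_t)\,|\,h_t)=1$;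 $\mathbb{P}^\xi_\mu$, $\mathbb{E}^\xi_\mu$ are the induced law and expectation of $(X_t,U_t)_{t\ge0}$ with $X_0\sim\mu$ (subscript $x$ for the Dirac mass at $x$). $\mathfrak{U}_{\mathrm{sm}}$ is the set of stationary Markov randomized strategies, i.e. stochastic kernels $v(du\,|\,x)$ with $v(\mathcal{U}(x)\,|\,x)=1$ (a measurable selector $v:\mathbb{X}\to\mathbb{U}$ of $\mathcal{U}$ is identified with the kernel of Dirac masses). For $v\in\mathfrak{U}_{\mathrm{sm}}$, $P_v(A\,|\,x)=\int P(A\,|\,x,u)v(du\,|\,x)$ and $c_v(x)=\int c(x,u)v(du\,|\,x)$. Average cost. $\mathcal{E}(\mu,\xi)=\limsup_{N}\frac1N\mathbb{E}^\xi_\mu[\sum_{n=0}^{N-1}c(X_n,U_n)]$, $J(\mu)=\inf_{\xi\in\mathfrak{U}}\mathcal{E}(\mu,\xi)$ ($J(x)$ for the Dirac mass at $x$), $\beta=\inf_{\mu}J(\mu)$. A strategy $\xi$ is optimal if $\mathcal{E}(\mu,\xi)=J(\mu)$ for all $\mu\in\mathfrak{P}(\mathbb{X})$. Standing assumptions. Basic: $P$ is strongly continuous, i.e. $(x,u)\mapsto\int f(y)P(dy\,|\,x,u)$ is continuous on $\mathbb{K}$ for every $f\in\mathcal{M}_b(\mathbb{X})$; $\mathcal{U}$ is upper semicontinuous and closed-valued; $c$ is lower semicontinuous. (A0): there are a bounded (Borel) set $\mathcal{B}\subset\mathbb{X}$ with $\inf_{(x,u)\in(\mathcal{B}^c\times\mathbb{U})\cap\mathbb{K}}c(x,u)>\beta$,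 a measure $\nu\in\mathfrak{P}(\mathbb{X})$ with $\nu(\mathcal{B})=1$ and a constant $\delta>0$ with $P(A\,|\,x,u)\ge\delta\nu(A)\mathbf{1}_{\mathcal{B}}(x)$ for all $A\in\mathfrak{B}(\mathbb{X})$, $(x,u)\in\mathbb{K}$, and $\sum_{n\ge1}\mathbb{P}^v_x(X_n\in\mathcal{B})>0$ for all $v\in\mathfrak{U}_{\mathrm{sm}}$, $x\in\mathbb{X}$. Here $\delta$ is chosen so that $\inf_{(x,u)\in(\mathcal{B}\times\mathbb{U})\cap\mathbb{K}}P(\mathcal{B}\,|\,x,u)>\delta$. (A1): either (i) $J(x)<\infty$ for some $x$ and $c$ is inf-compact on $\mathbb{K}$ (all sets $\{c\le\kappa\}$, $\kappa\in\mathbb{R}$, are compact); or (ii) $c$ is $\mathcal{K}$-inf-compact (inf-compact on $(K\times\mathbb{U})\cap\mathbb{K}$ for each compact $K\subset\mathbb{X}$) and (C) holds. Condition (C): there is a continuous one-one embedding of $\mathbb{K}$ into a Polish space whose image has compact closure $\mathbb{K}^*$ ($\mathbb{K}$ being identified with its image), where $\mathbb{K}^*$ is taken to be the closure of $\mathbb{K}$ in $\mathbb{X}^*\times\mathbb{U}^*$ with $\mathbb{X}^*,\mathbb{U}^*$ compact dense embeddings of $\mathbb{X},\mathbb{U}$ into suitable Polish spaces, assumed to exist; and there are a compact $\widetilde K\subset\mathbb{K}$ and $\varepsilon_0>0$ with $c\ge\beta+\varepsilon_0$ on $\mathbb{K}\setminus\widetilde K$. (A2): there exists a $c$-stable $v\in\mathfrak{U}_{\mathrm{sm}}$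 (defined below). Split chain. Let $\mathcal{X}=(\mathbb{X}\times\{0\})\cup(\mathcal{B}\times\{1\})$. For $\mu\in\mathfrak{P}(\mathbb{X})$ (and by linearity for finite measures) define $\breve\mu$ on $\mathcal{X}$ by $\breve\mu(A\times\{0\})=(1-\delta)\mu(A\cap\mathcal{B})+\mu(A\cap\mathcal{B}^c)$, $A\in\mathfrak{B}(\mathbb{X})$, and $\breve\mu(A\times\{1\})=\delta\mu(A)$, $A\in\mathfrak{B}(\mathcal{B})$; $\breve P(\cdot\,|\,x,u)$ is obtained from $P(\cdot\,|\,x,u)$ in this way. The split chain $\breve X_n=(X_n,i_n)$ on $\mathcal{X}$ has kernel $Q(\cdot\,|\,(x,i),u)$ equal to $\breve P(\cdot\,|\,x,u)$ if $i=0$, $x\notin\mathcal{B}$; to $\frac{1}{1-\delta}(\breve P(\cdot\,|\,x,u)-\delta\breve\nu)$ if $i=0$, $x\in\mathcal{B}$; and to $\breve\nu$ if $i=1$, $x\in\mathcal{B}$. Its cost is $\breve c((x,0),u)=c(x,u)$ for $x\in\mathcal{B}^c$, $\breve c((x,0),u)=\frac{c(x,u)}{1-\delta}$ for $x\in\mathcal{B}$, and $\breve c((x,1),u)=0$. A $v\in\mathfrak{U}_{\mathrm{sm}}$ controls the split chain by applying $v(\cdot\,|\,x)$ at $(x,i)$; $\breve c_v(x,i)=\int\breve c((x,i),u)v(du\,|\,x)$ and $\breve{\mathbb{E}}^v_{(x,i)}$ is the expectation started at $(x,i)$. Let $\breve\tau=\min\{n\ge1:\breve X_n\in\mathcal{B}\times\{1\}\}$.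 A $v\in\mathfrak{U}_{\mathrm{sm}}$ is $c$-stable if $x\mapsto\breve{\mathbb{E}}^v_{(x,0)}[\sum_{k=0}^{\breve\tau-1}\breve c_v(\breve X_k)]$ is bounded on every bounded subset of $\mathbb{X}$. Definition of $V_\star$. $\breve V^{(0)}_\star(x)=\inf_{v\in\mathfrak{U}_{\mathrm{sm}}}\breve{\mathbb{E}}^v_{(x,0)}\bigl[\sum_{k=0}^{\breve\tau-1}(\breve c_v(\breve X_k)-\beta)\bigr]$, and $V_\star(x)=(1-\delta)\breve V^{(0)}_\star(x)$ for $x\in\mathcal{B}$, $V_\star(x)=\breve V^{(0)}_\star(x)$ for $x\notin\mathcal{B}$. The function $V_\star\in\mathcal{L}(\mathbb{X})$ solves $V_\star(x)=\min_{u\in\mathcal{U}(x)}[c(x,u)-\beta+\int V_\star(y)P(dy\,|\,x,u)]$. Fixed optimal strategy. $v_\star$ is a fixed optimal stationary Markov strategy which is a measurable selector of the minimizer in this equation, so $V_\star=c_{v_\star}-\beta+P_{v_\star}V_\star$ on $\mathbb{X}$; $\pi_\star$ is the invariant probability measure of the chain controlled by $v_\star$. *)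

theory Defs
  imports "HOL-Probability.Probability"
begin

definition lsc_on :: "'a::topological_space set \<Rightarrow> ('a \<Rightarrow> 'b::linorder) \<Rightarrow> bool" where
  "lsc_on S f \<longleftrightarrow> (\<forall>a. openin (top_of_set S) {z \<in> S. a < f z})"

definition lsc_bounded_below :: "('a::topological_space \<Rightarrow> real) set" where
  "lsc_bounded_below = {f. lsc_on UNIV f \<and> (\<exists>b. \<forall>x. b \<le> f x)}"

definition weighted_norm :: "('a \<Rightarrow> real) \<Rightarrow> ('a \<Rightarrow> real) \<Rightarrow> ereal" where
  "weighted_norm f g = (SUP x. ereal (\<bar>g x\<bar> / (1 + \<bar>f x\<bar>)))"

definition big_O_class :: "('a::topological_space \<Rightarrow> real) \<Rightarrow> ('a \<Rightarrow> real) set" where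
  "big_O_class f = {g \<in> borel_measurable borel. weighted_norm f g < \<infinity>}"

text \<open>The integral of a function bounded from below may be \<open>+\<infinity>\<close>, for which the Bochner integral
  returns 0; hence the following extended-valued integral.\<close>

definition ext_integral :: "'a measure \<Rightarrow> ('a \<Rightarrow> real) \<Rightarrow> ereal" where
  "ext_integral \<mu> f =
     enn2ereal (\<integral>\<^sup>+x. ennreal (f x) \<partial>\<mu>) - enn2ereal (\<integral>\<^sup>+x. ennreal (- f x) \<partial>\<mu>)"

definition is_minimum_over :: "'a set \<Rightarrow> ('a \<Rightarrow> ereal) \<Rightarrow> ereal \<Rightarrow> bool" where
  "is_minimum_over S f m \<longleftrightarrow> (\<exists>u\<in>S. f u = m) \<and> (\<forall>u\<in>S. m \<le> f u)"

definition prob_measures :: "'a::topological_space measure set" where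
  "prob_measures = space (prob_algebra borel)"

text \<open>The state space is the type \<open>'x\<close> and the action space the type \<open>'u\<close>. The transition kernel
  and the running cost carry information only on the graph \<open>graphK\<close> of the action
  multifunction.\<close>

record ('x, 'u) mdp =
  acts :: "'x \<Rightarrow> 'u set"
  trans :: "'x \<times> 'u \<Rightarrow> 'x measure"
  cost :: "'x \<times> 'u \<Rightarrow> ennreal"

definition graphK :: "('x, 'u) mdp \<Rightarrow> ('x \<times> 'u) set" where
  "graphK M = {(x, u). u \<in> acts M x}"

definition is_mdp :: "('x::polish_space, 'u::polish_space) mdp \<Rightarrow> bool" where
  "is_mdp M \<longleftrightarrow>
     (\<forall>x. acts M x \<noteq> {} \<and> acts M x \<in> sets borel) \<and>
     (\<forall>G. open G \<longrightarrow> {x. acts M x \<inter> G \<noteq> {}} \<in> sets borel) \<and>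
     trans M \<in> restrict_space borel (graphK M) \<rightarrow>\<^sub>M prob_algebra borel \<and>
     cost M \<in> borel_measurable (restrict_space borel (graphK M)) \<and>
     (\<forall>z\<in>graphK M. 1 \<le> cost M z)"

text \<open>A strategy maps a time \<open>t\<close>, the history \<open>((x\<^sub>0,u\<^sub>0),\<dots>,(x\<^sub>t\<^sub>-\<^sub>1,u\<^sub>t\<^sub>-\<^sub>1))\<close>, given as a function on
  \<open>{0..<t}\<close>, and the current state \<open>x\<^sub>t\<close> to a law on actions.\<close>

type_synonym ('x, 'u) strategy = "nat \<Rightarrow> (nat \<Rightarrow> 'x \<times> 'u) \<Rightarrow> 'x \<Rightarrow> 'u measure"

definition admissible ::
  "('x::polish_space, 'u::polish_space) mdp \<Rightarrow> ('x, 'u) strategy set" where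
  "admissible M = {\<xi>. \<forall>t.
     (\<lambda>(h, x). \<xi> t h x) \<in> (\<Pi>\<^sub>M i\<in>{0..<t}. borel) \<Otimes>\<^sub>M borel \<rightarrow>\<^sub>M prob_algebra borel \<and>
     (\<forall>h \<in> space (\<Pi>\<^sub>M i\<in>{0..<t}. (borel :: ('x \<times> 'u) measure)). \<forall>x.
        emeasure (\<xi> t h x) (acts M x) = 1)}"

definition stationary ::
  "('x::polish_space, 'u::polish_space) mdp \<Rightarrow> ('x \<Rightarrow> 'u measure) set" where
  "stationary M = {v \<in> borel \<rightarrow>\<^sub>M prob_algebra borel. \<forall>x. emeasure (v x) (acts M x) = 1}"

definition stationary_strategy :: "('x \<Rightarrow> 'u measure) \<Rightarrow> ('x, 'u) strategy" where
  "stationary_strategy v = (\<lambda>t h x. v x)"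

text \<open>The path law is the Ionescu-Tulcea limit. Its one-step kernels have to be total, so the
  transition kernel is extended arbitrarily off the graph, which admissible strategies almost
  surely never leave.\<close>

definition total_trans :: "('x::polish_space, 'u) mdp \<Rightarrow> 'x \<times> 'u \<Rightarrow> 'x measure" where
  "total_trans M z = (if z \<in> graphK M then trans M z else return borel (fst z))"

definition path_measure :: "'s measure \<Rightarrow> (nat \<Rightarrow> (nat \<Rightarrow> 's) \<Rightarrow> 's measure) \<Rightarrow> (nat \<Rightarrow> 's) measure" where
  "path_measure S k =
     projective_family.lim UNIV (Ionescu_Tulcea.CI k (\<lambda>_. S)) (\<lambda>_. S)"

definition mdp_kernel ::
  "('x::polish_space, 'u::polish_space) mdp \<Rightarrow> 'x measure \<Rightarrow> ('x, 'u) strategy \<Rightarrow>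
   nat \<Rightarrow> (nat \<Rightarrow> 'x \<times> 'u) \<Rightarrow> ('x \<times> 'u) measure" where
  "mdp_kernel M \<mu> \<xi> t h =
     (case t of 0 \<Rightarrow> \<mu> | Suc s \<Rightarrow> total_trans M (h s)) \<bind>
     (\<lambda>x. distr (\<xi> t h x) borel (\<lambda>u. (x, u)))"

definition mdp_law ::
  "('x::polish_space, 'u::polish_space) mdp \<Rightarrow> 'x measure \<Rightarrow> ('x, 'u) strategy \<Rightarrow>
   (nat \<Rightarrow> 'x \<times> 'u) measure" where
  "mdp_law M \<mu> \<xi> = path_measure borel (mdp_kernel M \<mu> \<xi>)"

definition average_cost ::
  "('x::polish_space, 'u::polish_space) mdp \<Rightarrow> 'x measure \<Rightarrow> ('x, 'u) strategy \<Rightarrow> ennreal" where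
  "average_cost M \<mu> \<xi> =
     limsup (\<lambda>N. (\<integral>\<^sup>+\<omega>. (\<Sum>n<N. cost M (\<omega> n)) \<partial>mdp_law M \<mu> \<xi>) / of_nat N)"

definition optimal_cost ::
  "('x::polish_space, 'u::polish_space) mdp \<Rightarrow> 'x measure \<Rightarrow> ennreal" where
  "optimal_cost M \<mu> = (INF \<xi>\<in>admissible M. average_cost M \<mu> \<xi>)"

definition betaE :: "('x::polish_space, 'u::polish_space) mdp \<Rightarrow> ennreal" where
  "betaE M = (INF \<mu>\<in>prob_measures. optimal_cost M \<mu>)"

text \<open>Assumption \<open>A0\<close> below forces \<open>betaE M < \<infinity>\<close>, so nothing is lost in passing to the reals.\<close>

definition beta :: "('x::polish_space, 'u::polish_space) mdp \<Rightarrow> real" where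
  "beta M = enn2real (betaE M)"

definition is_optimal ::
  "('x::polish_space, 'u::polish_space) mdp \<Rightarrow> ('x, 'u) strategy \<Rightarrow> bool" where
  "is_optimal M \<xi> \<longleftrightarrow>
     \<xi> \<in> admissible M \<and> (\<forall>\<mu>\<in>prob_measures. average_cost M \<mu> \<xi> = optimal_cost M \<mu>)"

text \<open>The split state space is carried by \<open>'x \<times> bool\<close>; the points \<open>(x, True)\<close> with \<open>x \<notin> B\<close> are
  never charged.\<close>

definition split_algebra :: "('x::topological_space \<times> bool) measure" where
  "split_algebra = borel \<Otimes>\<^sub>M count_space UNIV"

definition split_measure ::
  "'x::topological_space set \<Rightarrow> real \<Rightarrow> 'x measure \<Rightarrow> ('x \<times> bool) measure" where
  "split_measure B \<delta> \<mu> = measure_of UNIV (sets split_algebra)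
     (\<lambda>C. ennreal (1 - \<delta>) * emeasure \<mu> ({x. (x, False) \<in> C} \<inter> B)
        + emeasure \<mu> ({x. (x, False) \<in> C} \<inter> - B)
        + ennreal \<delta> * emeasure \<mu> ({x. (x, True) \<in> C} \<inter> B))"

definition split_kernel ::
  "('x::polish_space, 'u) mdp \<Rightarrow> 'x set \<Rightarrow> 'x measure \<Rightarrow> real \<Rightarrow>
   'x \<times> bool \<Rightarrow> 'u \<Rightarrow> ('x \<times> bool) measure" where
  "split_kernel M B \<nu> \<delta> s u = (case s of (x, i) \<Rightarrow>
     if i then split_measure B \<delta> \<nu>
     else if x \<in> B then
       scale_measure (ennreal (1 / (1 - \<delta>)))
         (diff_measure (split_measure B \<delta> (trans M (x, u)))
            (scale_measure (ennreal \<delta>) (split_measure B \<delta> \<nu>)))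
     else split_measure B \<delta> (trans M (x, u)))"

definition split_cost ::
  "('x, 'u) mdp \<Rightarrow> 'x set \<Rightarrow> real \<Rightarrow> 'x \<times> bool \<Rightarrow> 'u \<Rightarrow> ennreal" where
  "split_cost M B \<delta> s u = (case s of (x, i) \<Rightarrow>
     if i then 0 else if x \<in> B then cost M (x, u) / ennreal (1 - \<delta>) else cost M (x, u))"

definition split_kernel_under ::
  "('x::polish_space, 'u) mdp \<Rightarrow> 'x set \<Rightarrow> 'x measure \<Rightarrow> real \<Rightarrow> ('x \<Rightarrow> 'u measure) \<Rightarrow>
   'x \<times> bool \<Rightarrow> ('x \<times> bool) measure" where
  "split_kernel_under M B \<nu> \<delta> v s = measure_of UNIV (sets split_algebra)
     (\<lambda>C. \<integral>\<^sup>+u. emeasure (split_kernel M B \<nu> \<delta> s u) C \<partial>v (fst s))"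

definition split_cost_under ::
  "('x, 'u) mdp \<Rightarrow> 'x set \<Rightarrow> real \<Rightarrow> ('x \<Rightarrow> 'u measure) \<Rightarrow> 'x \<times> bool \<Rightarrow> ennreal" where
  "split_cost_under M B \<delta> v s = (\<integral>\<^sup>+u. split_cost M B \<delta> s u \<partial>v (fst s))"

definition split_law ::
  "('x::polish_space, 'u) mdp \<Rightarrow> 'x set \<Rightarrow> 'x measure \<Rightarrow> real \<Rightarrow> ('x \<Rightarrow> 'u measure) \<Rightarrow>
   'x \<times> bool \<Rightarrow> (nat \<Rightarrow> 'x \<times> bool) measure" where
  "split_law M B \<nu> \<delta> v s = path_measure split_algebra
     (\<lambda>n h. case n of 0 \<Rightarrow> return split_algebra s
                    | Suc m \<Rightarrow> split_kernel_under M B \<nu> \<delta> v (h m))"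

definition return_time :: "'x set \<Rightarrow> (nat \<Rightarrow> 'x \<times> bool) \<Rightarrow> enat" where
  "return_time B \<omega> = (INF n\<in>{n. 1 \<le> n \<and> \<omega> n \<in> B \<times> {True}}. enat n)"

definition expected_cycle_sum ::
  "('x::polish_space, 'u) mdp \<Rightarrow> 'x set \<Rightarrow> 'x measure \<Rightarrow> real \<Rightarrow> ('x \<Rightarrow> 'u measure) \<Rightarrow>
   ('x \<times> bool \<Rightarrow> ennreal) \<Rightarrow> 'x \<times> bool \<Rightarrow> ennreal" where
  "expected_cycle_sum M B \<nu> \<delta> v f s =
     (\<integral>\<^sup>+\<omega>. (\<Sum>k. if enat k < return_time B \<omega> then f (\<omega> k) else 0) \<partial>split_law M B \<nu> \<delta> v s)"

definition c_stable ::
  "('x::polish_space, 'u::polish_space) mdp \<Rightarrow> 'x set \<Rightarrow> 'x measure \<Rightarrow> real \<Rightarrow>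
   ('x \<Rightarrow> 'u measure) \<Rightarrow> bool" where
  "c_stable M B \<nu> \<delta> v \<longleftrightarrow> v \<in> stationary M \<and>
     (\<forall>S. bounded S \<longrightarrow> (\<exists>b::real. \<forall>x\<in>S.
        expected_cycle_sum M B \<nu> \<delta> v (split_cost_under M B \<delta> v) (x, False) \<le> ennreal b))"

text \<open>The summands \<open>split_cost_under - \<beta>\<close> are signed, so positive and negative parts are summed
  separately (subtraction on ennreal truncates at 0). The negative part is supported on
  \<open>B \<times> {False}\<close>; under \<open>A0\<close> the expected number of visits there before the return time is
  finite, so the difference is not of the form \<open>\<infinity> - \<infinity>\<close>.\<close>

definition split_value ::
  "('x::polish_space, 'u::polish_space) mdp \<Rightarrow> 'x set \<Rightarrow> 'x measure \<Rightarrow> real \<Rightarrow>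
   ('x \<Rightarrow> 'u measure) \<Rightarrow> 'x \<Rightarrow> ereal" where
  "split_value M B \<nu> \<delta> v x =
     enn2ereal (expected_cycle_sum M B \<nu> \<delta> v
       (\<lambda>s. split_cost_under M B \<delta> v s - ennreal (beta M)) (x, False)) -
     enn2ereal (expected_cycle_sum M B \<nu> \<delta> v
       (\<lambda>s. ennreal (beta M) - split_cost_under M B \<delta> v s) (x, False))"

definition split_value_star ::
  "('x::polish_space, 'u::polish_space) mdp \<Rightarrow> 'x set \<Rightarrow> 'x measure \<Rightarrow> real \<Rightarrow> 'x \<Rightarrow> ereal" where
  "split_value_star M B \<nu> \<delta> x = (INF v\<in>stationary M. split_value M B \<nu> \<delta> v x)"

definition Vstar ::
  "('x::polish_space, 'u::polish_space) mdp \<Rightarrow> 'x set \<Rightarrow> 'x measure \<Rightarrow> real \<Rightarrow> 'x \<Rightarrow> ereal" where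
  "Vstar M B \<nu> \<delta> x =
     (if x \<in> B then ereal (1 - \<delta>) * split_value_star M B \<nu> \<delta> x else split_value_star M B \<nu> \<delta> x)"

definition basic_assumption :: "('x::polish_space, 'u::polish_space) mdp \<Rightarrow> bool" where
  "basic_assumption M \<longleftrightarrow>
     (\<forall>f::'x \<Rightarrow> real. f \<in> borel_measurable borel \<and> bounded (range f) \<longrightarrow>
        continuous_on (graphK M) (\<lambda>z. \<integral>y. f y \<partial>trans M z)) \<and>
     (\<forall>F. closed F \<longrightarrow> closed {x. acts M x \<inter> F \<noteq> {}}) \<and>
     (\<forall>x. closed (acts M x)) \<and>
     lsc_on (graphK M) (cost M)"

definition A0 ::
  "('x::polish_space, 'u::polish_space) mdp \<Rightarrow> 'x set \<Rightarrow> 'x measure \<Rightarrow> real \<Rightarrow> bool" where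
  "A0 M B \<nu> \<delta> \<longleftrightarrow>
     bounded B \<and> B \<in> sets borel \<and>
     (INF z\<in>{z \<in> graphK M. fst z \<notin> B}. cost M z) > betaE M \<and>
     \<nu> \<in> prob_measures \<and> emeasure \<nu> B = 1 \<and>
     \<delta> > 0 \<and>
     (\<forall>A\<in>sets borel. \<forall>z\<in>graphK M.
        emeasure (trans M z) A \<ge> ennreal \<delta> * emeasure \<nu> A * indicator B (fst z)) \<and>
     (\<forall>v\<in>stationary M. \<forall>x.
        (\<Sum>n. emeasure (mdp_law M (return borel x) (stationary_strategy v))
                 {\<omega>. fst (\<omega> (Suc n)) \<in> B}) > 0) \<and>
     (INF z\<in>{z \<in> graphK M. fst z \<in> B}. emeasure (trans M z) B) > ennreal \<delta>"

text \<open>\<open>iX\<close> and \<open>iU\<close> map the state and action space into Polish spaces; the compactifications are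
  the closures of their ranges. They are explicit arguments because HOL cannot quantify over types
  inside a formula.\<close>

definition condition_C ::
  "('x::polish_space, 'u::polish_space) mdp \<Rightarrow>
   ('x \<Rightarrow> 'xs::polish_space) \<Rightarrow> ('u \<Rightarrow> 'us::polish_space) \<Rightarrow> bool" where
  "condition_C M iX iU \<longleftrightarrow>
     continuous_on UNIV iX \<and> inj iX \<and> compact (closure (range iX)) \<and>
     continuous_on UNIV iU \<and> inj iU \<and> compact (closure (range iU)) \<and>
     compact (closure (map_prod iX iU ` graphK M)) \<and>
     (\<exists>K0 \<epsilon>. compact K0 \<and> K0 \<subseteq> graphK M \<and> \<epsilon> > 0 \<and>
        (\<forall>z \<in> graphK M - K0. cost M z \<ge> betaE M + ennreal \<epsilon>))"

definition A1 ::
  "('x::polish_space, 'u::polish_space) mdp \<Rightarrow>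
   ('x \<Rightarrow> 'xs::polish_space) \<Rightarrow> ('u \<Rightarrow> 'us::polish_space) \<Rightarrow> bool" where
  "A1 M iX iU \<longleftrightarrow>
     (\<exists>x. optimal_cost M (return borel x) < \<infinity>) \<and>
       (\<forall>k::real. compact {z \<in> graphK M. cost M z \<le> ennreal k}) \<or>
     (\<forall>C. compact C \<longrightarrow>
        (\<forall>k::real. compact {z \<in> graphK M. fst z \<in> C \<and> cost M z \<le> ennreal k})) \<and>
       condition_C M iX iU"

definition A2 ::
  "('x::polish_space, 'u::polish_space) mdp \<Rightarrow> 'x set \<Rightarrow> 'x measure \<Rightarrow> real \<Rightarrow> bool" where
  "A2 M B \<nu> \<delta> \<longleftrightarrow> (\<exists>v. c_stable M B \<nu> \<delta> v)"

definition bellman_rhs ::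
  "('x::polish_space, 'u::polish_space) mdp \<Rightarrow> ('x \<Rightarrow> real) \<Rightarrow> 'x \<Rightarrow> 'u \<Rightarrow> ereal" where
  "bellman_rhs M f x u =
     enn2ereal (cost M (x, u)) - ereal (beta M) + ext_integral (trans M (x, u)) f"

definition solves_optimality_equation ::
  "('x::polish_space, 'u::polish_space) mdp \<Rightarrow> ('x \<Rightarrow> real) \<Rightarrow> bool" where
  "solves_optimality_equation M V \<longleftrightarrow>
     (\<forall>x. is_minimum_over (acts M x) (bellman_rhs M V x) (ereal (V x)))"

definition minimizing_selector ::
  "('x::polish_space, 'u::polish_space) mdp \<Rightarrow> ('x \<Rightarrow> real) \<Rightarrow> ('x \<Rightarrow> 'u) \<Rightarrow> bool" where
  "minimizing_selector M V v \<longleftrightarrow> v \<in> borel_measurable borel \<and>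
     (\<forall>x. is_arg_min (bellman_rhs M V x) (\<lambda>u. u \<in> acts M x) (v x))"

definition invariant_under ::
  "('x::polish_space, 'u::polish_space) mdp \<Rightarrow> ('x \<Rightarrow> 'u) \<Rightarrow> 'x measure \<Rightarrow> bool" where
  "invariant_under M v \<pi> \<longleftrightarrow> \<pi> \<in> prob_measures \<and>
     (\<forall>A\<in>sets borel. emeasure \<pi> A = (\<integral>\<^sup>+x. emeasure (trans M (x, v x)) A \<partial>\<pi>))"

definition value_iteration ::
  "('x::polish_space, 'u::polish_space) mdp \<Rightarrow> (nat \<Rightarrow> 'x \<Rightarrow> real) \<Rightarrow> bool" where
  "value_iteration M \<Phi> \<longleftrightarrow>
     (\<forall>n x. is_minimum_over (acts M x) (bellman_rhs M (\<Phi> n) x) (ereal (\<Phi> (Suc n) x)))"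

definition init_class ::
  "('x::topological_space \<Rightarrow> real) \<Rightarrow> 'x measure \<Rightarrow> real \<Rightarrow> ('x \<Rightarrow> real) set" where
  "init_class V \<pi> \<kappa> =
     {f \<in> lsc_bounded_below \<inter> big_O_class V.
        (\<forall>x. f x \<ge> V x - \<kappa>) \<and> ext_integral \<pi> f \<le> ereal (\<kappa> + 1)}"

end

theory Submission
  imports Defs
begin

text \<open>Let \<open>P\<close> be the kernel of the optimal selector, split as \<open>P = T + s \<otimes> \<nu>\<close> with \<open>s = \<delta> 1\<^sub>B\<close> and a taboo kernel
  \<open>T\<close>, and let \<open>U = \<Sum>\<^sub>n T\<^sup>n\<close>. The optimality equation makes \<open>V\<close> a Lyapunov function for \<open>T\<close>, so
  \<open>U 1\<close> is finite everywhere and \<open>\<pi>\<close>-integrable. The nonnegative functions \<open>G\<^sub>n = \<Phi>\<^sub>n - V + \<kappa>\<close> satisfy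
  \<open>G\<^sub>n\<^sub>+\<^sub>1 + d\<^sub>n\<^sub>+\<^sub>1 = T G\<^sub>n + s \<nu>(G\<^sub>n)\<close> with \<open>d\<^sub>n \<ge> 0\<close>, and invariance of \<open>\<pi>\<close> gives \<open>\<Sum>\<^sub>n \<pi>(d\<^sub>n) \<le> \<pi>(G\<^sub>0)\<close>.
  Unrolling, \<open>\<nu>(G\<^sub>n)\<close> solves an aperiodic renewal equation with summable forcing and hence converges to
  some \<open>l\<close>. The same unrolled identity then yields \<open>G\<^sub>n \<rightarrow> l\<close> almost surely, and Fatou's lemma together
  with an upper bound on \<open>\<pi>(G\<^sub>n)\<close> yields convergence in \<open>L\<^sup>1\<close>.

  For the last claim, the cost of a regeneration cycle of the split chain is \<open>U\<close> applied to
  \<open>c - \<beta> (1 - s)\<close>, up to the weight \<open>1 - s\<close>. Comparing this with the optimality inequality iterated along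
  \<open>T\<close>, for every stationary strategy and with equality for the optimal selector, shows that
  \<open>\<nu>(V) = \<beta>\<close>.\<close>

section \<open>Renewal sequences\<close>

text \<open>All estimates live in \<open>ennreal\<close>: \<open>V\<close> and the iterates are only
  bounded below, integrals may be infinite, and subtraction truncates. Hence functions are shifted
  to be nonnegative and identities stay additive, with the defects \<open>d\<close> on the left. A
  defect is the loss from using the selector of \<open>V\<close> instead of a minimizer for the
  current iterate; each step lowers \<open>\<pi>(G)\<close> by exactly \<open>\<pi>(d)\<close>, so
  the defects are summable.

  The optimality equation fixes \<open>V\<close> only up to a constant; the cycle definition fixes
  that constant. Summed along \<open>T\<close>, the equation yields \<open>\<beta> U 1\<close> and
  \<open>\<nu>(V) U s = \<nu>(V)\<close>, whereas a cycle is charged \<open>\<beta>\<close> only for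
  \<open>U (1 - s) = U 1 - 1\<close>. The missing unit is the \<open>\<beta>\<close> of the last
  claim. Since \<open>V\<close> is an infimum over strategies, \<open>\<nu>(V) \<ge> \<beta>\<close>
  is obtained from almost minimizing strategies, and \<open>\<nu>(V) \<le> \<beta>\<close> from the
  selector.

  Path measures enter only through the definition of \<open>V\<close>, and are eliminated by
  expressing cycle sums as potentials of \<open>T\<close>. Value iteration does not assert that the
  iterates are measurable; this is derived from closedness of their sublevel sets.\<close>

lemma convolution_tendsto:
  fixes p b :: "nat \<Rightarrow> real"
  assumes p: "summable p" "\<And>j. 0 \<le> p j" and b: "b \<longlonglongrightarrow> l"
  shows "(\<lambda>n. \<Sum>j<n. p j * b (n - 1 - j)) \<longlonglongrightarrow> (\<Sum>j. p j) * l"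
proof -
  obtain K where K: "\<And>n. \<bar>b n\<bar> \<le> K"
    using BseqE[OF convergent_imp_Bseq[OF convergentI[OF b]]] by (metis real_norm_def)
  \<comment> \<open>Extension by 0 for \<open>j \<ge> n\<close> turns the growing sums into one
    series dominated by \<open>p j * K\<close>, so the limit may be taken termwise.\<close>
  define f where "f j n = (if j < n then p j * b (n - 1 - j) else 0)" for j n
  have lim: "(\<lambda>n. f j n) \<longlonglongrightarrow> p j * l" for j
  proof -
    have "filterlim (\<lambda>n. n - Suc j) sequentially sequentially"
      by (rule filterlim_minus_const_nat_at_top)
    then have "(\<lambda>n. p j * b (n - 1 - j)) \<longlonglongrightarrow> p j * l"
      by (intro tendsto_intros filterlim_compose[OF b]) simp
    moreover have "eventually (\<lambda>n. f j n = p j * b (n - 1 - j)) sequentially"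
      using eventually_gt_at_top[of j] by eventually_elim (simp add: f_def)
    ultimately show ?thesis by (simp add: tendsto_cong)
  qed
  have "(\<lambda>n. suminf (\<lambda>j. f j n)) \<longlonglongrightarrow> suminf (\<lambda>j. p j * l)"
  proof (rule tannerys_theorem[THEN conjunct2, THEN conjunct2])
    show "(\<lambda>n. f j n) \<longlonglongrightarrow> p j * l" for j by (rule lim)
    show "\<forall>\<^sub>F (j, n) in at_top \<times>\<^sub>F sequentially. norm (f j n) \<le> p j * K"
      using K p(2) order_trans[OF abs_ge_zero K[of 0]]
      by (intro always_eventually) (auto simp: f_def abs_mult intro!: mult_left_mono)
    show "summable (\<lambda>j. p j * K)" by (intro summable_mult2 p)
  qed auto
  moreover have "suminf (\<lambda>j. f j n) = (\<Sum>j<n. p j * b (n - 1 - j))" for n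
    by (subst suminf_finite[of "{..<n}"]) (auto simp: f_def)
  ultimately show ?thesis using suminf_mult2[OF p(1), of l] by simp
qed

text \<open>A conserved quantity. Read \<open>r j\<close> as the probability that a gap between
  renewals exceeds \<open>j\<close>. From \<open>n\<close> to \<open>Suc n\<close>, the weight of
  the old term \<open>a (n - j)\<close> drops by \<open>r j - r (Suc j)\<close>, which is exactly
  what the renewal equation returns through \<open>a (Suc n)\<close>; only \<open>e (Suc n)\<close>
  is new.\<close>

lemma renewal_sum:
  fixes a e r :: "nat \<Rightarrow> real"
  assumes r: "r 0 = 1"
    and eq: "\<And>n. a n = e n + (\<Sum>j<n. (r j - r (Suc j)) * a (n - 1 - j))"
  shows "(\<Sum>j\<le>n. r j * a (n - j)) = (\<Sum>k\<le>n. e k)"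
proof (induction n)
  case 0
  show ?case using eq[of 0] r by simp
next
  case (Suc n)
  have "(\<Sum>j\<le>Suc n. r j * a (Suc n - j)) = a (Suc n) + (\<Sum>j\<le>n. r (Suc j) * a (n - j))"
    by (subst sum.atMost_Suc_shift) (simp add: r)
  also have "a (Suc n) = e (Suc n) + (\<Sum>j\<le>n. (r j - r (Suc j)) * a (n - j))"
    by (subst eq) (simp add: lessThan_Suc_atMost)
  also have "\<dots> + (\<Sum>j\<le>n. r (Suc j) * a (n - j)) = e (Suc n) + (\<Sum>j\<le>n. r j * a (n - j))"
    by (simp add: sum.distrib[symmetric] algebra_simps)
  finally show ?case using Suc by simp
qed

text \<open>Feller's argument: since \<open>r 1 < r 0\<close>, along a subsequence realising the upper limit all
  bounded shifts have the same limit, which the conserved sum then determines.\<close>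

lemma renewal_upper_limit:
  fixes a e r :: "nat \<Rightarrow> real"
  assumes a: "bounded (range a)"
    and r: "summable r" "r 0 = 1" "\<And>j. r (Suc j) \<le> r j" "r 1 < 1"
    and e: "summable e"
    and eq: "\<And>n. a n = e n + (\<Sum>j<n. (r j - r (Suc j)) * a (n - 1 - j))"
    and upper: "\<And>\<epsilon>. 0 < \<epsilon> \<Longrightarrow> eventually (\<lambda>n. a n < \<alpha> + \<epsilon>) sequentially"
    and h: "strict_mono h" "(\<lambda>k. a (h k)) \<longlonglongrightarrow> \<alpha>"
  shows "\<alpha> * suminf r = suminf e"
proof -
  obtain K where K: "\<And>n. \<bar>a n\<bar> \<le> K" using a by (auto simp: bounded_iff)
  define p where "p j = r j - r (Suc j)" for j
  have p0: "0 \<le> p j" for j using r(3) by (simp add: p_def)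
  have sp: "summable p"
    unfolding p_def using r(1) by (intro summable_diff) (auto simp: summable_Suc_iff)
  have r0: "0 \<le> r j" for j
  proof -
    have "decseq r" using r(3) by (rule decseq_SucI)
    moreover have "r \<longlonglongrightarrow> 0" by (rule summable_LIMSEQ_zero[OF r(1)])
    ultimately show ?thesis by (rule decseq_ge)
  qed
  define b where "b n = \<alpha> - a n" for n
  define bm where "bm n = max 0 (- b n)" for n
  have bm: "bm \<longlonglongrightarrow> 0"
  proof (rule LIMSEQ_I)
    fix \<epsilon> :: real assume "0 < \<epsilon>"
    from upper[OF this] show "\<exists>no. \<forall>n\<ge>no. norm (bm n - 0) < \<epsilon>"
      using \<open>0 < \<epsilon>\<close> by (auto simp: eventually_sequentially bm_def b_def max_def) (metis add.commute diff_less_eq)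
  qed
  have sum_p: "(\<Sum>j<n. p j) = 1 - r n" for n
    unfolding p_def by (induction n) (auto simp: r(2))
  have beq: "b n = - e n + \<alpha> * r n + (\<Sum>j<n. p j * b (n - 1 - j))" for n
  proof -
    have "(\<Sum>j<n. p j * b (n - 1 - j)) = (\<Sum>j<n. p j) * \<alpha> - (\<Sum>j<n. p j * a (n - 1 - j))"
      by (simp add: b_def right_diff_distrib sum_subtractf sum_distrib_right)
    then show ?thesis unfolding b_def using eq[of n] by (simp add: p_def[symmetric] sum_p algebra_simps)
  qed
  \<comment> \<open>The renewal equation for \<open>b\<close>, solved for its single term
    \<open>p 0 * b n\<close>; every other value of \<open>b\<close> is bounded below by
    \<open>- bm\<close>, which tends to 0.\<close>
  define u where "u n = b n + e n - \<alpha> * r n + (\<Sum>j<n. p j * bm (n - 1 - j))" for n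
  have le: "p 0 * b n \<le> u (Suc n)" for n
  proof -
    have "(\<Sum>j<n. p (Suc j) * b (n - Suc j)) \<ge> (\<Sum>j<n. p (Suc j) * (- bm (n - Suc j)))"
      by (intro sum_mono mult_left_mono p0) (auto simp: bm_def)
    moreover have "(\<Sum>j<n. p (Suc j) * bm (n - Suc j)) \<le> (\<Sum>j<Suc n. p j * bm (n - j))"
      by (subst sum.lessThan_Suc_shift) (auto simp: bm_def intro!: mult_nonneg_nonneg p0)
    moreover have "b (Suc n) = - e (Suc n) + \<alpha> * r (Suc n) + p 0 * b n + (\<Sum>j<n. p (Suc j) * b (n - Suc j))"
      by (subst beq, subst sum.lessThan_Suc_shift) simp
    ultimately show ?thesis unfolding u_def by (simp add: sum_negf)
  qed
  \<comment> \<open>Smallness of \<open>b\<close> moves one index backwards: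
    \<open>b (m k - 1)\<close> is squeezed between \<open>- bm (m k - 1)\<close> and
    \<open>u (m k) / p 0\<close>. Dividing is possible because \<open>p 0 = 1 - r 1\<close> is
    positive.\<close>
  have step: "(\<lambda>k. b (m k - 1)) \<longlonglongrightarrow> 0"
    if m: "filterlim m at_top sequentially" and bm0: "(\<lambda>k. b (m k)) \<longlonglongrightarrow> 0" for m :: "nat \<Rightarrow> nat"
  proof -
    have "(\<lambda>n. e n - \<alpha> * r n + (\<Sum>j<n. p j * bm (n - 1 - j))) \<longlonglongrightarrow> 0 - \<alpha> * 0 + (\<Sum>j. p j) * 0"
      by (intro tendsto_intros convolution_tendsto sp p0 bm summable_LIMSEQ_zero r e)
    from filterlim_compose[OF this m] have "(\<lambda>k. b (m k) + (e (m k) - \<alpha> * r (m k) + (\<Sum>j<m k. p j * bm (m k - 1 - j)))) \<longlonglongrightarrow> 0 + (0 - \<alpha> * 0 + (\<Sum>j. p j) * 0)"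
      by (rule tendsto_add[OF bm0])
    then have u0: "(\<lambda>k. u (m k)) \<longlonglongrightarrow> 0" by (simp add: u_def algebra_simps)
    have ppos: "0 < p 0" using r by (simp add: p_def)
    have up: "(\<lambda>k. u (m k) / p 0) \<longlonglongrightarrow> 0" using tendsto_divide[OF u0 tendsto_const, of "p 0"] ppos by simp
    have "filterlim (\<lambda>k. m k - 1) sequentially sequentially"
      by (rule filterlim_compose[OF filterlim_minus_const_nat_at_top m])
    from tendsto_minus[OF filterlim_compose[OF bm this]]
    have lo: "(\<lambda>k. - bm (m k - 1)) \<longlonglongrightarrow> 0" by simp
    show ?thesis
    proof (rule tendsto_sandwich[OF _ _ lo up])
      show "\<forall>\<^sub>F k in sequentially. - bm (m k - 1) \<le> b (m k - 1)"
        by (intro always_eventually) (simp add: bm_def max_def)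
      have "eventually (\<lambda>k. m k \<ge> 1) sequentially" using m by (auto simp: filterlim_at_top)
      then show "\<forall>\<^sub>F k in sequentially. b (m k - 1) \<le> u (m k) / p 0"
      proof eventually_elim
        case (elim k)
        show ?case using le[of "m k - 1"] elim ppos by (simp add: field_simps)
      qed
    qed
  qed
  have hf: "filterlim h at_top sequentially" by (rule filterlim_subseq[OF h(1)])
  have shift: "(\<lambda>k. b (h k - i)) \<longlonglongrightarrow> 0" for i
  proof (induction i)
    case 0
    show ?case using tendsto_diff[OF tendsto_const h(2), of \<alpha>] by (simp add: b_def)
  next
    case (Suc i)
    have "filterlim (\<lambda>k. h k - i) at_top sequentially"
      by (rule filterlim_compose[OF filterlim_minus_const_nat_at_top hf])
    from step[OF this Suc] show ?case by simp
  qed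
  \<comment> \<open>By \<open>renewal_sum\<close> the series over \<open>j\<close> is a partial sum
    of \<open>e\<close>; termwise, all the shifted values \<open>a (h k - j)\<close> tend to
    \<open>\<alpha>\<close>.\<close>
  define f where "f j k = (if j \<le> h k then r j * a (h k - j) else 0)" for j k
  have "(\<lambda>k. suminf (\<lambda>j. f j k)) \<longlonglongrightarrow> suminf (\<lambda>j. r j * \<alpha>)"
  proof (rule tannerys_theorem[THEN conjunct2, THEN conjunct2])
    fix j
    have "(\<lambda>k. r j * (\<alpha> - b (h k - j))) \<longlonglongrightarrow> r j * (\<alpha> - 0)"
      by (intro tendsto_intros shift)
    moreover have "eventually (\<lambda>k. h k \<ge> j) sequentially" using hf by (auto simp: filterlim_at_top)
    then have "eventually (\<lambda>k. f j k = r j * (\<alpha> - b (h k - j))) sequentially"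
      by eventually_elim (simp add: f_def b_def)
    ultimately show "f j \<longlonglongrightarrow> r j * \<alpha>" by (simp add: tendsto_cong)
  next
    show "\<forall>\<^sub>F (j, n) in at_top \<times>\<^sub>F sequentially. norm (f j n) \<le> r j * K"
      using K r0 order_trans[OF abs_ge_zero K[of 0]]
      by (intro always_eventually) (auto simp: f_def abs_mult intro!: mult_left_mono)
    show "summable (\<lambda>j. r j * K)" by (intro summable_mult2 r)
  qed auto
  moreover have "suminf (\<lambda>j. f j k) = (\<Sum>i\<le>h k. e i)" for k
    by (subst suminf_finite[of "{..h k}"]) (auto simp: f_def renewal_sum[OF r(2) eq, symmetric])
  moreover have "(\<lambda>k. \<Sum>i\<le>h k. e i) \<longlonglongrightarrow> suminf e"
    using filterlim_compose[OF summable_LIMSEQ'[OF e] hf] by simp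
  ultimately have "suminf (\<lambda>j. r j * \<alpha>) = suminf e" using LIMSEQ_unique by auto
  then show ?thesis using suminf_mult2[OF r(1), of \<alpha>] by (simp add: mult.commute)
qed

lemma bounded_upper_limit:
  fixes a :: "nat \<Rightarrow> real"
  assumes "bounded (range a)"
  obtains \<alpha> h where "\<And>\<epsilon>. 0 < \<epsilon> \<Longrightarrow> eventually (\<lambda>n. a n < \<alpha> + \<epsilon>) sequentially"
    "strict_mono h" "(\<lambda>k. a (h k)) \<longlonglongrightarrow> \<alpha>"
proof -
  obtain K where K: "\<And>n. \<bar>a n\<bar> \<le> K" using assms by (auto simp: bounded_iff)
  let ?L = "limsup (\<lambda>n. ereal (a n))"
  have "?L \<le> ereal K" using K by (intro Limsup_bounded) (auto simp: abs_le_iff)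
  moreover have "ereal (- K) \<le> ?L" using K
    by (intro le_Limsup) (auto intro!: always_eventually simp: abs_le_iff minus_le_iff)
  ultimately obtain \<alpha> where \<alpha>: "?L = ereal \<alpha>" by (cases ?L) auto
  obtain h where h: "strict_mono h" "((\<lambda>n. ereal (a n)) \<circ> h) \<longlonglongrightarrow> ?L"
    using limsup_subseq_lim by blast
  show ?thesis
  proof (rule that[OF _ h(1)])
    show "(\<lambda>k. a (h k)) \<longlonglongrightarrow> \<alpha>" using h(2) by (simp add: \<alpha> comp_def)
    fix \<epsilon> :: real assume "0 < \<epsilon>"
    then have "?L < ereal (\<alpha> + \<epsilon>)" by (simp add: \<alpha>)
    from Limsup_lessD[OF this] show "eventually (\<lambda>n. a n < \<alpha> + \<epsilon>) sequentially" by simp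
  qed
qed

text \<open>The upper limit of \<open>a\<close> and that of \<open>- a\<close> are both determined
  by the conserved sum. As \<open>suminf r \<ge> 1\<close>, they are opposite, so the upper and
  lower limits of \<open>a\<close> agree.\<close>

theorem renewal_convergence:
  fixes a e r :: "nat \<Rightarrow> real"
  assumes a: "bounded (range a)"
    and r: "summable r" "r 0 = 1" "\<And>j. r (Suc j) \<le> r j" "r 1 < 1"
    and e: "summable e"
    and eq: "\<And>n. a n = e n + (\<Sum>j<n. (r j - r (Suc j)) * a (n - 1 - j))"
  shows "convergent a"
proof -
  obtain \<alpha> h where A: "\<And>\<epsilon>. 0 < \<epsilon> \<Longrightarrow> eventually (\<lambda>n. a n < \<alpha> + \<epsilon>) sequentially"
    "strict_mono h" "(\<lambda>k. a (h k)) \<longlonglongrightarrow> \<alpha>"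
    using bounded_upper_limit[OF a] by blast
  have "bounded (range (\<lambda>n. - a n))" using a by (auto simp: bounded_iff)
  from bounded_upper_limit[OF this] obtain \<alpha>' h' where
    B: "\<And>\<epsilon>. 0 < \<epsilon> \<Longrightarrow> eventually (\<lambda>n. - a n < \<alpha>' + \<epsilon>) sequentially"
    "strict_mono h'" "(\<lambda>k. - a (h' k)) \<longlonglongrightarrow> \<alpha>'" by blast
  have 1: "\<alpha> * suminf r = suminf e" by (rule renewal_upper_limit[OF a r e eq A])
  have "\<alpha>' * suminf r = suminf (\<lambda>n. - e n)"
  proof (rule renewal_upper_limit[OF _ r _ _ B])
    show "bounded (range (\<lambda>n. - a n))" by fact
    show "summable (\<lambda>n. - e n)" using e by (rule summable_minus)
    show "- a n = - e n + (\<Sum>j<n. (r j - r (Suc j)) * - a (n - 1 - j))" for n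
      by (subst eq) (simp add: sum_negf)
  qed
  then have 2: "\<alpha>' * suminf r = - suminf e" by (simp add: suminf_minus[OF e])
  have "1 \<le> suminf r"
  proof -
    have "decseq r" using r(3) by (rule decseq_SucI)
    then have "0 \<le> r j" for j
      using summable_LIMSEQ_zero[OF r(1)] by (rule decseq_ge)
    then show ?thesis using sum_le_suminf[OF r(1), of "{0}"] r(2) by simp
  qed
  moreover have "(\<alpha> + \<alpha>') * suminf r = 0" using 1 2 by (simp add: algebra_simps)
  ultimately have "\<alpha>' = - \<alpha>" by (auto simp: add_eq_0_iff)
  have "a \<longlonglongrightarrow> \<alpha>"
  proof (rule LIMSEQ_I)
    fix \<epsilon> :: real assume "0 < \<epsilon>"
    from eventually_conj[OF A(1)[OF this] B(1)[OF this]]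
    show "\<exists>no. \<forall>n\<ge>no. norm (a n - \<alpha>) < \<epsilon>"
      by (auto simp: eventually_sequentially \<open>\<alpha>' = - \<alpha>\<close> abs_less_iff algebra_simps)
  qed
  then show ?thesis by (auto simp: convergent_def)
qed

section \<open>Chains with a minorization\<close>

lemma tendsto_zero_of_suminf_finite:
  fixes f :: "nat \<Rightarrow> ennreal"
  assumes "suminf f < \<infinity>"
  shows "f \<longlonglongrightarrow> 0"
proof -
  have S: "(\<lambda>n. \<Sum>j<n. f j) \<longlonglongrightarrow> suminf f" by (intro summable_LIMSEQ) auto
  have "(\<Sum>j<n. f j) < \<infinity>" for n
    using assms by (intro le_less_trans[OF sum_le_suminf]) auto
  then have "(\<Sum>j<Suc n. f j) - (\<Sum>j<n. f j) = f n" for n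
    by (simp add: less_top[symmetric])
  moreover have "(\<lambda>n. (\<Sum>j<Suc n. f j) - (\<Sum>j<n. f j)) \<longlonglongrightarrow> suminf f - suminf f"
    using assms by (intro tendsto_diff_ennreal S LIMSEQ_Suc[OF S]) auto
  ultimately show ?thesis using assms by simp
qed

text \<open>\<open>T\<close> is the chain killed with probability \<open>s x\<close>, after which it
  restarts from \<open>\<nu>\<close>; \<open>T_s\<close> says that no other mass is lost. Series in
  powers of \<open>T\<close> are thus sums over a single regeneration cycle.\<close>

locale minorized_chain =
  fixes T :: "'a::topological_space \<Rightarrow> 'a measure" and s :: "'a \<Rightarrow> ennreal" and \<nu> :: "'a measure"
  assumes T[measurable]: "T \<in> borel \<rightarrow>\<^sub>M subprob_algebra borel"
    and s[measurable]: "s \<in> borel_measurable borel"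
    and sets_nu[measurable_cong]: "sets \<nu> = sets borel"
    and nu_space: "emeasure \<nu> UNIV = 1"
    and T_s: "\<And>x. emeasure (T x) UNIV + s x = 1"
begin

definition taboo :: "('a \<Rightarrow> ennreal) \<Rightarrow> 'a \<Rightarrow> ennreal" where
  "taboo f x = (\<integral>\<^sup>+y. f y \<partial>T x)"

definition potential :: "('a \<Rightarrow> ennreal) \<Rightarrow> 'a \<Rightarrow> ennreal" where
  "potential f x = (\<Sum>n. (taboo ^^ n) f x)"

lemma sets_T[measurable_cong]: "sets (T x) = sets borel"
  using subprob_measurableD(2)[OF T] by simp

lemma space_nu[simp]: "space \<nu> = UNIV"
  using sets_eq_imp_space_eq[OF sets_nu] by simp

lemma space_T[simp]: "space (T x) = UNIV"
  using sets_eq_imp_space_eq[OF sets_T[of x]] by simp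

lemma measurable_taboo[measurable]:
  "f \<in> borel_measurable borel \<Longrightarrow> taboo f \<in> borel_measurable borel"
  unfolding taboo_def[abs_def] by (rule nn_integral_measurable_subprob_algebra2[OF _ T]) simp

lemma measurable_taboo_iterate[measurable]:
  "f \<in> borel_measurable borel \<Longrightarrow> (taboo ^^ n) f \<in> borel_measurable borel"
  by (induction n) auto

lemma measurable_potential[measurable]:
  "f \<in> borel_measurable borel \<Longrightarrow> potential f \<in> borel_measurable borel"
  unfolding potential_def[abs_def] by measurable

lemma taboo_mono: "(\<And>x. f x \<le> g x) \<Longrightarrow> taboo f x \<le> taboo g x"
  unfolding taboo_def by (intro nn_integral_mono)

lemma taboo_iterate_mono: "(\<And>x. f x \<le> g x) \<Longrightarrow> (taboo ^^ n) f x \<le> (taboo ^^ n) g x"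
  by (induction n arbitrary: x) (auto intro: taboo_mono)

lemma potential_mono: "(\<And>x. f x \<le> g x) \<Longrightarrow> potential f x \<le> potential g x"
  unfolding potential_def by (intro suminf_le taboo_iterate_mono) auto

lemma taboo_add:
  "f \<in> borel_measurable borel \<Longrightarrow> g \<in> borel_measurable borel \<Longrightarrow>
    taboo (\<lambda>x. f x + g x) = (\<lambda>x. taboo f x + taboo g x)"
  unfolding taboo_def by (intro ext nn_integral_add) auto

lemma taboo_cmult:
  "f \<in> borel_measurable borel \<Longrightarrow> taboo (\<lambda>x. c * f x) = (\<lambda>x. c * taboo f x)"
  unfolding taboo_def by (intro ext nn_integral_cmult) auto

lemma taboo_suminf:
  "(\<And>k::nat. f k \<in> borel_measurable borel) \<Longrightarrow> taboo (\<lambda>x. \<Sum>k. f k x) = (\<lambda>x. \<Sum>k. taboo (f k) x)"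
  unfolding taboo_def by (intro ext nn_integral_suminf) auto

lemma taboo_sum:
  "(\<And>k. k \<in> I \<Longrightarrow> f k \<in> borel_measurable borel) \<Longrightarrow> taboo (\<lambda>x. \<Sum>k\<in>I. f k x) = (\<lambda>x. \<Sum>k\<in>I. taboo (f k) x)"
  unfolding taboo_def by (intro ext nn_integral_sum) auto

lemma taboo_iterate_add:
  "f \<in> borel_measurable borel \<Longrightarrow> g \<in> borel_measurable borel \<Longrightarrow>
    (taboo ^^ n) (\<lambda>x. f x + g x) = (\<lambda>x. (taboo ^^ n) f x + (taboo ^^ n) g x)"
  by (induction n) (auto simp: taboo_add)

lemma taboo_iterate_cmult:
  "f \<in> borel_measurable borel \<Longrightarrow> (taboo ^^ n) (\<lambda>x. c * f x) = (\<lambda>x. c * (taboo ^^ n) f x)"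
  by (induction n) (auto simp: taboo_cmult)

lemma taboo_iterate_suminf:
  "(\<And>k::nat. f k \<in> borel_measurable borel) \<Longrightarrow>
    (taboo ^^ n) (\<lambda>x. \<Sum>k. f k x) = (\<lambda>x. \<Sum>k. (taboo ^^ n) (f k) x)"
  by (induction n) (auto simp: taboo_suminf)

lemma potential_add:
  "f \<in> borel_measurable borel \<Longrightarrow> g \<in> borel_measurable borel \<Longrightarrow>
    potential (\<lambda>x. f x + g x) x = potential f x + potential g x"
  by (simp add: potential_def taboo_iterate_add suminf_add)

lemma potential_cmult:
  "f \<in> borel_measurable borel \<Longrightarrow> potential (\<lambda>x. c * f x) x = c * potential f x"
  by (simp add: potential_def taboo_iterate_cmult)

text \<open>The tail of the series is \<open>T^n\<close> applied to the whole potential, so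
  \<open>T^n (U f)\<close> is both bounded by \<open>U f\<close> and a vanishing remainder where
  \<open>U f\<close> is finite.\<close>

lemma potential_unfold_n:
  assumes f: "f \<in> borel_measurable borel"
  shows "potential f x = (\<Sum>j<n. (taboo ^^ j) f x) + (taboo ^^ n) (potential f) x"
proof -
  have "potential f = (\<lambda>x. \<Sum>k. (taboo ^^ k) f x)" by (auto simp: potential_def)
  moreover have "(taboo ^^ n) ((taboo ^^ k) f) = (taboo ^^ (k + n)) f" for k
    by (metis add.commute comp_apply funpow_add)
  ultimately have "(taboo ^^ n) (potential f) x = (\<Sum>k. (taboo ^^ (k + n)) f x)"
    using f by (simp add: taboo_iterate_suminf)
  moreover have "potential f x = (\<Sum>k. (taboo ^^ (k + n)) f x) + (\<Sum>j<n. (taboo ^^ j) f x)"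
    unfolding potential_def by (rule suminf_offset[OF summableI])
  ultimately show ?thesis by (simp only: add.commute)
qed

lemma taboo_iterate_potential_le:
  "f \<in> borel_measurable borel \<Longrightarrow> (taboo ^^ n) (potential f) x \<le> potential f x"
  by (subst potential_unfold_n[of f _ n]) auto

lemma partial_sums_le_potential: "(\<Sum>j<n. (taboo ^^ j) f x) \<le> potential f x"
  unfolding potential_def by (intro sum_le_suminf) auto

lemma partial_sums_tendsto_potential: "(\<lambda>n. \<Sum>j<n. (taboo ^^ j) f x) \<longlonglongrightarrow> potential f x"
  unfolding potential_def by (intro summable_LIMSEQ) auto

lemma taboo_one: "taboo (\<lambda>_. 1) x + s x = 1"
  using T_s[of x] by (simp add: taboo_def)

lemma taboo_iterate_Suc_inner: "(taboo ^^ Suc n) f = (taboo ^^ n) (taboo f)"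
  by (simp only: funpow_Suc_right comp_apply)

text \<open>Either the chain survives \<open>n\<close> steps or it was killed at one of them;
  formally \<open>T 1 + s = 1\<close> telescopes.\<close>

lemma taboo_iterate_one: "(taboo ^^ n) (\<lambda>_. 1) x + (\<Sum>j<n. (taboo ^^ j) s x) = 1"
proof (induction n)
  case (Suc n)
  have "(taboo ^^ n) (\<lambda>_. 1) = (taboo ^^ n) (\<lambda>x. taboo (\<lambda>_. 1) x + s x)"
    by (simp add: taboo_one)
  also have "\<dots> = (\<lambda>x. (taboo ^^ Suc n) (\<lambda>_. 1) x + (taboo ^^ n) s x)"
    unfolding taboo_iterate_Suc_inner by (subst taboo_iterate_add) simp_all
  finally have "(taboo ^^ n) (\<lambda>_. 1) x = (taboo ^^ Suc n) (\<lambda>_. 1) x + (taboo ^^ n) s x" by (rule fun_cong)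
  then show ?case using Suc by (simp only: sum.lessThan_Suc ac_simps)
qed auto

lemma potential_s_le: "potential s x \<le> 1"
  unfolding potential_def
proof (intro suminf_le_const summableI)
  show "(\<Sum>j<n. (taboo ^^ j) s x) \<le> 1" for n
    using add_increasing[OF zero_le order_refl, of "\<Sum>j<n. (taboo ^^ j) s x" "(taboo ^^ n) (\<lambda>_. 1) x"]
    by (simp only: taboo_iterate_one)
qed

text \<open>Variation of constants for a step with loss \<open>d\<close> and input \<open>h\<close>.
  Keeping the losses on the left makes the identity valid even for infinite values. The induction
  peels \<open>T\<close> off in front, hence the general \<open>x\<close>.\<close>

lemma unroll:
  assumes G: "\<And>n. G n \<in> borel_measurable borel" and d: "\<And>n. d n \<in> borel_measurable borel"
    and h: "\<And>n. h n \<in> borel_measurable borel"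
    and eq: "\<And>n x. G (Suc n) x + d (Suc n) x = taboo (G n) x + h n x"
  shows "G n x + (\<Sum>j<n. (taboo ^^ j) (d (n - j)) x) =
    (taboo ^^ n) (G 0) x + (\<Sum>j<n. (taboo ^^ j) (h (n - 1 - j)) x)"
proof (induction n arbitrary: x)
  case (Suc n)
  have "G (Suc n) x + (\<Sum>j<Suc n. (taboo ^^ j) (d (Suc n - j)) x) =
      (G (Suc n) x + d (Suc n) x) + taboo (\<lambda>x. \<Sum>j<n. (taboo ^^ j) (d (n - j)) x) x"
  proof -
    have "taboo (\<lambda>x. \<Sum>j<n. (taboo ^^ j) (d (n - j)) x) x = (\<Sum>j<n. taboo ((taboo ^^ j) (d (n - j))) x)"
      by (subst taboo_sum) (auto intro: measurable_taboo_iterate d)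
    then show ?thesis by (subst sum.lessThan_Suc_shift) (simp add: add.assoc)
  qed
  also have "\<dots> = taboo (\<lambda>x. G n x + (\<Sum>j<n. (taboo ^^ j) (d (n - j)) x)) x + h n x"
  proof -
    have "taboo (\<lambda>x. G n x + (\<Sum>j<n. (taboo ^^ j) (d (n - j)) x)) x =
        taboo (G n) x + taboo (\<lambda>x. \<Sum>j<n. (taboo ^^ j) (d (n - j)) x) x"
      using d by (subst taboo_add) (auto simp: G)
    then show ?thesis by (simp only: eq ac_simps)
  qed
  also have "\<dots> = taboo (\<lambda>x. (taboo ^^ n) (G 0) x + (\<Sum>j<n. (taboo ^^ j) (h (n - 1 - j)) x)) x + h n x"
    by (simp only: Suc)
  also have "\<dots> = (taboo ^^ Suc n) (G 0) x + (\<Sum>j<Suc n. (taboo ^^ j) (h (Suc n - 1 - j)) x)"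
  proof -
    have "taboo (\<lambda>x. (taboo ^^ n) (G 0) x + (\<Sum>j<n. (taboo ^^ j) (h (n - 1 - j)) x)) x =
        taboo ((taboo ^^ n) (G 0)) x + taboo (\<lambda>x. \<Sum>j<n. (taboo ^^ j) (h (n - 1 - j)) x) x"
      using h by (subst taboo_add) (auto intro: measurable_taboo_iterate G)
    moreover have "taboo (\<lambda>x. \<Sum>j<n. (taboo ^^ j) (h (n - 1 - j)) x) x = (\<Sum>j<n. taboo ((taboo ^^ j) (h (n - 1 - j))) x)"
      by (subst taboo_sum) (auto intro: measurable_taboo_iterate h)
    ultimately show ?thesis by (subst sum.lessThan_Suc_shift) (simp add: ac_simps)
  qed
  finally show ?case .
qed simp

text \<open>Time-independent form of \<open>unroll\<close> for inequalities. Applying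
  \<open>T^n\<close> to the one-step inequality and adding it to the previous bound only rearranges
  terms, so nothing has to be cancelled in \<open>ennreal\<close>.\<close>

lemma unroll_le:
  assumes G: "G \<in> borel_measurable borel" and d: "d \<in> borel_measurable borel"
    and h: "h \<in> borel_measurable borel"
    and le: "\<And>x. G x + d x \<le> taboo G x + h x"
  shows "G x + (\<Sum>j<n. (taboo ^^ j) d x) \<le> (taboo ^^ n) G x + (\<Sum>j<n. (taboo ^^ j) h x)"
proof (induction n)
  case (Suc n)
  have "(taboo ^^ n) (\<lambda>x. G x + d x) x \<le> (taboo ^^ n) (\<lambda>x. taboo G x + h x) x"
    by (intro taboo_iterate_mono le)
  then have "(taboo ^^ n) G x + (taboo ^^ n) d x \<le> (taboo ^^ Suc n) G x + (taboo ^^ n) h x"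
    using G d h by (simp only: taboo_iterate_add measurable_taboo taboo_iterate_Suc_inner)
  from add_mono[OF Suc add_right_mono[OF this]]
  have "G x + (\<Sum>j<n. (taboo ^^ j) d x) + (taboo ^^ n) d x \<le> (taboo ^^ n) G x + (\<Sum>j<n. (taboo ^^ j) h x) + (taboo ^^ n) d x"
    using Suc by (intro add_right_mono)
  also have "\<dots> = (taboo ^^ n) G x + (taboo ^^ n) d x + (\<Sum>j<n. (taboo ^^ j) h x)" by (simp add: ac_simps)
  also have "\<dots> \<le> (taboo ^^ Suc n) G x + (taboo ^^ n) h x + (\<Sum>j<n. (taboo ^^ j) h x)"
    by (rule add_right_mono) fact
  finally show ?case by (simp add: ac_simps)
qed simp

lemma unroll_ge:
  assumes G: "G \<in> borel_measurable borel" and d: "d \<in> borel_measurable borel"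
    and h: "h \<in> borel_measurable borel"
    and le: "\<And>x. taboo G x + h x \<le> G x + d x"
  shows "(taboo ^^ n) G x + (\<Sum>j<n. (taboo ^^ j) h x) \<le> G x + (\<Sum>j<n. (taboo ^^ j) d x)"
proof (induction n)
  case (Suc n)
  have "(taboo ^^ n) (\<lambda>x. taboo G x + h x) x \<le> (taboo ^^ n) (\<lambda>x. G x + d x) x"
    by (intro taboo_iterate_mono le)
  then have *: "(taboo ^^ Suc n) G x + (taboo ^^ n) h x \<le> (taboo ^^ n) G x + (taboo ^^ n) d x"
    using G d h by (simp only: taboo_iterate_add measurable_taboo taboo_iterate_Suc_inner)
  have "(taboo ^^ Suc n) G x + (taboo ^^ n) h x + (\<Sum>j<n. (taboo ^^ j) h x)
     \<le> (taboo ^^ n) G x + (taboo ^^ n) d x + (\<Sum>j<n. (taboo ^^ j) h x)"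
    by (rule add_right_mono) fact
  also have "\<dots> = (taboo ^^ n) G x + (\<Sum>j<n. (taboo ^^ j) h x) + (taboo ^^ n) d x" by (simp add: ac_simps)
  also have "\<dots> \<le> G x + (\<Sum>j<n. (taboo ^^ j) d x) + (taboo ^^ n) d x"
    using Suc by (intro add_right_mono)
  finally show ?case by (simp add: ac_simps)
qed simp

text \<open>Summing the drift along \<open>T\<close>, the regeneration term costs at most
  \<open>k\<close> in total, because a cycle regenerates at most once:
  \<open>U s \<le> 1\<close>.\<close>

lemma Lyapunov_potential_bound:
  assumes V[measurable]: "V \<in> borel_measurable borel"
    and drift: "\<And>x. taboo V x + \<epsilon> \<le> V x + k * s x"
  shows "\<epsilon> * potential (\<lambda>_. 1) x \<le> V x + k"
proof -
  have "\<epsilon> * (\<Sum>j<n. (taboo ^^ j) (\<lambda>_. 1) x) \<le> V x + k" for n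
  proof -
    have "(\<Sum>j<n. (taboo ^^ j) (\<lambda>_. \<epsilon> * 1) x) \<le> (taboo ^^ n) V x + (\<Sum>j<n. (taboo ^^ j) (\<lambda>_. \<epsilon> * 1) x)"
      by simp
    also have "\<dots> \<le> V x + (\<Sum>j<n. (taboo ^^ j) (\<lambda>x. k * s x) x)"
      by (intro unroll_ge) (auto simp: drift)
    also have "(\<Sum>j<n. (taboo ^^ j) (\<lambda>x. k * s x) x) = k * (\<Sum>j<n. (taboo ^^ j) s x)"
      by (subst taboo_iterate_cmult) (auto simp: sum_distrib_left)
    also have "\<dots> \<le> k * 1"
      by (intro mult_left_mono order_trans[OF partial_sums_le_potential potential_s_le]) auto
    also have "(\<Sum>j<n. (taboo ^^ j) (\<lambda>_. \<epsilon> * 1) x) = \<epsilon> * (\<Sum>j<n. (taboo ^^ j) (\<lambda>_. 1) x)"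
      by (subst taboo_iterate_cmult) (auto simp: sum_distrib_left)
    finally show ?thesis by simp
  qed
  moreover have "\<epsilon> * potential (\<lambda>_. 1) x = (\<Sum>j. \<epsilon> * (taboo ^^ j) (\<lambda>_. 1) x)"
    by (simp add: potential_def)
  ultimately show ?thesis
    by (simp only:) (intro suminf_le_const summableI, simp add: sum_distrib_left)
qed

lemma taboo_iterate_one_tendsto:
  "potential (\<lambda>_. 1) x < \<infinity> \<Longrightarrow> (\<lambda>n. (taboo ^^ n) (\<lambda>_. 1) x) \<longlonglongrightarrow> 0"
  unfolding potential_def by (rule tendsto_zero_of_suminf_finite)

text \<open>If the expected cycle length is finite, the survival probability tends to 0, so
  regeneration is certain.\<close>

lemma potential_s:
  assumes "potential (\<lambda>_. 1) x < \<infinity>"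
  shows "potential s x = 1"
proof -
  have "(\<lambda>n. (taboo ^^ n) (\<lambda>_. 1) x + (\<Sum>j<n. (taboo ^^ j) s x)) \<longlonglongrightarrow> 0 + potential s x"
    by (intro tendsto_add partial_sums_tendsto_potential taboo_iterate_one_tendsto assms)
  then show ?thesis by (simp add: taboo_iterate_one LIMSEQ_const_iff)
qed

lemma taboo_iterate_potential_tendsto:
  assumes f: "f \<in> borel_measurable borel" and fin: "potential f x < \<infinity>"
  shows "(\<lambda>n. (taboo ^^ n) (potential f) x) \<longlonglongrightarrow> 0"
proof -
  have "(taboo ^^ n) (potential f) x = potential f x - (\<Sum>j<n. (taboo ^^ j) f x)" for n
  proof -
    have "(\<Sum>j<n. (taboo ^^ j) f x) < \<infinity>"
      using partial_sums_le_potential fin by (rule le_less_trans)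
    then show ?thesis using potential_unfold_n[OF f, of x n] by (simp add: less_top[symmetric])
  qed
  moreover have "(\<lambda>n. potential f x - (\<Sum>j<n. (taboo ^^ j) f x)) \<longlonglongrightarrow> potential f x - potential f x"
    using fin by (intro tendsto_diff_ennreal tendsto_const partial_sums_tendsto_potential) auto
  ultimately show ?thesis using fin by simp
qed

end

text \<open>Exchange of the two sums. Only an inequality results, since the arguments
  \<open>n - j\<close> with \<open>j < n\<close> never reach 0.\<close>

lemma convolution_suminf_le:
  fixes F :: "nat \<Rightarrow> nat \<Rightarrow> ennreal"
  shows "(\<Sum>n. \<Sum>j<n. F j (n - j)) \<le> (\<Sum>j. \<Sum>k. F j k)"
proof -
  define g where "g j n = (if j < n then F j (n - j) else 0)" for j n
  have "(\<Sum>j<n. F j (n - j)) = (\<Sum>j. g j n)" for n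
    by (subst suminf_finite[of "{..<n}"]) (auto simp: g_def)
  then have "(\<Sum>n. \<Sum>j<n. F j (n - j)) = (\<Sum>n. \<Sum>j. g j n)" by simp
  also have "\<dots> = (\<Sum>j. \<Sum>n. g j n)"
    using nn_integral_suminf[of g "count_space UNIV"]
    unfolding nn_integral_count_space_nat by simp
  also have "\<dots> \<le> (\<Sum>j. \<Sum>k. F j k)"
  proof (rule suminf_le[OF _ summableI summableI])
    fix j
    have "(\<Sum>n. g j n) = (\<Sum>n. g j (n + j)) + (\<Sum>n<j. g j n)" by (rule suminf_offset[OF summableI])
    also have "(\<Sum>n<j. g j n) = 0" by (auto simp: g_def)
    also have "(\<Sum>n. g j (n + j)) + 0 \<le> (\<Sum>k. F j k)"
      by (auto simp: g_def intro!: suminf_le)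
    finally show "(\<Sum>n. g j n) \<le> (\<Sum>k. F j k)" .
  qed
  finally show ?thesis .
qed

lemma summable_enn2real:
  assumes "suminf u < (\<infinity>::ennreal)"
  shows "summable (\<lambda>n. enn2real (u n))"
proof (rule summable_suminf_not_top)
  have "u n < \<top>" for n
    using assms sum_le_suminf[of u "{n}"] by (auto intro: le_less_trans)
  then have "ennreal (enn2real (u n)) = u n" for n by simp
  then show "(\<Sum>n. ennreal (enn2real (u n))) \<noteq> \<top>" using assms by simp
qed simp

text \<open>\<open>invariant\<close> is invariance under the full kernel, written through its
  splitting. \<open>nu_s\<close> allows a regeneration one step after another, which is the
  aperiodicity behind \<open>r 1 < 1\<close>.\<close>

locale invariant_chain = minorized_chain +
  fixes \<pi> :: "'a measure"
  assumes sets_pi[measurable_cong]: "sets \<pi> = sets borel"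
    and pi_space: "emeasure \<pi> UNIV = 1"
    and invariant: "\<And>f. f \<in> borel_measurable borel \<Longrightarrow>
      (\<integral>\<^sup>+x. f x \<partial>\<pi>) = (\<integral>\<^sup>+x. taboo f x \<partial>\<pi>) + (\<integral>\<^sup>+x. s x \<partial>\<pi>) * (\<integral>\<^sup>+x. f x \<partial>\<nu>)"
    and nu_s: "0 < (\<integral>\<^sup>+x. s x \<partial>\<nu>)"
    and potential_one: "\<And>x. potential (\<lambda>_. 1) x < \<infinity>"
    and pi_potential_one: "(\<integral>\<^sup>+x. potential (\<lambda>_. 1) x \<partial>\<pi>) < \<infinity>"
begin

section \<open>The cycle formula for the invariant measure\<close>

lemma space_pi[simp]: "space \<pi> = UNIV"
  using sets_eq_imp_space_eq[OF sets_pi] by simp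

text \<open>Under stationarity, the last regeneration lies either at least \<open>n\<close> steps
  back or at a definite one of the last \<open>n\<close> steps.\<close>

lemma invariant_n:
  assumes f: "f \<in> borel_measurable borel"
  shows "(\<integral>\<^sup>+x. f x \<partial>\<pi>) = (\<integral>\<^sup>+x. (taboo ^^ n) f x \<partial>\<pi>) +
    (\<integral>\<^sup>+x. s x \<partial>\<pi>) * (\<Sum>j<n. \<integral>\<^sup>+x. (taboo ^^ j) f x \<partial>\<nu>)"
proof (induction n)
  case (Suc n)
  then show ?case using invariant[OF measurable_taboo_iterate[OF f], of n]
    by (simp add: distrib_left ac_simps)
qed simp

lemma nu_potential_eq:
  "f \<in> borel_measurable borel \<Longrightarrow> (\<integral>\<^sup>+x. potential f x \<partial>\<nu>) = (\<Sum>j. \<integral>\<^sup>+x. (taboo ^^ j) f x \<partial>\<nu>)"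
  unfolding potential_def by (intro nn_integral_suminf) auto

lemma nu_potential_le:
  assumes f: "f \<in> borel_measurable borel"
  shows "(\<integral>\<^sup>+x. s x \<partial>\<pi>) * (\<integral>\<^sup>+x. potential f x \<partial>\<nu>) \<le> (\<integral>\<^sup>+x. f x \<partial>\<pi>)"
proof -
  have "(\<integral>\<^sup>+x. s x \<partial>\<pi>) * (\<Sum>j<n. \<integral>\<^sup>+x. (taboo ^^ j) f x \<partial>\<nu>) \<le> (\<integral>\<^sup>+x. f x \<partial>\<pi>)" for n
    by (subst invariant_n[OF f, of n]) (simp add: add_increasing)
  then show ?thesis
    unfolding nu_potential_eq[OF f] ennreal_suminf_cmult[symmetric]
    by (intro suminf_le_const summableI) (simp add: sum_distrib_left)
qed

lemma nu_le:
  assumes f: "f \<in> borel_measurable borel"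
  shows "(\<integral>\<^sup>+x. s x \<partial>\<pi>) * (\<integral>\<^sup>+x. f x \<partial>\<nu>) \<le> (\<integral>\<^sup>+x. f x \<partial>\<pi>)"
  by (subst invariant[OF f]) (simp add: add_increasing)

lemma pi_one_tendsto: "(\<lambda>n. \<integral>\<^sup>+x. (taboo ^^ n) (\<lambda>_. 1) x \<partial>\<pi>) \<longlonglongrightarrow> 0"
proof (rule tendsto_zero_of_suminf_finite)
  have "(\<Sum>n. \<integral>\<^sup>+x. (taboo ^^ n) (\<lambda>_. 1) x \<partial>\<pi>) = (\<integral>\<^sup>+x. potential (\<lambda>_. 1) x \<partial>\<pi>)"
    unfolding potential_def by (intro nn_integral_suminf[symmetric]) auto
  then show "(\<Sum>n. \<integral>\<^sup>+x. (taboo ^^ n) (\<lambda>_. 1) x \<partial>\<pi>) < \<infinity>" using pi_potential_one by simp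
qed

text \<open>Were \<open>\<pi>(s) = 0\<close>, invariance would give \<open>\<pi>(T^n 1) = 1\<close>
  for all \<open>n\<close>, against the integrability of the cycle length.\<close>

lemma pi_s_pos: "0 < (\<integral>\<^sup>+x. s x \<partial>\<pi>)"
proof (rule ccontr)
  assume "\<not> ?thesis"
  then have 0: "(\<integral>\<^sup>+x. s x \<partial>\<pi>) = 0" by simp
  have "(\<integral>\<^sup>+x. (taboo ^^ n) (\<lambda>_. 1) x \<partial>\<pi>) = 1" for n
    using invariant_n[of "\<lambda>_. 1" n] by (simp add: 0 pi_space)
  then show False using pi_one_tendsto by (simp add: LIMSEQ_const_iff)
qed

lemma s_le_1: "s x \<le> 1"
  using T_s[of x] by (metis add_increasing zero_le order_refl)

lemma pi_s_le_1: "(\<integral>\<^sup>+x. s x \<partial>\<pi>) \<le> 1"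
  using nn_integral_mono[of \<pi> s "\<lambda>_. 1"] by (simp add: s_le_1 pi_space)

lemma finite_of_pi_s_mult:
  assumes "(\<integral>\<^sup>+x. s x \<partial>\<pi>) * c \<le> b" "b < \<infinity>"
  shows "c < \<infinity>"
  using assms pi_s_pos by (auto simp: less_top[symmetric] top_unique ennreal_mult_eq_top_iff)

text \<open>Kac's cycle formula: up to the factor \<open>\<pi>(s)\<close>, the invariant measure is
  the expected occupation measure of a cycle started from \<open>\<nu>\<close>. What must be shown
  is that the remainder \<open>\<pi>(T^n f)\<close> in \<open>invariant_n\<close> vanishes.\<close>

lemma pi_eq_nu_potential:
  assumes f[measurable]: "f \<in> borel_measurable borel"
  shows "(\<integral>\<^sup>+x. f x \<partial>\<pi>) = (\<integral>\<^sup>+x. s x \<partial>\<pi>) * (\<integral>\<^sup>+x. potential f x \<partial>\<nu>)"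
proof (rule antisym)
  show "(\<integral>\<^sup>+x. s x \<partial>\<pi>) * (\<integral>\<^sup>+x. potential f x \<partial>\<nu>) \<le> (\<integral>\<^sup>+x. f x \<partial>\<pi>)"
    by (rule nu_potential_le) fact
  \<comment> \<open>Truncation at \<open>N\<close> bounds the remainder by \<open>N\<close> times
    \<open>\<pi>(T^n 1)\<close>, which tends to 0; monotone convergence then removes
    \<open>N\<close>.\<close>
  define g where "g N x = min (of_nat N) (f x)" for N :: nat and x
  have g[measurable]: "g N \<in> borel_measurable borel" for N unfolding g_def[abs_def] by measurable
  have "(\<integral>\<^sup>+x. g N x \<partial>\<pi>) \<le> (\<integral>\<^sup>+x. s x \<partial>\<pi>) * (\<integral>\<^sup>+x. potential f x \<partial>\<nu>)" for N
  proof -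
    have "(\<integral>\<^sup>+x. (taboo ^^ n) (g N) x \<partial>\<pi>) \<le> of_nat N * (\<integral>\<^sup>+x. (taboo ^^ n) (\<lambda>_. 1) x \<partial>\<pi>)" for n
    proof -
      have "(taboo ^^ n) (g N) x \<le> (taboo ^^ n) (\<lambda>_. of_nat N * 1) x" for x
        by (intro taboo_iterate_mono) (simp add: g_def)
      then have "(\<integral>\<^sup>+x. (taboo ^^ n) (g N) x \<partial>\<pi>) \<le> (\<integral>\<^sup>+x. of_nat N * (taboo ^^ n) (\<lambda>_. 1) x \<partial>\<pi>)"
        by (intro nn_integral_mono) (simp only: taboo_iterate_cmult borel_measurable_const)
      then show ?thesis by (simp add: nn_integral_cmult)
    qed
    moreover have "(\<Sum>j<n. \<integral>\<^sup>+x. (taboo ^^ j) (g N) x \<partial>\<nu>) \<le> (\<integral>\<^sup>+x. potential f x \<partial>\<nu>)" for n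
    proof -
      have "(\<Sum>j<n. \<integral>\<^sup>+x. (taboo ^^ j) (g N) x \<partial>\<nu>) \<le> (\<integral>\<^sup>+x. potential (g N) x \<partial>\<nu>)"
        unfolding nu_potential_eq[OF g] by (intro sum_le_suminf) auto
      also have "\<dots> \<le> (\<integral>\<^sup>+x. potential f x \<partial>\<nu>)"
        by (intro nn_integral_mono potential_mono) (simp add: g_def)
      finally show ?thesis .
    qed
    ultimately have "(\<integral>\<^sup>+x. g N x \<partial>\<pi>) \<le> of_nat N * (\<integral>\<^sup>+x. (taboo ^^ n) (\<lambda>_. 1) x \<partial>\<pi>) +
        (\<integral>\<^sup>+x. s x \<partial>\<pi>) * (\<integral>\<^sup>+x. potential f x \<partial>\<nu>)" for n
      by (subst invariant_n[OF g, of _ n]) (intro add_mono mult_left_mono, auto)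
    moreover have "(\<lambda>n. of_nat N * (\<integral>\<^sup>+x. (taboo ^^ n) (\<lambda>_. 1) x \<partial>\<pi>) +
        (\<integral>\<^sup>+x. s x \<partial>\<pi>) * (\<integral>\<^sup>+x. potential f x \<partial>\<nu>)) \<longlonglongrightarrow>
        of_nat N * 0 + (\<integral>\<^sup>+x. s x \<partial>\<pi>) * (\<integral>\<^sup>+x. potential f x \<partial>\<nu>)"
      by (intro tendsto_add tendsto_const ennreal_tendsto_cmult pi_one_tendsto) (simp add: of_nat_less_top)
    ultimately show ?thesis by (intro LIMSEQ_le_const) auto
  qed
  moreover have "(\<integral>\<^sup>+x. f x \<partial>\<pi>) = (SUP N. \<integral>\<^sup>+x. g N x \<partial>\<pi>)"
  proof -
    have "f x = (SUP N. g N x)" for x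
    proof -
      have "(SUP N. g N x) = min (SUP N. of_nat N) (f x)" unfolding g_def by (simp add: inf_min[symmetric] SUP_inf)
      then show ?thesis by (simp add: ennreal_SUP_of_nat_eq_top)
    qed
    then have "(\<integral>\<^sup>+x. f x \<partial>\<pi>) = (\<integral>\<^sup>+x. (SUP N. g N x) \<partial>\<pi>)" by simp
    also have "\<dots> = (SUP N. \<integral>\<^sup>+x. g N x \<partial>\<pi>)"
      by (intro nn_integral_monotone_convergence_SUP)
        (auto simp: g_def incseq_def le_fun_def min_def intro: order_trans of_nat_mono)
    finally show ?thesis .
  qed
  ultimately show "(\<integral>\<^sup>+x. f x \<partial>\<pi>) \<le> (\<integral>\<^sup>+x. s x \<partial>\<pi>) * (\<integral>\<^sup>+x. potential f x \<partial>\<nu>)"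
    by (auto intro: SUP_least)
qed

text \<open>By the cycle formula the partial sums in \<open>invariant_n\<close> exhaust
  \<open>\<pi>(f)\<close>; as this is finite, the remainder tends to 0.\<close>

lemma pi_taboo_iterate_tendsto:
  assumes f: "f \<in> borel_measurable borel" and fin: "(\<integral>\<^sup>+x. f x \<partial>\<pi>) < \<infinity>"
  shows "(\<lambda>n. \<integral>\<^sup>+x. (taboo ^^ n) f x \<partial>\<pi>) \<longlonglongrightarrow> 0"
proof -
  let ?S = "\<lambda>n. (\<integral>\<^sup>+x. s x \<partial>\<pi>) * (\<Sum>j<n. \<integral>\<^sup>+x. (taboo ^^ j) f x \<partial>\<nu>)"
  have "?S n \<noteq> \<top>" for n
    using invariant_n[OF f, of n] fin by auto
  then have "(\<integral>\<^sup>+x. (taboo ^^ n) f x \<partial>\<pi>) = (\<integral>\<^sup>+x. f x \<partial>\<pi>) - ?S n" for n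
    by (subst invariant_n[OF f, of n]) simp
  moreover have "?S \<longlonglongrightarrow> (\<integral>\<^sup>+x. s x \<partial>\<pi>) * (\<integral>\<^sup>+x. potential f x \<partial>\<nu>)"
    unfolding nu_potential_eq[OF f] using pi_s_le_1
    by (intro ennreal_tendsto_cmult summable_LIMSEQ summableI) (auto intro: le_less_trans)
  then have "(\<lambda>n. (\<integral>\<^sup>+x. f x \<partial>\<pi>) - ?S n) \<longlonglongrightarrow> (\<integral>\<^sup>+x. f x \<partial>\<pi>) - (\<integral>\<^sup>+x. f x \<partial>\<pi>)"
    using fin unfolding pi_eq_nu_potential[OF f, symmetric]
    by (intro tendsto_diff_ennreal tendsto_const) auto
  ultimately show ?thesis using fin by simp
qed

text \<open>Integrability of \<open>U f\<close> is available only under \<open>\<nu>\<close>, not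
  under \<open>\<pi>\<close>. It shows that a cycle from \<open>\<nu>\<close> never meets the set
  \<open>A\<close> where \<open>U f\<close> is infinite, and invariance turns this into
  \<open>\<pi>(A) \<le> \<pi>(T^n 1)\<close> for every \<open>n\<close>.\<close>

lemma AE_potential_finite:
  assumes f[measurable]: "f \<in> borel_measurable borel" and fin: "(\<integral>\<^sup>+x. f x \<partial>\<pi>) < \<infinity>"
  shows "AE x in \<pi>. potential f x < \<infinity>"
proof -
  define A where "A = {x. potential f x = \<infinity>}"
  have A[measurable]: "A \<in> sets borel" unfolding A_def by measurable
  have "(\<integral>\<^sup>+x. potential f x \<partial>\<nu>) < \<infinity>" by (rule finite_of_pi_s_mult[OF nu_potential_le fin]) fact
  \<comment> \<open>\<open>U f\<close> dominates \<open>\<top>\<close> times the indicator of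
    \<open>A\<close>, and \<open>T^j (U f) \<le> U f\<close>; a finite \<open>\<nu>\<close>-integral
    then forces the \<open>\<nu>\<close>-integral of \<open>T^j\<close> of the indicator to be
    0.\<close>
  have nu0: "(\<integral>\<^sup>+x. (taboo ^^ j) (indicator A) x \<partial>\<nu>) = 0" for j
  proof -
    have "\<top> * indicator A x \<le> potential f x" for x by (auto simp: A_def indicator_def)
    then have "(taboo ^^ j) (\<lambda>x. \<top> * indicator A x) x \<le> potential f x" for x
      by (intro order_trans[OF taboo_iterate_mono taboo_iterate_potential_le[OF f, of j]])
    then have "(\<integral>\<^sup>+x. (taboo ^^ j) (\<lambda>x. \<top> * indicator A x) x \<partial>\<nu>) \<le> (\<integral>\<^sup>+x. potential f x \<partial>\<nu>)"
      by (intro nn_integral_mono)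
    also have "(taboo ^^ j) (\<lambda>x. \<top> * indicator A x) = (\<lambda>x. \<top> * (taboo ^^ j) (indicator A) x)"
      by (rule taboo_iterate_cmult) simp
    also have "(\<integral>\<^sup>+x. \<top> * (taboo ^^ j) (indicator A) x \<partial>\<nu>) = \<top> * (\<integral>\<^sup>+x. (taboo ^^ j) (indicator A) x \<partial>\<nu>)"
      by (rule nn_integral_cmult) simp
    finally show ?thesis using \<open>(\<integral>\<^sup>+x. potential f x \<partial>\<nu>) < \<infinity>\<close>
      by (auto simp: ennreal_top_mult split: if_splits)
  qed
  have "emeasure \<pi> A \<le> (\<integral>\<^sup>+x. (taboo ^^ n) (\<lambda>_. 1) x \<partial>\<pi>)" for n
  proof -
    have "emeasure \<pi> A = (\<integral>\<^sup>+x. indicator A x \<partial>\<pi>)" by simp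
    also have "\<dots> = (\<integral>\<^sup>+x. (taboo ^^ n) (indicator A) x \<partial>\<pi>)"
      using invariant_n[of "indicator A" n] by (simp add: nu0)
    also have "\<dots> \<le> (\<integral>\<^sup>+x. (taboo ^^ n) (\<lambda>_. 1) x \<partial>\<pi>)"
      by (intro nn_integral_mono taboo_iterate_mono) (auto simp: indicator_def)
    finally show ?thesis .
  qed
  then have "emeasure \<pi> A \<le> 0" by (intro LIMSEQ_le_const[OF pi_one_tendsto]) auto
  then show ?thesis
    by (intro AE_I[of _ _ A]) (auto simp: A_def less_top[symmetric])
qed

text \<open>\<open>G_le\<close> is an inequality because each iterate minimizes for itself, while
  the kernel here belongs to one fixed strategy. The limits under \<open>\<pi>\<close> and under
  \<open>\<nu>\<close> are both returned, since their coincidence is what the final comparison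
  uses.\<close>

lemma value_iteration_convergence:
  fixes G :: "nat \<Rightarrow> 'a \<Rightarrow> ennreal"
  assumes G[measurable]: "\<And>n. G n \<in> borel_measurable borel"
    and G_le: "\<And>n x. G (Suc n) x \<le> taboo (G n) x + s x * (\<integral>\<^sup>+y. G n y \<partial>\<nu>)"
    and G0: "(\<integral>\<^sup>+x. G 0 x \<partial>\<pi>) < \<infinity>"
  obtains l :: real where "0 \<le> l" "\<And>n. (\<integral>\<^sup>+x. G n x \<partial>\<pi>) < \<infinity>"
    "AE x in \<pi>. (\<lambda>n. G n x) \<longlonglongrightarrow> ennreal l"
    "(\<lambda>n. \<integral>\<^sup>+x. G n x \<partial>\<pi>) \<longlonglongrightarrow> ennreal l"
    "(\<lambda>n. \<integral>\<^sup>+x. G n x \<partial>\<nu>) \<longlonglongrightarrow> ennreal l"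
proof -
  define a where "a n = (\<integral>\<^sup>+y. G n y \<partial>\<nu>)" for n
  \<comment> \<open>The value at 0 is a filler: unrolling evaluates \<open>d (n - j)\<close> with
    \<open>j < n\<close> only, and 0 adds nothing to the total defect \<open>D\<close>.\<close>
  define d where "d n x = (case n of 0 \<Rightarrow> 0 | Suc m \<Rightarrow> taboo (G m) x + s x * a m - G (Suc m) x)" for n x
  have d[measurable]: "d n \<in> borel_measurable borel" for n
    unfolding d_def[abs_def] by (cases n) auto
  have eq: "G (Suc n) x + d (Suc n) x = taboo (G n) x + s x * a n" for n x
    using G_le[of n x] by (simp add: d_def a_def[symmetric] add_diff_inverse_ennreal)
  have h: "(\<lambda>x. s x * a n) \<in> borel_measurable borel" for n by measurable
  note unrolled = unroll[of G d "\<lambda>n x. s x * a n", OF G d h eq]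

  \<comment> \<open>Invariance makes \<open>\<pi>(G n)\<close> nonincreasing with decrement exactly
    the mean defect; telescoping bounds the total.\<close>
  have pi_eq: "(\<integral>\<^sup>+x. G (Suc n) x \<partial>\<pi>) + (\<integral>\<^sup>+x. d (Suc n) x \<partial>\<pi>) = (\<integral>\<^sup>+x. G n x \<partial>\<pi>)" for n
  proof -
    have "(\<integral>\<^sup>+x. G (Suc n) x \<partial>\<pi>) + (\<integral>\<^sup>+x. d (Suc n) x \<partial>\<pi>) = (\<integral>\<^sup>+x. taboo (G n) x + s x * a n \<partial>\<pi>)"
      by (simp add: nn_integral_add[symmetric] eq)
    also have "\<dots> = (\<integral>\<^sup>+x. taboo (G n) x \<partial>\<pi>) + (\<integral>\<^sup>+x. s x \<partial>\<pi>) * a n"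
      by (simp add: nn_integral_add nn_integral_multc)
    finally show ?thesis using invariant[OF G, of n] by (simp add: a_def)
  qed
  have pi_sum: "(\<integral>\<^sup>+x. G n x \<partial>\<pi>) + (\<Sum>k<Suc n. \<integral>\<^sup>+x. d k x \<partial>\<pi>) = (\<integral>\<^sup>+x. G 0 x \<partial>\<pi>)" for n
  proof (induction n)
    case 0
    show ?case by (simp add: d_def)
  next
    case (Suc n)
    then show ?case unfolding sum.lessThan_Suc[of _ "Suc n"] by (simp only: pi_eq[of n, symmetric] ac_simps)
  qed
  have pi_G_le: "(\<integral>\<^sup>+x. G n x \<partial>\<pi>) \<le> (\<integral>\<^sup>+x. G 0 x \<partial>\<pi>)" for n
    unfolding pi_sum[of n, symmetric] by (rule add_increasing2) auto
  have pi_G_fin: "(\<integral>\<^sup>+x. G n x \<partial>\<pi>) < \<infinity>" for n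
    using pi_G_le G0 by (rule le_less_trans)
  define D where "D x = (\<Sum>k. d k x)" for x
  have D[measurable]: "D \<in> borel_measurable borel" unfolding D_def[abs_def] by measurable
  have "(\<integral>\<^sup>+x. D x \<partial>\<pi>) = (\<Sum>k. \<integral>\<^sup>+x. d k x \<partial>\<pi>)"
    unfolding D_def by (intro nn_integral_suminf) auto
  also have "\<dots> \<le> (\<integral>\<^sup>+x. G 0 x \<partial>\<pi>)"
  proof (intro suminf_le_const summableI)
    fix n
    have "(\<Sum>k<n. \<integral>\<^sup>+x. d k x \<partial>\<pi>) \<le> (\<Sum>k<Suc n. \<integral>\<^sup>+x. d k x \<partial>\<pi>)" by (intro sum_mono2) auto
    also have "\<dots> \<le> (\<integral>\<^sup>+x. G 0 x \<partial>\<pi>)"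
      unfolding pi_sum[of n, symmetric] by (rule add_increasing) auto
    finally show "(\<Sum>k<n. \<integral>\<^sup>+x. d k x \<partial>\<pi>) \<le> (\<integral>\<^sup>+x. G 0 x \<partial>\<pi>)" .
  qed
  finally have pi_D: "(\<integral>\<^sup>+x. D x \<partial>\<pi>) < \<infinity>" using G0 by (rule le_less_trans)

  \<comment> \<open>Invariance gives
    \<open>\<pi>(s) \<nu>(G n) \<le> \<pi>(G n) \<le> \<pi>(G 0)\<close>, and
    \<open>\<pi>(s)\<close> is positive and finite.\<close>
  have "\<exists>K. \<forall>n. a n \<le> K \<and> K < \<infinity>"
  proof (intro exI allI conjI)
    let ?s = "\<integral>\<^sup>+x. s x \<partial>\<pi>"
    have s0: "?s \<noteq> 0" "?s \<noteq> \<top>" using pi_s_pos pi_s_le_1 by (auto simp: top_unique)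
    show "a n \<le> (\<integral>\<^sup>+x. G 0 x \<partial>\<pi>) / ?s" for n
    proof -
      have "?s * a n \<le> (\<integral>\<^sup>+x. G 0 x \<partial>\<pi>)"
        unfolding a_def by (rule order_trans[OF nu_le[OF G] pi_G_le])
      then have "?s * a n / ?s \<le> (\<integral>\<^sup>+x. G 0 x \<partial>\<pi>) / ?s" by (rule divide_right_mono_ennreal)
      then show ?thesis using s0 by (simp add: ennreal_mult_divide_eq mult.commute)
    qed
    show "(\<integral>\<^sup>+x. G 0 x \<partial>\<pi>) / ?s < \<infinity>"
      using G0 s0 by (simp add: ennreal_divide_eq_top_iff less_top[symmetric])
  qed
  then obtain K where K: "\<And>n. a n \<le> K" "K < \<infinity>" by blast
  have a_fin: "a n < \<top>" for n using K(1)[of n] K(2) by (auto intro: le_less_trans)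

  define E where "E n x = (\<Sum>j<n. (taboo ^^ j) (d (n - j)) x)" for n x
  have E[measurable]: "E n \<in> borel_measurable borel" for n unfolding E_def[abs_def] by measurable
  \<comment> \<open>Summed over time, the propagated defects are bounded by the potential of the
    total defect. This gives summable forcing under \<open>\<nu>\<close> and, almost surely under
    \<open>\<pi>\<close>, \<open>E n x\<close> tending to 0.\<close>
  have E_sum: "(\<Sum>n. E n x) \<le> potential D x" for x
    using convolution_suminf_le[of "\<lambda>j k. (taboo ^^ j) (d k) x"]
    by (simp add: E_def potential_def D_def[abs_def] taboo_iterate_suminf[OF d])
  have nu_pot_D: "(\<integral>\<^sup>+x. potential D x \<partial>\<nu>) < \<infinity>"
    by (rule finite_of_pi_s_mult[OF nu_potential_le[OF D] pi_D])
  have nu_pot_G0: "(\<integral>\<^sup>+x. potential (G 0) x \<partial>\<nu>) < \<infinity>"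
    by (rule finite_of_pi_s_mult[OF nu_potential_le[OF G] G0])

  \<comment> \<open>\<open>r j\<close> is the probability that a cycle started from
    \<open>\<nu>\<close> survives \<open>j\<close> steps; its decrements \<open>p j\<close> are the
    regeneration probabilities.\<close>
  define r where "r j = enn2real (\<integral>\<^sup>+x. (taboo ^^ j) (\<lambda>_. 1) x \<partial>\<nu>)" for j
  have one_le: "(taboo ^^ j) (\<lambda>_. 1) x \<le> 1" for j x
    using add_increasing2[OF zero_le order_refl, of "(taboo ^^ j) (\<lambda>_. 1) x" "\<Sum>i<j. (taboo ^^ i) s x"]
    by (simp only: taboo_iterate_one)
  have nu_one_le: "(\<integral>\<^sup>+x. (taboo ^^ j) (\<lambda>_. 1) x \<partial>\<nu>) \<le> 1" for j
    using nn_integral_mono[of \<nu> "(taboo ^^ j) (\<lambda>_. 1)" "\<lambda>_. 1"] by (simp add: one_le nu_space)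
  have r_enn: "(\<integral>\<^sup>+x. (taboo ^^ j) (\<lambda>_. 1) x \<partial>\<nu>) = ennreal (r j)" for j
    using nu_one_le[of j] by (simp add: r_def le_less_trans)
  have nu_step: "(\<integral>\<^sup>+x. (taboo ^^ j) (\<lambda>_. 1) x \<partial>\<nu>) =
      (\<integral>\<^sup>+x. (taboo ^^ Suc j) (\<lambda>_. 1) x \<partial>\<nu>) + (\<integral>\<^sup>+x. (taboo ^^ j) s x \<partial>\<nu>)" for j
  proof -
    have "(taboo ^^ j) (\<lambda>_. 1) = (taboo ^^ j) (\<lambda>x. taboo (\<lambda>_. 1) x + s x)"
      by (simp add: taboo_one)
    also have "\<dots> = (\<lambda>x. (taboo ^^ Suc j) (\<lambda>_. 1) x + (taboo ^^ j) s x)"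
      unfolding taboo_iterate_Suc_inner by (subst taboo_iterate_add) simp_all
    finally have "(\<integral>\<^sup>+x. (taboo ^^ j) (\<lambda>_. 1) x \<partial>\<nu>) =
        (\<integral>\<^sup>+x. (taboo ^^ Suc j) (\<lambda>_. 1) x + (taboo ^^ j) s x \<partial>\<nu>)" by (rule arg_cong)
    also have "\<dots> = (\<integral>\<^sup>+x. (taboo ^^ Suc j) (\<lambda>_. 1) x \<partial>\<nu>) + (\<integral>\<^sup>+x. (taboo ^^ j) s x \<partial>\<nu>)"
      by (intro nn_integral_add measurable_taboo_iterate) auto
    finally show ?thesis .
  qed
  have r0: "0 \<le> r j" for j by (simp add: r_def)
  have p_fin: "(\<integral>\<^sup>+x. (taboo ^^ j) s x \<partial>\<nu>) < \<top>" for j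
    using nu_step[of j] unfolding r_enn by (metis ennreal_less_top ennreal_add_eq_top less_top)
  define p where "p j = enn2real (\<integral>\<^sup>+x. (taboo ^^ j) s x \<partial>\<nu>)" for j
  have p_enn: "(\<integral>\<^sup>+x. (taboo ^^ j) s x \<partial>\<nu>) = ennreal (p j)" for j
    using p_fin[of j] by (simp add: p_def)
  have p_nonneg: "0 \<le> p j" for j by (simp add: p_def)
  have p_eq: "r j - r (Suc j) = p j" for j
  proof -
    have "ennreal (r j) = ennreal (r (Suc j) + p j)"
      using nu_step[of j] unfolding r_enn p_enn by (simp add: r0 p_nonneg)
    then show ?thesis using r0[of "Suc j"] r0[of j] p_nonneg[of j] by (subst (asm) ennreal_inj) auto
  qed

  define A where "A n = enn2real (a n)" for n
  have A: "a n = ennreal (A n)" for n using a_fin[of n] by (simp add: A_def)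
  have A0: "0 \<le> A n" for n by (simp add: A_def)
  define e1 where "e1 n = enn2real (\<integral>\<^sup>+x. (taboo ^^ n) (G 0) x \<partial>\<nu>)" for n
  define e2 where "e2 n = enn2real (\<integral>\<^sup>+x. E n x \<partial>\<nu>)" for n
  have s1: "(\<Sum>n. \<integral>\<^sup>+x. (taboo ^^ n) (G 0) x \<partial>\<nu>) < \<infinity>"
    using nu_pot_G0 unfolding nu_potential_eq[OF G] .
  have s2: "(\<Sum>n. \<integral>\<^sup>+x. E n x \<partial>\<nu>) < \<infinity>"
  proof -
    have "(\<Sum>n. \<integral>\<^sup>+x. E n x \<partial>\<nu>) = (\<integral>\<^sup>+x. (\<Sum>n. E n x) \<partial>\<nu>)"
      by (intro nn_integral_suminf[symmetric]) auto
    also have "\<dots> \<le> (\<integral>\<^sup>+x. potential D x \<partial>\<nu>)" by (intro nn_integral_mono E_sum)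
    finally show ?thesis using nu_pot_D by (rule le_less_trans)
  qed
  have fin1: "(\<integral>\<^sup>+x. (taboo ^^ n) (G 0) x \<partial>\<nu>) = ennreal (e1 n)" for n
    using s1 sum_le_suminf[of "\<lambda>n. \<integral>\<^sup>+x. (taboo ^^ n) (G 0) x \<partial>\<nu>" "{n}"] by (auto simp: e1_def le_less_trans)
  have fin2: "(\<integral>\<^sup>+x. E n x \<partial>\<nu>) = ennreal (e2 n)" for n
    using s2 sum_le_suminf[of "\<lambda>n. \<integral>\<^sup>+x. E n x \<partial>\<nu>" "{n}"] by (auto simp: e2_def le_less_trans)
  have e_nonneg: "0 \<le> e1 n" "0 \<le> e2 n" for n by (auto simp: e1_def e2_def)

  have h_iter: "(taboo ^^ j) (\<lambda>x. s x * a k) = (\<lambda>x. a k * (taboo ^^ j) s x)" for j k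
    using taboo_iterate_cmult[of s j "a k"] by (simp add: mult.commute)
  define Bn where "Bn n x = (\<Sum>j<n. a (n - 1 - j) * (taboo ^^ j) s x)" for n x
  have Bn[measurable]: "Bn n \<in> borel_measurable borel" for n unfolding Bn_def[abs_def] by measurable
  have unr: "G n x + E n x = (taboo ^^ n) (G 0) x + Bn n x" for n x
    using unrolled[of n x] by (simp only: E_def Bn_def h_iter)

  \<comment> \<open>Integrating the unrolled identity against \<open>\<nu>\<close> closes it into a
    scalar renewal equation, as \<open>G\<close> enters the sum only through its
    \<open>\<nu>\<close>-means.\<close>
  have ren: "A n = (e1 n - e2 n) + (\<Sum>j<n. (r j - r (Suc j)) * A (n - 1 - j))" for n
  proof -
    have "(\<integral>\<^sup>+x. G n x + E n x \<partial>\<nu>) = (\<integral>\<^sup>+x. (taboo ^^ n) (G 0) x + Bn n x \<partial>\<nu>)"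
      by (simp only: unr)
    then have "ennreal (A n) + ennreal (e2 n) = ennreal (e1 n) + (\<integral>\<^sup>+x. Bn n x \<partial>\<nu>)"
      by (subst (asm) (1 2) nn_integral_add) (auto simp: A[symmetric] a_def fin1[symmetric] fin2[symmetric])
    also have "(\<integral>\<^sup>+x. Bn n x \<partial>\<nu>) = (\<Sum>j<n. a (n - 1 - j) * (\<integral>\<^sup>+x. (taboo ^^ j) s x \<partial>\<nu>))"
      unfolding Bn_def by (subst nn_integral_sum) (auto simp: nn_integral_cmult)
    also have "\<dots> = ennreal (\<Sum>j<n. p j * A (n - 1 - j))"
      unfolding A p_enn using A0 p_nonneg
      by (subst sum_ennreal[symmetric]) (auto simp: ennreal_mult[symmetric] mult.commute)
    finally have "ennreal (A n + e2 n) = ennreal (e1 n + (\<Sum>j<n. p j * A (n - 1 - j)))"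
      using A0 p_nonneg e_nonneg by (simp add: sum_nonneg)
    then have "A n + e2 n = e1 n + (\<Sum>j<n. p j * A (n - 1 - j))"
      using A0 p_nonneg e_nonneg by (subst (asm) ennreal_inj) (auto simp: sum_nonneg)
    then show ?thesis by (simp add: p_eq)
  qed
  have "convergent A"
  proof (rule renewal_convergence[OF _ _ _ _ _ _ ren])
    have "A n \<le> enn2real K" for n
      using K(1)[of n] K(2) by (auto simp: A_def intro: enn2real_mono)
    then show "bounded (range A)" using A0 by (auto simp: bounded_iff intro!: exI[of _ "enn2real K"])
    have "(\<integral>\<^sup>+x. potential (\<lambda>_. 1) x \<partial>\<nu>) < \<infinity>"
      by (rule finite_of_pi_s_mult[OF nu_potential_le[of "\<lambda>_. 1"]]) (auto simp: pi_space)
    then show "summable r"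
      unfolding r_def by (intro summable_enn2real) (simp add: nu_potential_eq)
    show "r 0 = 1" by (simp add: r_def nu_space)
    show "r (Suc j) \<le> r j" for j using p_eq[of j] p_nonneg[of j] by simp
    have "0 < p 0" using nu_s p_fin[of 0] by (simp add: p_def enn2real_positive_iff)
    then show "r 1 < 1" using p_eq[of 0] \<open>r 0 = 1\<close> by simp
    show "summable (\<lambda>n. e1 n - e2 n)"
      unfolding e1_def e2_def by (intro summable_diff summable_enn2real s1 s2)
  qed
  then obtain l where l: "A \<longlonglongrightarrow> l" by (auto simp: convergent_def)
  have l0: "0 \<le> l" using l A0 by (intro LIMSEQ_le_const[OF l]) auto
  have a_lim: "a \<longlonglongrightarrow> ennreal l" unfolding A[abs_def] using l by (rule tendsto_ennrealI)

  \<comment> \<open>From any starting point the regeneration probabilities sum to 1, so averaging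
    the convergent \<open>A\<close> with these weights preserves its limit.\<close>
  have B_lim: "(\<lambda>n. Bn n x) \<longlonglongrightarrow> ennreal l" for x
  proof -
    define q where "q j = enn2real ((taboo ^^ j) s x)" for j
    have sum1: "(\<Sum>j. (taboo ^^ j) s x) = 1" using potential_s[of x, OF potential_one] by (simp add: potential_def)
    have q_enn: "(taboo ^^ j) s x = ennreal (q j)" for j
      using sum_le_suminf[of "\<lambda>j. (taboo ^^ j) s x" "{j}"] sum1 by (auto simp: q_def le_less_trans)
    have sq: "summable q" unfolding q_def by (rule summable_enn2real) (simp add: sum1)
    have q0: "0 \<le> q j" for j by (simp add: q_def)
    have "ennreal (suminf q) = 1" using sum1 unfolding q_enn by (subst suminf_ennreal2[OF q0 sq, symmetric])
    then have "suminf q = 1" by simp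
    then have "(\<lambda>n. \<Sum>j<n. q j * A (n - 1 - j)) \<longlonglongrightarrow> l"
      using convolution_tendsto[OF sq q0 l] by simp
    moreover have "Bn n x = ennreal (\<Sum>j<n. q j * A (n - 1 - j))" for n
      unfolding Bn_def A q_enn using A0 q0
      by (subst sum_ennreal[symmetric]) (auto simp: ennreal_mult[symmetric] mult.commute)
    ultimately show ?thesis by simp
  qed
  have B_le: "Bn n x \<le> K" for n x
  proof -
    have "Bn n x \<le> (\<Sum>j<n. K * (taboo ^^ j) s x)"
      unfolding Bn_def by (intro sum_mono mult_right_mono K) auto
    also have "\<dots> = K * (\<Sum>j<n. (taboo ^^ j) s x)" by (simp add: sum_distrib_left)
    also have "\<dots> \<le> K * 1"
      by (intro mult_left_mono order_trans[OF partial_sums_le_potential potential_s_le]) auto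
    finally show ?thesis by simp
  qed

  have AE_lim: "AE x in \<pi>. (\<lambda>n. G n x) \<longlonglongrightarrow> ennreal l"
    using AE_potential_finite[OF D pi_D] AE_potential_finite[OF G G0]
  proof eventually_elim
    case (elim x)
    have E0: "(\<lambda>n. E n x) \<longlonglongrightarrow> 0"
      using E_sum[of x] elim(1) by (intro tendsto_zero_of_suminf_finite) (rule le_less_trans)
    have T0: "(\<lambda>n. (taboo ^^ n) (G 0) x) \<longlonglongrightarrow> 0"
      using elim(2) unfolding potential_def by (rule tendsto_zero_of_suminf_finite)
    have "E n x < \<top>" for n
      using sum_le_suminf[of "\<lambda>n. E n x" "{n}"] E_sum[of x] elim(1) by (auto intro: le_less_trans)
    then have "G n x = (taboo ^^ n) (G 0) x + Bn n x - E n x" for n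
      by (simp add: unr[symmetric] less_top[symmetric])
    moreover have "(\<lambda>n. (taboo ^^ n) (G 0) x + Bn n x - E n x) \<longlonglongrightarrow> 0 + ennreal l - 0"
      by (intro tendsto_diff_ennreal tendsto_add T0 B_lim E0) auto
    ultimately show ?case by simp
  qed

  \<comment> \<open>The upper bound for the means comes from dropping \<open>E n\<close> in the
    unrolled identity; \<open>Bn n\<close> is dominated by the constant \<open>K\<close>.\<close>
  have "(\<lambda>n. \<integral>\<^sup>+x. Bn n x \<partial>\<pi>) \<longlonglongrightarrow> (\<integral>\<^sup>+x. ennreal l \<partial>\<pi>)"
    using K(2) by (intro nn_integral_dominated_convergence[where w="\<lambda>_. K"])
      (auto simp: B_le B_lim pi_space)
  then have upper: "(\<lambda>n. (\<integral>\<^sup>+x. (taboo ^^ n) (G 0) x \<partial>\<pi>) + (\<integral>\<^sup>+x. Bn n x \<partial>\<pi>)) \<longlonglongrightarrow> 0 + ennreal l"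
    by (intro tendsto_add pi_taboo_iterate_tendsto G G0) (simp add: pi_space)
  have pi_upper: "(\<integral>\<^sup>+x. G n x \<partial>\<pi>) \<le> (\<integral>\<^sup>+x. (taboo ^^ n) (G 0) x \<partial>\<pi>) + (\<integral>\<^sup>+x. Bn n x \<partial>\<pi>)" for n
  proof -
    have "(\<integral>\<^sup>+x. G n x \<partial>\<pi>) \<le> (\<integral>\<^sup>+x. (taboo ^^ n) (G 0) x + Bn n x \<partial>\<pi>)"
      unfolding unr[symmetric] by (intro nn_integral_mono add_increasing2) auto
    then show ?thesis by (simp add: nn_integral_add)
  qed
  have "limsup (\<lambda>n. \<integral>\<^sup>+x. G n x \<partial>\<pi>) \<le> ennreal l"
  proof -
    have "limsup (\<lambda>n. \<integral>\<^sup>+x. G n x \<partial>\<pi>) \<le>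
        limsup (\<lambda>n. (\<integral>\<^sup>+x. (taboo ^^ n) (G 0) x \<partial>\<pi>) + (\<integral>\<^sup>+x. Bn n x \<partial>\<pi>))"
      by (intro Limsup_mono always_eventually allI pi_upper)
    then show ?thesis using lim_imp_Limsup[OF _ upper] by simp
  qed
  moreover have "ennreal l \<le> liminf (\<lambda>n. \<integral>\<^sup>+x. G n x \<partial>\<pi>)"
  proof -
    have "ennreal l = (\<integral>\<^sup>+x. ennreal l \<partial>\<pi>)" by (simp add: pi_space)
    also have "\<dots> = (\<integral>\<^sup>+x. liminf (\<lambda>n. G n x) \<partial>\<pi>)"
      using AE_lim by (intro nn_integral_cong_AE) (auto simp: lim_imp_Liminf)
    also have "\<dots> \<le> liminf (\<lambda>n. \<integral>\<^sup>+x. G n x \<partial>\<pi>)" by (intro nn_integral_liminf) auto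
    finally show ?thesis .
  qed
  ultimately have "(\<lambda>n. \<integral>\<^sup>+x. G n x \<partial>\<pi>) \<longlonglongrightarrow> ennreal l"
    using Liminf_le_Limsup[of sequentially "\<lambda>n. \<integral>\<^sup>+x. G n x \<partial>\<pi>"]
    by (intro Liminf_eq_Limsup antisym) auto
  then show thesis
    using that[OF l0 pi_G_fin AE_lim] a_lim by (simp add: a_def[abs_def])
qed

end

section \<open>Path measures of Markov chains\<close>

text \<open>The kernel family inside \<open>split_law\<close> with an abstract transition kernel, so
  that the path computation is independent of the split chain.\<close>

definition markov_path_kernel :: "'s measure \<Rightarrow> ('s \<Rightarrow> 's measure) \<Rightarrow> 's \<Rightarrow> nat \<Rightarrow> (nat \<Rightarrow> 's) \<Rightarrow> 's measure" where
  "markov_path_kernel S Q z n h = (case n of 0 \<Rightarrow> return S z | Suc m \<Rightarrow> Q (h m))"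

text \<open>The indicator tests the arrival point and not the starting point, matching a return time
  that is counted from 1.\<close>

definition avoiding_kernel :: "('s \<Rightarrow> 's measure) \<Rightarrow> 's set \<Rightarrow> ('s \<Rightarrow> ennreal) \<Rightarrow> 's \<Rightarrow> ennreal" where
  "avoiding_kernel Q A f x = (\<integral>\<^sup>+y. indicator (- A) y * f y \<partial>Q x)"

context
  fixes S :: "'s measure" and Q :: "'s \<Rightarrow> 's measure" and z :: 's and A :: "'s set"
  assumes Q: "Q \<in> S \<rightarrow>\<^sub>M prob_algebra S" and z: "z \<in> space S" and A[measurable]: "A \<in> sets S"
begin

interpretation IT: Ionescu_Tulcea "markov_path_kernel S Q z" "\<lambda>_. S"
proof (rule Ionescu_Tulcea.intro)
  have Q'[measurable]: "Q \<in> S \<rightarrow>\<^sub>M subprob_algebra S" using Q by (rule measurable_prob_algebraD)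
  show "markov_path_kernel S Q z i \<in> Pi\<^sub>M {0..<i} (\<lambda>_. S) \<rightarrow>\<^sub>M subprob_algebra S" for i
  proof (cases i)
    case 0
    have "return S z \<in> space (subprob_algebra S)"
      using z by (simp add: space_subprob_algebra subprob_space_return)
    then show ?thesis using 0 by (simp add: markov_path_kernel_def[abs_def])
  next
    case (Suc m)
    have "(\<lambda>h. Q (h m)) \<in> Pi\<^sub>M {0..<Suc m} (\<lambda>_. S) \<rightarrow>\<^sub>M subprob_algebra S" by measurable
    then show ?thesis using Suc by (simp add: markov_path_kernel_def[abs_def])
  qed
  show "prob_space (markov_path_kernel S Q z i x)" if "x \<in> space (Pi\<^sub>M {0..<i} (\<lambda>_. S))" for i x
  proof (cases i)
    case (Suc m)
    then have "x m \<in> space S" using that by (auto simp: space_PiM)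
    then have "Q (x m) \<in> space (prob_algebra S)" using Q by (rule measurable_space[rotated])
    then show ?thesis using Suc by (simp add: markov_path_kernel_def space_prob_algebra)
  qed (simp add: markov_path_kernel_def prob_space_return z)
qed

lemma measurable_avoiding_kernel[measurable]:
  assumes [measurable]: "f \<in> borel_measurable S"
  shows "avoiding_kernel Q A f \<in> borel_measurable S"
  unfolding avoiding_kernel_def[abs_def]
  by (rule nn_integral_measurable_subprob_algebra2[OF _ measurable_prob_algebraD[OF Q]]) measurable

text \<open>The marginal of the projective limit on the first \<open>n\<close> coordinates is the
  finite composition of kernels, on which induction is possible.\<close>

lemma nn_integral_path_prefix:
  assumes F[measurable]: "F \<in> borel_measurable (Pi\<^sub>M {0..<n} (\<lambda>_. S))"
  shows "(\<integral>\<^sup>+\<omega>. F (restrict \<omega> {0..<n}) \<partial>path_measure S (markov_path_kernel S Q z)) = (\<integral>\<^sup>+\<omega>. F \<omega> \<partial>IT.C 0 n (\<lambda>_. undefined))"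
proof -
  have up: "IT.up_to {0..<n} = n"
    unfolding IT.up_to_def by (rule Least_equality) (auto simp: not_le[symmetric])
  have sC: "sets (IT.C 0 n (\<lambda>_. undefined)) = sets (Pi\<^sub>M {0..<n} (\<lambda>_. S))"
    using IT.sets_C[of "\<lambda>_. undefined" 0 n] by (simp add: space_PiM)
  have "(\<integral>\<^sup>+\<omega>. F (restrict \<omega> {0..<n}) \<partial>path_measure S (markov_path_kernel S Q z)) =
      (\<integral>\<^sup>+\<omega>. F \<omega> \<partial>distr IT.PF.lim (Pi\<^sub>M {0..<n} (\<lambda>_. S)) (\<lambda>x. restrict x {0..<n}))"
    unfolding path_measure_def
    by (subst nn_integral_distr) (auto intro!: measurable_restrict measurable_component_singleton cong: measurable_cong_sets)
  also have "\<dots> = (\<integral>\<^sup>+\<omega>. F \<omega> \<partial>IT.CI {0..<n})" by (subst IT.distr_lim) auto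
  also have "\<dots> = (\<integral>\<^sup>+\<omega>. F (restrict \<omega> {0..<n}) \<partial>IT.C 0 n (\<lambda>_. undefined))"
    unfolding IT.CI_def up
    by (subst nn_integral_distr) (auto simp: measurable_cong_sets[OF sC refl] intro!: measurable_restrict measurable_component_singleton)
  also have "\<dots> = (\<integral>\<^sup>+\<omega>. F \<omega> \<partial>IT.C 0 n (\<lambda>_. undefined))"
    using sets_eq_imp_space_eq[OF sC]
    by (intro nn_integral_cong arg_cong[of _ _ F]) (auto simp: space_PiM PiE_restrict)
  finally show ?thesis .
qed

definition avoid_prod :: "nat \<Rightarrow> ('s \<Rightarrow> ennreal) \<Rightarrow> (nat \<Rightarrow> 's) \<Rightarrow> ennreal" where
  "avoid_prod k f \<omega> = (\<Prod>i\<in>{1..k}. indicator (- A) (\<omega> i)) * f (\<omega> k)"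

lemma measurable_avoid_prod[measurable]:
  assumes [measurable]: "f \<in> borel_measurable S"
  shows "avoid_prod k f \<in> borel_measurable (Pi\<^sub>M {0..<Suc k} (\<lambda>_. S))"
proof -
  have [measurable]: "(\<lambda>\<omega>. \<omega> i) \<in> Pi\<^sub>M {0..<Suc k} (\<lambda>_. S) \<rightarrow>\<^sub>M S" if "i \<le> k" for i
    using that by (intro measurable_component_singleton) auto
  have g: "(\<lambda>x. indicator (- A) x :: ennreal) \<in> borel_measurable S" by measurable
  show ?thesis unfolding avoid_prod_def[abs_def]
    by (intro borel_measurable_times_ennreal borel_measurable_prod_ennreal measurable_compose[OF _ g] measurable_compose[OF _ assms]) auto
qed

text \<open>Integrating out the last coordinate replaces \<open>f\<close> at time
  \<open>Suc k\<close> by the avoiding kernel applied to \<open>f\<close> at time \<open>k\<close>;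
  hence the induction over all \<open>f\<close>.\<close>

lemma nn_integral_avoid_prod:
  assumes f: "f \<in> borel_measurable S"
  shows "(\<integral>\<^sup>+\<omega>. avoid_prod k f \<omega> \<partial>IT.C 0 (Suc k) (\<lambda>_. undefined)) = (avoiding_kernel Q A ^^ k) f z"
  using f
proof (induction k arbitrary: f)
  case 0
  let ?u = "\<lambda>_::nat. undefined :: 's"
  have u: "?u \<in> space (Pi\<^sub>M {0..<0} (\<lambda>_. S))" by (simp add: space_PiM)
  have "(\<integral>\<^sup>+\<omega>. avoid_prod 0 f \<omega> \<partial>IT.C 0 (Suc 0) ?u) = (\<integral>\<^sup>+\<omega>. avoid_prod 0 f \<omega> \<partial>IT.eP 0 ?u)"
    using IT.measurable_eP[of 0] u by (simp add: bind_return)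
  also have "\<dots> = (\<integral>\<^sup>+y. avoid_prod 0 f (?u(0 := y)) \<partial>return S z)"
    using IT.nn_integral_eP[OF u measurable_avoid_prod[OF 0, of 0]] by (simp add: markov_path_kernel_def)
  also have "\<dots> = f z" using 0 z by (simp add: avoid_prod_def nn_integral_return)
  finally show ?case by simp
next
  case (Suc k)
  let ?u = "\<lambda>_::nat. undefined :: 's" and ?K = "avoiding_kernel Q A"
  have u: "?u \<in> space (Pi\<^sub>M {0..<0} (\<lambda>_. S))" by (simp add: space_PiM)
  note m = measurable_avoid_prod[OF Suc.prems, of "Suc k"]
  have sC: "sets (IT.C 0 (Suc k) ?u) = sets (Pi\<^sub>M {0..<Suc k} (\<lambda>_. S))"
    using IT.sets_C[OF u, of "Suc k"] by simp
  have eP: "IT.eP (0 + Suc k) \<in> IT.C 0 (Suc k) ?u \<rightarrow>\<^sub>M subprob_algebra (Pi\<^sub>M {0..<Suc (Suc k)} (\<lambda>_. S))"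
    unfolding measurable_cong_sets[OF sC refl] using IT.measurable_eP[of "Suc k"] by simp
  have "(\<integral>\<^sup>+\<omega>. avoid_prod (Suc k) f \<omega> \<partial>IT.C 0 (Suc (Suc k)) ?u) =
      (\<integral>\<^sup>+h. \<integral>\<^sup>+\<omega>. avoid_prod (Suc k) f \<omega> \<partial>IT.eP (0 + Suc k) h \<partial>IT.C 0 (Suc k) ?u)"
    unfolding IT.C.simps(2)[of 0 "Suc k"] by (rule nn_integral_bind[OF m eP])
  also have "\<dots> = (\<integral>\<^sup>+h. avoid_prod k (?K f) h \<partial>IT.C 0 (Suc k) ?u)"
  proof (rule nn_integral_cong)
    fix h assume "h \<in> space (IT.C 0 (Suc k) ?u)"
    then have h: "h \<in> space (Pi\<^sub>M {0..<Suc k} (\<lambda>_. S))" using sets_eq_imp_space_eq[OF sC] by simp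
    then have hk: "h k \<in> space S" by (auto simp: space_PiM)
    then have [measurable_cong]: "sets (Q (h k)) = sets S"
      using measurable_space[OF Q hk] by (simp add: space_prob_algebra)
    have "(\<integral>\<^sup>+\<omega>. avoid_prod (Suc k) f \<omega> \<partial>IT.eP (0 + Suc k) h) =
        (\<integral>\<^sup>+y. avoid_prod (Suc k) f (h(Suc k := y)) \<partial>Q (h k))"
      using IT.nn_integral_eP[OF h m] by (simp add: markov_path_kernel_def)
    also have "\<dots> = (\<integral>\<^sup>+y. (\<Prod>i\<in>{1..k}. indicator (- A) (h i)) * (indicator (- A) y * f y) \<partial>Q (h k))"
      by (intro nn_integral_cong) (simp add: avoid_prod_def prod.nat_ivl_Suc' ac_simps)
    also have "\<dots> = (\<Prod>i\<in>{1..k}. indicator (- A) (h i)) * ?K f (h k)"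
      unfolding avoiding_kernel_def using Suc.prems by (intro nn_integral_cmult) measurable
    finally show "(\<integral>\<^sup>+\<omega>. avoid_prod (Suc k) f \<omega> \<partial>IT.eP (0 + Suc k) h) = avoid_prod k (?K f) h"
      by (simp add: avoid_prod_def)
  qed
  also have "\<dots> = (?K ^^ k) (?K f) z"
    using Suc.prems by (intro Suc.IH) measurable
  finally show ?case by (simp add: funpow_swap1)
qed

text \<open>The \<open>k\<close>-th summand depends on coordinates up to \<open>k\<close> only, so
  each is a finite-dimensional integral and the nonnegative series may be integrated
  termwise.\<close>

lemma nn_integral_path_avoiding:
  assumes f[measurable]: "f \<in> borel_measurable S"
  shows "(\<integral>\<^sup>+\<omega>. (\<Sum>k. if \<forall>i\<in>{1..k}. \<omega> i \<notin> A then f (\<omega> k) else 0) \<partial>path_measure S (markov_path_kernel S Q z)) =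
    (\<Sum>k. (avoiding_kernel Q A ^^ k) f z)"
proof -
  let ?L = "path_measure S (markov_path_kernel S Q z)"
  have eq: "(if \<forall>i\<in>{1..k}. \<omega> i \<notin> A then f (\<omega> k) else 0) = avoid_prod k f (restrict \<omega> {0..<Suc k})" for \<omega> k
  proof -
    have "(\<Prod>i\<in>{1..k}. indicator (- A) (restrict \<omega> {0..<Suc k} i)) = (\<Prod>i\<in>{1..k}. indicator (- A) (\<omega> i) :: ennreal)"
      by (intro prod.cong) auto
    also have "\<dots> = (if \<forall>i\<in>{1..k}. \<omega> i \<notin> A then 1 else 0)"
      by (auto intro!: prod.neutral prod_zero simp: indicator_def)
    finally show ?thesis by (simp add: avoid_prod_def)
  qed
  have sL: "sets ?L = sets (Pi\<^sub>M UNIV (\<lambda>_. S))" by (simp add: path_measure_def)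
  have m: "(\<lambda>\<omega>. avoid_prod k f (restrict \<omega> {0..<Suc k})) \<in> borel_measurable ?L" for k
    unfolding measurable_cong_sets[OF sL refl]
    by (rule measurable_compose[OF _ measurable_avoid_prod[OF f]])
      (auto intro!: measurable_restrict measurable_component_singleton)
  show ?thesis unfolding eq
    by (subst nn_integral_suminf[OF m])
      (simp only: nn_integral_path_prefix[OF measurable_avoid_prod[OF f]] nn_integral_avoid_prod[OF f])
qed

end

section \<open>The controlled kernels\<close>

text \<open>Lifts a decomposition known on sets to integrals by induction over measurable functions,
  without forming the sum of the measures.\<close>

lemma nn_integral_add_mult_measure:
  assumes f: "f \<in> borel_measurable N"
    and sets: "sets L = sets N" "sets K = sets N"
    and eq: "\<And>A. A \<in> sets N \<Longrightarrow> emeasure N A = emeasure L A + c * emeasure K A"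
  shows "(\<integral>\<^sup>+x. f x \<partial>N) = (\<integral>\<^sup>+x. f x \<partial>L) + c * (\<integral>\<^sup>+x. f x \<partial>K)"
  using f
proof (induction rule: borel_measurable_induct)
  case (cong f g)
  have sp: "space L = space N" "space K = space N" using sets by (auto dest: sets_eq_imp_space_eq)
  have "(\<integral>\<^sup>+x. f x \<partial>N) = (\<integral>\<^sup>+x. g x \<partial>N)" "(\<integral>\<^sup>+x. f x \<partial>L) = (\<integral>\<^sup>+x. g x \<partial>L)"
    "(\<integral>\<^sup>+x. f x \<partial>K) = (\<integral>\<^sup>+x. g x \<partial>K)"
    by (auto intro!: nn_integral_cong simp: cong(3) sp)
  then show ?case using cong(4) by (simp only:)
next
  case (set A)
  then show ?case using eq sets by simp
next
  case (mult u a)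
  then have "u \<in> borel_measurable L" "u \<in> borel_measurable K"
    by (simp_all add: measurable_cong_sets[OF sets(1) refl] measurable_cong_sets[OF sets(2) refl])
  then show ?case using mult by (simp add: nn_integral_cmult distrib_left ac_simps)
next
  case (add u v)
  then have "u \<in> borel_measurable L" "u \<in> borel_measurable K" "v \<in> borel_measurable L" "v \<in> borel_measurable K"
    by (simp_all add: measurable_cong_sets[OF sets(1) refl] measurable_cong_sets[OF sets(2) refl])
  then show ?case using add by (simp add: nn_integral_add distrib_left ac_simps)
next
  case (seq U)
  then have m: "U i \<in> borel_measurable L" "U i \<in> borel_measurable K" for i
    by (simp_all add: measurable_cong_sets[OF sets(1) refl] measurable_cong_sets[OF sets(2) refl])
  have iU: "incseq U" by (rule seq)
  have inc: "incseq (\<lambda>i. \<integral>\<^sup>+x. U i x \<partial>L)" "incseq (\<lambda>i. c * (\<integral>\<^sup>+x. U i x \<partial>K))"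
    using iU by (auto simp: incseq_def le_fun_def intro!: nn_integral_mono mult_left_mono)
  have "(\<integral>\<^sup>+x. (SUP i. U i x) \<partial>N) = (SUP i. \<integral>\<^sup>+x. U i x \<partial>N)"
    using seq by (intro nn_integral_monotone_convergence_SUP) auto
  also have "\<dots> = (SUP i. (\<integral>\<^sup>+x. U i x \<partial>L) + c * (\<integral>\<^sup>+x. U i x \<partial>K))" by (simp add: seq)
  also have "\<dots> = (SUP i. \<integral>\<^sup>+x. U i x \<partial>L) + (SUP i. c * (\<integral>\<^sup>+x. U i x \<partial>K))"
    by (rule ennreal_SUP_add[OF inc])
  also have "\<dots> = (\<integral>\<^sup>+x. (SUP i. U i x) \<partial>L) + c * (\<integral>\<^sup>+x. (SUP i. U i x) \<partial>K)"
    using seq m by (simp add: nn_integral_monotone_convergence_SUP SUP_mult_left_ennreal)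
  finally show ?case by (simp add: image_comp SUP_apply)
qed

text \<open>Upper semicontinuity together with closed values gives a closed, hence Borel, graph,
  which is what makes the total extensions of kernel and cost measurable.\<close>

lemma closed_graphK:
  fixes M :: "('x::polish_space, 'u::polish_space) mdp"
  assumes "basic_assumption M"
  shows "closed (graphK M)"
  unfolding closed_sequential_limits
proof (intro allI impI, elim conjE)
  fix z l assume z: "\<forall>n. z n \<in> graphK M" "z \<longlonglongrightarrow> l"
  have usc: "closed {x. acts M x \<inter> F \<noteq> {}}" if "closed F" for F
    using assms that by (auto simp: basic_assumption_def)
  have "closed (acts M (fst l))" using assms by (auto simp: basic_assumption_def)
  show "l \<in> graphK M"
  proof (rule ccontr)
    assume "l \<notin> graphK M"
    then have "snd l \<in> - acts M (fst l)" by (auto simp: graphK_def split: prod.splits)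
    \<comment> \<open>A closed ball around the limiting action misses the actions at the limiting
      state; but the states whose actions meet it form a closed set containing the tail of the
      sequence.\<close>
    then obtain r where r: "0 < r" "cball (snd l) r \<subseteq> - acts M (fst l)"
      using \<open>closed (acts M (fst l))\<close> open_contains_cball[of "- acts M (fst l)"] by (auto simp: open_Compl)
    have "eventually (\<lambda>n. dist (snd (z n)) (snd l) < r) sequentially"
      using tendsto_snd[OF z(2)] r(1) by (rule tendstoD)
    then have "eventually (\<lambda>n. fst (z n) \<in> {x. acts M x \<inter> cball (snd l) r \<noteq> {}}) sequentially"
    proof eventually_elim
      case (elim n)
      have "snd (z n) \<in> acts M (fst (z n))" using z(1) by (auto simp: graphK_def split: prod.splits)
      then show ?case using elim by (auto simp: dist_commute less_imp_le)
    qed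
    then have "fst l \<in> {x. acts M x \<inter> cball (snd l) r \<noteq> {}}"
      by (rule Lim_in_closed_set[OF usc _ _ tendsto_fst[OF z(2)], rotated]) auto
    then show False using r(2) by auto
  qed
qed

text \<open>Extended by 0 off the graph to be measurable on the whole product; a stationary strategy
  puts no mass there.\<close>

definition total_cost :: "('x, 'u) mdp \<Rightarrow> 'x \<times> 'u \<Rightarrow> ennreal" where
  "total_cost M z = (if z \<in> graphK M then cost M z else 0)"

definition kernel_under :: "('x::polish_space, 'u::polish_space) mdp \<Rightarrow> ('x \<Rightarrow> 'u measure) \<Rightarrow> 'x \<Rightarrow> 'x measure" where
  "kernel_under M w x = w x \<bind> (\<lambda>u. total_trans M (x, u))"

definition cost_under :: "('x::polish_space, 'u::polish_space) mdp \<Rightarrow> ('x \<Rightarrow> 'u measure) \<Rightarrow> 'x \<Rightarrow> ennreal" where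
  "cost_under M w x = (\<integral>\<^sup>+u. total_cost M (x, u) \<partial>w x)"

text \<open>The minorization ensures that the subtraction on \<open>B\<close> yields a
  measure.\<close>

definition taboo_kernel :: "('x::polish_space, 'u::polish_space) mdp \<Rightarrow> 'x set \<Rightarrow> 'x measure \<Rightarrow> real \<Rightarrow> ('x \<Rightarrow> 'u measure) \<Rightarrow> 'x \<Rightarrow> 'x measure" where
  "taboo_kernel M B \<nu> \<delta> w x =
     (if x \<in> B then diff_measure (kernel_under M w x) (scale_measure (ennreal \<delta>) \<nu>) else kernel_under M w x)"

definition regen :: "'x set \<Rightarrow> real \<Rightarrow> 'x \<Rightarrow> ennreal" where
  "regen B \<delta> x = ennreal \<delta> * indicator B x"

text \<open>The complement of \<open>regen\<close>: the mass of the taboo kernel at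
  \<open>x\<close>, and the share of a point that splitting places at level
  \<open>False\<close>.\<close>

definition hold :: "'x set \<Rightarrow> real \<Rightarrow> 'x \<Rightarrow> ennreal" where
  "hold B \<delta> x = (if x \<in> B then ennreal (1 - \<delta>) else 1)"

locale split_mdp =
  fixes M :: "('x::polish_space, 'u::polish_space) mdp" and B :: "'x set" and \<nu> :: "'x measure" and \<delta> :: real
  assumes is_mdp: "is_mdp M" and basic: "basic_assumption M" and A0: "A0 M B \<nu> \<delta>"
begin

lemma acts_nonempty: "acts M x \<noteq> {}" and acts_sets[measurable]: "acts M x \<in> sets borel"
  using is_mdp by (auto simp: is_mdp_def)

lemma graphK_sets[measurable]: "graphK M \<in> sets borel"
  using closed_graphK[OF basic] by (rule borel_closed)

lemma measurable_total_trans[measurable]: "total_trans M \<in> borel \<rightarrow>\<^sub>M prob_algebra borel"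
proof -
  have 1: "trans M \<in> restrict_space borel (graphK M) \<rightarrow>\<^sub>M prob_algebra borel" using is_mdp by (simp add: is_mdp_def)
  have f: "fst \<in> borel \<rightarrow>\<^sub>M (borel :: 'x measure)" by (intro borel_measurable_continuous_onI continuous_intros)
  have "(\<lambda>z. return borel (fst z)) \<in> borel \<rightarrow>\<^sub>M prob_algebra (borel :: 'x measure)"
    by (rule measurable_compose[OF f measurable_return_prob_space])
  then have 2: "(\<lambda>z. return borel (fst z)) \<in> restrict_space borel {z. z \<notin> graphK M} \<rightarrow>\<^sub>M prob_algebra (borel :: 'x measure)"
    by (rule measurable_restrict_space1)
  show ?thesis unfolding total_trans_def[abs_def]
    using 1 2 by (subst measurable_If_restrict_space_iff) auto
qed

lemma measurable_total_cost[measurable]: "total_cost M \<in> borel_measurable borel"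
proof -
  have "cost M \<in> borel_measurable (restrict_space borel (graphK M))" using is_mdp by (simp add: is_mdp_def)
  then show ?thesis unfolding total_cost_def[abs_def]
    by (subst measurable_If_restrict_space_iff) auto
qed

lemma delta_pos: "0 < \<delta>" and B_sets[measurable]: "B \<in> sets borel" and nu_B: "emeasure \<nu> B = 1"
  and nu_prob: "\<nu> \<in> space (prob_algebra borel)"
  using A0 unfolding A0_def prob_measures_def by - (elim conjE, assumption)+

lemma sets_nu[measurable_cong]: "sets \<nu> = sets borel" and prob_nu: "prob_space \<nu>"
  using nu_prob by (auto simp: space_prob_algebra)

lemma nu_UNIV: "emeasure \<nu> UNIV = 1"
  using prob_space.emeasure_space_1[OF prob_nu] sets_eq_imp_space_eq[OF sets_nu] by simp

lemma trans_prob: "z \<in> graphK M \<Longrightarrow> trans M z \<in> space (prob_algebra borel)"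
  using measurable_space[OF measurable_total_trans, of z] by (simp add: total_trans_def)

lemma minorization: "z \<in> graphK M \<Longrightarrow> fst z \<in> B \<Longrightarrow> A \<in> sets borel \<Longrightarrow> ennreal \<delta> * emeasure \<nu> A \<le> emeasure (trans M z) A"
proof -
  assume z: "z \<in> graphK M" "fst z \<in> B" "A \<in> sets borel"
  have "\<forall>A\<in>sets borel. \<forall>z\<in>graphK M. ennreal \<delta> * emeasure \<nu> A * indicator B (fst z) \<le> emeasure (trans M z) A"
    using A0 unfolding A0_def by (elim conjE)
  from this[rule_format, OF z(3,1)] show ?thesis using z(2) by simp
qed

text \<open>The last clause of \<open>A0\<close> puts \<open>\<delta>\<close> strictly below a
  transition probability of \<open>B\<close>; some state lies in \<open>B\<close> because
  \<open>\<nu>\<close> charges it.\<close>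

lemma delta_less_1: "\<delta> < 1"
proof -
  have "B \<noteq> {}" using nu_B by auto
  then obtain x u where xu: "x \<in> B" "u \<in> acts M x" using acts_nonempty by blast
  then have K: "(x, u) \<in> {z \<in> graphK M. fst z \<in> B}" by (simp add: graphK_def)
  have "ennreal \<delta> < (INF z\<in>{z \<in> graphK M. fst z \<in> B}. emeasure (trans M z) B)" using A0 by (simp add: A0_def)
  also have "\<dots> \<le> emeasure (trans M (x, u)) B" by (rule INF_lower[OF K])
  also have "\<dots> \<le> 1"
    using trans_prob[of "(x, u)"] K by (auto simp: space_prob_algebra intro: prob_space.measure_le_1)
  finally show ?thesis by (simp add: ennreal_less_one_iff)
qed

lemma betaE_eq: "betaE M = ennreal (beta M)"
proof -
  have "betaE M < \<top>" using A0 by (auto simp only: A0_def intro: order_less_le_trans[OF _ top_greatest])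
  then show ?thesis by (simp add: beta_def)
qed

text \<open>The infimum off \<open>B\<close> may be infinite, so a finite level strictly between it
  and \<open>beta M\<close> supplies the gap.\<close>

lemma cost_gap: "\<exists>\<epsilon>>0. \<forall>z\<in>graphK M. fst z \<notin> B \<longrightarrow> ennreal (beta M + \<epsilon>) \<le> cost M z"
proof -
  let ?I = "INF z\<in>{z \<in> graphK M. fst z \<notin> B}. cost M z"
  have "ennreal (beta M) < ?I" using A0 by (simp add: A0_def betaE_eq)
  then obtain c where c: "ennreal (beta M) < c" "c < ?I" using dense by blast
  then obtain c' where c': "c = ennreal c'" "0 \<le> c'" by (cases c) auto
  then have "beta M < c'" using c(1) by (simp add: ennreal_less_iff beta_def)
  then show ?thesis
    using c c' by (intro exI[of _ "c' - beta M"]) (auto intro: less_imp_le order_less_le_trans INF_lower)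
qed

lemma beta_nonneg: "0 \<le> beta M" by (simp add: beta_def)

lemma measurable_regen[measurable]: "regen B \<delta> \<in> borel_measurable borel"
  unfolding regen_def[abs_def] by measurable

lemma measurable_hold[measurable]: "hold B \<delta> \<in> borel_measurable borel"
  unfolding hold_def[abs_def] by measurable

lemma hold_add_regen: "hold B \<delta> x + regen B \<delta> x = 1"
  using delta_pos delta_less_1
  by (auto simp: hold_def regen_def ennreal_plus[symmetric] simp del: ennreal_plus)

lemma hold_pos: "0 < hold B \<delta> x" and hold_fin: "hold B \<delta> x < \<top>"
  using delta_less_1 by (auto simp: hold_def)

lemma hold_cancel: "hold B \<delta> x * (1 / hold B \<delta> x * a) = a"
proof -
  have "hold B \<delta> x * (1 / hold B \<delta> x) = 1"
    using hold_pos[of x] hold_fin[of x] by (simp add: ennreal_times_divide ennreal_divide_self)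
  then show ?thesis by (simp add: mult.assoc[symmetric])
qed

context
  fixes w :: "'x \<Rightarrow> 'u measure"
  assumes w: "w \<in> stationary M"
begin

lemma measurable_w[measurable]: "w \<in> borel \<rightarrow>\<^sub>M prob_algebra borel"
  using w by (simp add: stationary_def)

lemma w_prob: "prob_space (w x)" and sets_w[measurable_cong]: "sets (w x) = sets borel"
  using measurable_space[OF measurable_w, of x] by (auto simp: space_prob_algebra)

lemma AE_acts: "AE u in w x. u \<in> acts M x"
proof -
  interpret prob_space "w x" by (rule w_prob)
  have "emeasure (w x) (acts M x) = 1" using w by (simp add: stationary_def)
  then have "prob (acts M x) = 1" by (simp add: measure_def)
  then show ?thesis by (subst AE_in_set_eq_1) auto
qed

lemma AE_graph: "AE u in w x. (x, u) \<in> graphK M"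
  using AE_acts by (simp add: graphK_def)

lemma measurable_kernel_under[measurable]: "kernel_under M w \<in> borel \<rightarrow>\<^sub>M prob_algebra borel"
  unfolding kernel_under_def[abs_def]
  by (rule measurable_bind_prob_space2[OF measurable_w]) (simp add: borel_prod)

lemma kernel_under_prob: "prob_space (kernel_under M w x)"
  and sets_kernel_under[measurable_cong]: "sets (kernel_under M w x) = sets borel"
  using measurable_space[OF measurable_kernel_under, of x] by (auto simp: space_prob_algebra)

lemma measurable_pair_u[measurable]: "(\<lambda>u. (x, u)) \<in> w x' \<rightarrow>\<^sub>M borel"
  unfolding measurable_cong_sets[OF sets_w refl]
  by (intro borel_measurable_continuous_onI continuous_intros)

lemma nn_integral_kernel_under:
  assumes [measurable]: "f \<in> borel_measurable borel"
  shows "(\<integral>\<^sup>+y. f y \<partial>kernel_under M w x) = (\<integral>\<^sup>+u. \<integral>\<^sup>+y. f y \<partial>total_trans M (x, u) \<partial>w x)"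
  unfolding kernel_under_def
  by (rule nn_integral_bind[OF assms measurable_prob_algebraD]) (rule measurable_compose[OF measurable_pair_u measurable_total_trans])

lemma emeasure_kernel_under:
  assumes [measurable]: "A \<in> sets borel"
  shows "emeasure (kernel_under M w x) A = (\<integral>\<^sup>+u. emeasure (total_trans M (x, u)) A \<partial>w x)"
proof -
  have "sets (total_trans M z) = sets borel" for z
    using measurable_space[OF measurable_total_trans, of z] by (simp add: space_prob_algebra)
  then show ?thesis
    using nn_integral_kernel_under[of "indicator A" x] by (simp add: sets_kernel_under)
qed

lemma kernel_minorization:
  assumes "x \<in> B" "A \<in> sets borel"
  shows "ennreal \<delta> * emeasure \<nu> A \<le> emeasure (kernel_under M w x) A"
proof -
  interpret prob_space "w x" by (rule w_prob)
  have "ennreal \<delta> * emeasure \<nu> A = (\<integral>\<^sup>+u. ennreal \<delta> * emeasure \<nu> A \<partial>w x)" by (simp add: emeasure_space_1)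
  also have "\<dots> \<le> (\<integral>\<^sup>+u. emeasure (total_trans M (x, u)) A \<partial>w x)"
    by (rule nn_integral_mono_AE) (use AE_graph[of x] in eventually_elim, simp add: total_trans_def minorization assms)
  finally show ?thesis by (simp add: emeasure_kernel_under assms)
qed

lemma sets_taboo_kernel[measurable_cong]: "sets (taboo_kernel M B \<nu> \<delta> w x) = sets borel"
  by (simp add: taboo_kernel_def sets_kernel_under)

lemma emeasure_taboo_kernel:
  assumes A: "A \<in> sets borel"
  shows "emeasure (taboo_kernel M B \<nu> \<delta> w x) A = emeasure (kernel_under M w x) A - regen B \<delta> x * emeasure \<nu> A"
proof -
  interpret P: prob_space "kernel_under M w x" by (rule kernel_under_prob)
  interpret nu: prob_space \<nu> by (rule prob_nu)
  have "finite_measure (scale_measure (ennreal \<delta>) \<nu>)"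
    by (intro finite_measureI) (simp add: nu.emeasure_space_1 ennreal_mult_eq_top_iff)
  then have "emeasure (diff_measure (kernel_under M w x) (scale_measure (ennreal \<delta>) \<nu>)) A =
      emeasure (kernel_under M w x) A - emeasure (scale_measure (ennreal \<delta>) \<nu>) A" if "x \<in> B"
    using A that by (intro emeasure_diff_measure)
      (auto simp: sets_kernel_under sets_nu kernel_minorization P.finite_measure_axioms)
  then show ?thesis by (simp add: taboo_kernel_def regen_def)
qed

lemma emeasure_kernel_split:
  assumes A: "A \<in> sets borel"
  shows "emeasure (kernel_under M w x) A = emeasure (taboo_kernel M B \<nu> \<delta> w x) A + regen B \<delta> x * emeasure \<nu> A"
proof -
  have "regen B \<delta> x * emeasure \<nu> A \<le> emeasure (kernel_under M w x) A"
    using kernel_minorization[OF _ A, of x] by (cases "x \<in> B") (auto simp: regen_def)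
  then show ?thesis by (simp add: emeasure_taboo_kernel A diff_add_cancel_ennreal)
qed

text \<open>The splitting of the controlled kernel into \<open>T\<close> and
  \<open>s \<otimes> \<nu>\<close>, in the integrated form used by all later estimates.\<close>

lemma nn_integral_kernel_split:
  assumes f: "f \<in> borel_measurable borel"
  shows "(\<integral>\<^sup>+y. f y \<partial>kernel_under M w x) = (\<integral>\<^sup>+y. f y \<partial>taboo_kernel M B \<nu> \<delta> w x) + regen B \<delta> x * (\<integral>\<^sup>+y. f y \<partial>\<nu>)"
  using f by (intro nn_integral_add_mult_measure)
    (auto simp: sets_kernel_under sets_taboo_kernel sets_nu emeasure_kernel_split measurable_cong_sets[OF sets_kernel_under refl])

lemma minorized_chain: "minorized_chain (taboo_kernel M B \<nu> \<delta> w) (regen B \<delta>) \<nu>"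
proof
  interpret nu: prob_space \<nu> by (rule prob_nu)
  have space: "space (kernel_under M w x) = UNIV" "space (taboo_kernel M B \<nu> \<delta> w x) = UNIV" for x
    using sets_eq_imp_space_eq[OF sets_kernel_under] sets_eq_imp_space_eq[OF sets_taboo_kernel] by auto
  show eq1: "emeasure (taboo_kernel M B \<nu> \<delta> w x) UNIV + regen B \<delta> x = 1" for x
    using emeasure_kernel_split[of UNIV x] prob_space.emeasure_space_1[OF kernel_under_prob, of x]
    by (simp add: space nu_UNIV)
  show "taboo_kernel M B \<nu> \<delta> w \<in> borel \<rightarrow>\<^sub>M subprob_algebra borel"
  proof (rule measurable_subprob_algebra)
    show "subprob_space (taboo_kernel M B \<nu> \<delta> w x)" for x
    proof (rule subprob_spaceI)
      have "emeasure (taboo_kernel M B \<nu> \<delta> w x) UNIV \<le> emeasure (taboo_kernel M B \<nu> \<delta> w x) UNIV + regen B \<delta> x"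
        by (rule add_increasing2) auto
      then show "emeasure (taboo_kernel M B \<nu> \<delta> w x) (space (taboo_kernel M B \<nu> \<delta> w x)) \<le> 1"
        by (simp add: space eq1)
    qed (simp add: space)
    fix A :: "'x set" assume [measurable]: "A \<in> sets borel"
    have [measurable]: "(\<lambda>x. emeasure (kernel_under M w x) A) \<in> borel_measurable borel"
      using measurable_kernel_under by (intro measurable_emeasure_kernel[of _ _ borel] measurable_prob_algebraD) auto
    show "(\<lambda>x. emeasure (taboo_kernel M B \<nu> \<delta> w x) A) \<in> borel_measurable borel"
      by (simp add: emeasure_taboo_kernel)
  qed (simp add: sets_taboo_kernel)
qed (auto simp: sets_nu nu_UNIV)

lemma measurable_cost_under[measurable]: "cost_under M w \<in> borel_measurable borel"
  unfolding cost_under_def[abs_def]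
  by (rule nn_integral_measurable_subprob_algebra2[OF _ measurable_prob_algebraD[OF measurable_w]])
    (simp add: borel_prod)

end

end

section \<open>The split chain\<close>

text \<open>The split measures and kernels are given by set functions through
  \<open>measure_of\<close>; this identifies them once the set function is recognised as an actual
  measure.\<close>

lemma measure_of_eq_measure:
  assumes "sets N = sets A" "space A = UNIV" "\<And>C. C \<in> sets A \<Longrightarrow> g C = emeasure N C"
  shows "measure_of UNIV (sets A) g = N"
proof -
  have "sigma_sets UNIV (sets A) = sets A" using sets.sigma_sets_eq[of A] assms(2) by simp
  then have "measure_of UNIV (sets A) g = measure_of UNIV (sets A) (emeasure N)"
    using assms by (intro measure_of_eq) auto
  also have "\<dots> = N"
    using measure_of_of_measure[of N] assms(1,2) sets_eq_imp_space_eq[OF assms(1)] by simp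
  finally show ?thesis .
qed

lemma space_split_algebra[simp]: "space split_algebra = UNIV"
  by (simp add: split_algebra_def space_pair_measure)

lemma measurable_split_embed: "(\<lambda>y. (y, i)) \<in> borel \<rightarrow>\<^sub>M split_algebra"
  unfolding split_algebra_def by measurable

lemma measurable_split_section[measurable]:
  "f \<in> borel_measurable split_algebra \<Longrightarrow> (\<lambda>y. f (y, i)) \<in> borel_measurable borel"
  by (rule measurable_compose[OF measurable_split_embed])

lemma finite_measure_scale_measure:
  "finite_measure N \<Longrightarrow> finite_measure (scale_measure (ennreal c) N)"
  by (intro finite_measureI) (simp add: finite_measure.emeasure_finite ennreal_mult_eq_top_iff space_scale_measure)

lemma measurable_split_fst[measurable]: "fst \<in> split_algebra \<rightarrow>\<^sub>M borel"
  and measurable_split_snd[measurable]: "snd \<in> split_algebra \<rightarrow>\<^sub>M count_space UNIV"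
  unfolding split_algebra_def by measurable

text \<open>The splitting of \<open>\<mu>\<close> as a density on a product, so that its integrals
  reduce to integrals over \<open>\<mu>\<close>.\<close>

definition lift_split :: "'x::topological_space set \<Rightarrow> real \<Rightarrow> 'x measure \<Rightarrow> ('x \<times> bool) measure" where
  "lift_split B \<delta> \<mu> = density (\<mu> \<Otimes>\<^sub>M count_space UNIV) (\<lambda>(y, i). if i then regen B \<delta> y else hold B \<delta> y)"

text \<open>The mass that the splitting of a unit mass at \<open>y\<close> assigns to
  \<open>C\<close>.\<close>

definition split_weight :: "'x set \<Rightarrow> real \<Rightarrow> ('x \<times> bool) set \<Rightarrow> 'x \<Rightarrow> ennreal" where
  "split_weight B \<delta> C y = hold B \<delta> y * indicator C (y, False) + regen B \<delta> y * indicator C (y, True)"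

lemma return_time_less_iff: "enat k < return_time B \<omega> \<longleftrightarrow> (\<forall>i\<in>{1..k}. \<omega> i \<notin> B \<times> {True})"
proof
  assume "enat k < return_time B \<omega>"
  then have "enat k < enat n" if "1 \<le> n" "\<omega> n \<in> B \<times> {True}" for n
    using that unfolding return_time_def by (intro less_INF_D[of _ enat "{n. 1 \<le> n \<and> \<omega> n \<in> B \<times> {True}}"]) auto
  then show "\<forall>i\<in>{1..k}. \<omega> i \<notin> B \<times> {True}" by force
next
  assume *: "\<forall>i\<in>{1..k}. \<omega> i \<notin> B \<times> {True}"
  have "enat (Suc k) \<le> return_time B \<omega>"
    unfolding return_time_def
  proof (rule INF_greatest)
    fix n assume "n \<in> {n. 1 \<le> n \<and> \<omega> n \<in> B \<times> {True}}"
    then have "\<not> n \<le> k" using *[rule_format, of n] by auto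
    then show "enat (Suc k) \<le> enat n" by simp
  qed
  then show "enat k < return_time B \<omega>" by (rule less_le_trans[rotated]) simp
qed

context split_mdp
begin

lemma regen_fin: "regen B \<delta> x < \<top>"
  by (simp add: regen_def indicator_def)

lemma sets_lift_split: "sets \<mu> = sets borel \<Longrightarrow> sets (lift_split B \<delta> \<mu>) = sets split_algebra"
  unfolding lift_split_def split_algebra_def sets_density by (rule sets_pair_measure_cong) simp_all

lemma measurable_split_weight_fun: "(\<lambda>(y, i). if i then regen B \<delta> y else hold B \<delta> y) \<in> borel_measurable split_algebra"
proof -
  have "(\<lambda>s. if snd s then regen B \<delta> (fst s) else hold B \<delta> (fst s)) \<in> borel_measurable split_algebra" by measurable
  then show ?thesis by (simp add: case_prod_beta')
qed

lemma nn_integral_lift_split: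
  assumes mu: "sets \<mu> = sets borel" and f[measurable]: "f \<in> borel_measurable split_algebra"
  shows "(\<integral>\<^sup>+s. f s \<partial>lift_split B \<delta> \<mu>) = (\<integral>\<^sup>+y. hold B \<delta> y * f (y, False) + regen B \<delta> y * f (y, True) \<partial>\<mu>)"
proof -
  let ?g = "\<lambda>(y, i). if i then regen B \<delta> y else hold B \<delta> y"
  have sets: "sets (\<mu> \<Otimes>\<^sub>M count_space UNIV) = sets split_algebra"
    using mu unfolding split_algebra_def by (intro sets_pair_measure_cong) simp_all
  note cong = measurable_cong_sets[OF sets refl]
  have m: "(\<lambda>s. ?g s * f s) \<in> borel_measurable (\<mu> \<Otimes>\<^sub>M count_space UNIV)"
    unfolding cong using measurable_split_weight_fun by measurable
  have "(\<integral>\<^sup>+s. f s \<partial>lift_split B \<delta> \<mu>) = (\<integral>\<^sup>+s. ?g s * f s \<partial>(\<mu> \<Otimes>\<^sub>M count_space UNIV))"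
    unfolding lift_split_def
    by (rule nn_integral_density) (simp_all only: cong measurable_split_weight_fun f)
  also have "\<dots> = (\<integral>\<^sup>+y. \<integral>\<^sup>+i. ?g (y, i) * f (y, i) \<partial>count_space UNIV \<partial>\<mu>)"
    by (rule sigma_finite_measure.nn_integral_fst[OF _ m, symmetric]) (simp add: sigma_finite_measure_count_space)
  also have "\<dots> = (\<integral>\<^sup>+y. hold B \<delta> y * f (y, False) + regen B \<delta> y * f (y, True) \<partial>\<mu>)"
    by (simp add: nn_integral_count_space_finite UNIV_bool)
  finally show ?thesis .
qed

lemma measurable_split_weight[measurable]:
  assumes [measurable]: "C \<in> sets split_algebra"
  shows "split_weight B \<delta> C \<in> borel_measurable borel"
proof -
  have [measurable]: "indicator C \<in> borel_measurable split_algebra" by measurable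
  show ?thesis unfolding split_weight_def[abs_def] by measurable
qed

lemma emeasure_lift_split:
  assumes "sets \<mu> = sets borel" and C: "C \<in> sets split_algebra"
  shows "emeasure (lift_split B \<delta> \<mu>) C = (\<integral>\<^sup>+y. split_weight B \<delta> C y \<partial>\<mu>)"
  using nn_integral_lift_split[OF assms(1), of "indicator C"] C
  by (simp add: sets_lift_split assms(1) split_weight_def)

lemma emeasure_lift_split_UNIV:
  assumes "sets \<mu> = sets borel"
  shows "emeasure (lift_split B \<delta> \<mu>) UNIV = emeasure \<mu> UNIV"
proof -
  have "split_weight B \<delta> UNIV = (\<lambda>_. 1)" by (simp add: split_weight_def fun_eq_iff hold_add_regen)
  moreover have "UNIV \<in> sets (split_algebra :: ('x \<times> bool) measure)" using sets.top[of split_algebra] by simp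
  ultimately show ?thesis
    using emeasure_lift_split[OF assms, of UNIV] sets_eq_imp_space_eq[OF assms] by simp
qed

lemma split_measure_eq:
  assumes mu: "sets \<mu> = sets borel"
  shows "split_measure B \<delta> \<mu> = lift_split B \<delta> \<mu>"
  unfolding split_measure_def
proof (rule measure_of_eq_measure)
  note [measurable_cong] = mu
  fix C :: "('x \<times> bool) set" assume C[measurable]: "C \<in> sets split_algebra"
  have [measurable]: "{x. (x, i) \<in> C} \<in> sets borel" for i
    using measurable_sets[OF measurable_split_embed C, of i] by (simp add: vimage_def)
  have "split_weight B \<delta> C y = ennreal (1 - \<delta>) * indicator ({x. (x, False) \<in> C} \<inter> B) y +
      indicator ({x. (x, False) \<in> C} \<inter> - B) y + ennreal \<delta> * indicator ({x. (x, True) \<in> C} \<inter> B) y" for y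
    by (auto simp: split_weight_def hold_def regen_def indicator_def)
  then have "(\<integral>\<^sup>+y. split_weight B \<delta> C y \<partial>\<mu>) = ennreal (1 - \<delta>) * emeasure \<mu> ({x. (x, False) \<in> C} \<inter> B)
      + emeasure \<mu> ({x. (x, False) \<in> C} \<inter> - B) + ennreal \<delta> * emeasure \<mu> ({x. (x, True) \<in> C} \<inter> B)"
    by (simp add: nn_integral_add nn_integral_cmult)
  then show "ennreal (1 - \<delta>) * emeasure \<mu> ({x. (x, False) \<in> C} \<inter> B)
      + emeasure \<mu> ({x. (x, False) \<in> C} \<inter> - B) + ennreal \<delta> * emeasure \<mu> ({x. (x, True) \<in> C} \<inter> B)
      = emeasure (lift_split B \<delta> \<mu>) C"
    by (simp add: emeasure_lift_split mu C)
qed (simp_all add: sets_lift_split mu)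

lemma finite_measure_lift_split:
  assumes "sets \<mu> = sets borel" "emeasure \<mu> UNIV < \<infinity>"
  shows "finite_measure (lift_split B \<delta> \<mu>)"
  using assms by (intro finite_measureI)
    (auto simp: sets_eq_imp_space_eq[OF sets_lift_split[OF assms(1)]] emeasure_lift_split_UNIV)

lemma inverse_hold: "x \<in> B \<Longrightarrow> ennreal (1 / (1 - \<delta>)) = 1 / hold B \<delta> x"
  using divide_ennreal[of 1 "1 - \<delta>"] delta_less_1 by (simp add: hold_def)

text \<open>One formula covers both cases: off \<open>B\<close> the weight \<open>hold\<close> is 1
  and \<open>regen\<close> is 0.\<close>

lemma emeasure_split_kernel_False:
  assumes z: "(x, u) \<in> graphK M" and C: "C \<in> sets split_algebra"
  shows "emeasure (split_kernel M B \<nu> \<delta> (x, False) u) C =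
    1 / hold B \<delta> x * ((\<integral>\<^sup>+y. split_weight B \<delta> C y \<partial>total_trans M (x, u)) - regen B \<delta> x * (\<integral>\<^sup>+y. split_weight B \<delta> C y \<partial>\<nu>))"
proof -
  have st: "sets (trans M (x, u)) = sets borel" and pt: "prob_space (trans M (x, u))"
    using trans_prob[OF z] by (auto simp: space_prob_algebra)
  have tt: "total_trans M (x, u) = trans M (x, u)" using z by (simp add: total_trans_def)
  show ?thesis
  proof (cases "x \<in> B")
    case False
    then show ?thesis
      by (simp add: split_kernel_def split_measure_eq st emeasure_lift_split C hold_def regen_def tt)
  next
    case True
    have t1: "emeasure (trans M (x, u)) UNIV = 1"
      using prob_space.emeasure_space_1[OF pt] sets_eq_imp_space_eq[OF st] by simp
    have f1: "finite_measure (lift_split B \<delta> (trans M (x, u)))"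
      by (rule finite_measure_lift_split[OF st]) (simp add: t1)
    have f2: "finite_measure (scale_measure (ennreal \<delta>) (lift_split B \<delta> \<nu>))"
      using nu_UNIV by (intro finite_measure_scale_measure finite_measure_lift_split) (simp_all add: sets_nu)
    \<comment> \<open>Domination passes to the lifts: the transition law is \<open>L\<close> plus
      \<open>\<delta>\<close> times \<open>\<nu>\<close>, and lifting integrates a nonnegative
      weight against each part.\<close>
    have le: "ennreal \<delta> * emeasure (lift_split B \<delta> \<nu>) A \<le> emeasure (lift_split B \<delta> (trans M (x, u))) A" if A: "A \<in> sets split_algebra" for A
    proof -
      define L where "L = diff_measure (trans M (x, u)) (scale_measure (ennreal \<delta>) \<nu>)"
      have fin: "finite_measure (scale_measure (ennreal \<delta>) \<nu>)"
        by (intro finite_measure_scale_measure prob_space.finite_measure prob_nu)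
      have "emeasure L D = emeasure (trans M (x, u)) D - ennreal \<delta> * emeasure \<nu> D" if "D \<in> sets borel" for D
        unfolding L_def using that minorization[OF z] True
        by (subst emeasure_diff_measure[OF prob_space.finite_measure[OF pt] fin]) (auto simp: st sets_nu)
      then have "emeasure (trans M (x, u)) D = emeasure L D + ennreal \<delta> * emeasure \<nu> D" if "D \<in> sets borel" for D
        using that minorization[OF z, of D] True by (simp add: diff_add_cancel_ennreal)
      then have "(\<integral>\<^sup>+y. split_weight B \<delta> A y \<partial>trans M (x, u)) =
          (\<integral>\<^sup>+y. split_weight B \<delta> A y \<partial>L) + ennreal \<delta> * (\<integral>\<^sup>+y. split_weight B \<delta> A y \<partial>\<nu>)"
        using A by (intro nn_integral_add_mult_measure)
          (auto simp: st sets_nu L_def measurable_cong_sets[OF st refl])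
      then show ?thesis using A by (simp add: emeasure_lift_split st sets_nu add_increasing)
    qed
    have "emeasure (split_kernel M B \<nu> \<delta> (x, False) u) C =
        ennreal (1 / (1 - \<delta>)) * emeasure (diff_measure (lift_split B \<delta> (trans M (x, u)))
            (scale_measure (ennreal \<delta>) (lift_split B \<delta> \<nu>))) C"
      using True by (simp add: split_kernel_def split_measure_eq st sets_nu)
    also have "emeasure (diff_measure (lift_split B \<delta> (trans M (x, u)))
            (scale_measure (ennreal \<delta>) (lift_split B \<delta> \<nu>))) C =
        emeasure (lift_split B \<delta> (trans M (x, u))) C - ennreal \<delta> * emeasure (lift_split B \<delta> \<nu>) C"
      using C le by (subst emeasure_diff_measure[OF f1 f2]) (auto simp: sets_lift_split st sets_nu)
    finally show ?thesis
      using True by (simp add: inverse_hold emeasure_lift_split st sets_nu C tt regen_def)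
  qed
qed

context
  fixes w :: "'x \<Rightarrow> 'u measure"
  assumes w: "w \<in> stationary M"
begin

interpretation minorized_chain "taboo_kernel M B \<nu> \<delta> w" "regen B \<delta>" \<nu>
  by (rule minorized_chain[OF w])

text \<open>From level \<open>False\<close> this is the step conditioned on not regenerating: the
  taboo kernel has mass \<open>hold\<close> at the current state, hence the factor.\<close>

definition split_chain :: "'x \<times> bool \<Rightarrow> ('x \<times> bool) measure" where
  "split_chain s = (if snd s then lift_split B \<delta> \<nu>
     else scale_measure (1 / hold B \<delta> (fst s)) (lift_split B \<delta> (taboo_kernel M B \<nu> \<delta> w (fst s))))"

lemma sets_split_chain: "sets (split_chain s) = sets split_algebra"
  by (simp add: split_chain_def sets_lift_split sets_T split_mdp.sets_nu[OF split_mdp_axioms])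

lemma emeasure_split_chain:
  assumes C: "C \<in> sets split_algebra"
  shows "emeasure (split_chain s) C = (if snd s then (\<integral>\<^sup>+y. split_weight B \<delta> C y \<partial>\<nu>)
     else 1 / hold B \<delta> (fst s) * taboo (split_weight B \<delta> C) (fst s))"
  using C by (simp add: split_chain_def emeasure_lift_split sets_T split_mdp.sets_nu[OF split_mdp_axioms] taboo_def)

text \<open>Averaging over actions commutes with the subtraction in the split kernel, because the
  subtracted measure is finite and the same for all actions.\<close>

lemma split_kernel_under_eq: "split_kernel_under M B \<nu> \<delta> w s = split_chain s"
  unfolding split_kernel_under_def
proof (rule measure_of_eq_measure)
  note snu = split_mdp.sets_nu[OF split_mdp_axioms]
  fix C :: "('x \<times> bool) set" assume C[measurable]: "C \<in> sets split_algebra"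
  obtain x i where s: "s = (x, i)" by (cases s)
  interpret W: prob_space "w x" by (rule w_prob[OF w])
  show "(\<integral>\<^sup>+u. emeasure (split_kernel M B \<nu> \<delta> s u) C \<partial>w (fst s)) = emeasure (split_chain s) C"
  proof (cases i)
    case True
    then show ?thesis
      by (simp add: s split_kernel_def emeasure_split_chain C split_measure_eq[OF snu] emeasure_lift_split[OF snu] W.emeasure_space_1)
  next
    case False
    let ?\<phi> = "split_weight B \<delta> C"
    let ?k = "regen B \<delta> x * (\<integral>\<^sup>+y. ?\<phi> y \<partial>\<nu>)"
    have "?\<phi> y \<le> 1" for y
      unfolding hold_add_regen[of y, symmetric] split_weight_def
      by (intro add_mono) (auto simp: indicator_def)
    then have "(\<integral>\<^sup>+y. ?\<phi> y \<partial>\<nu>) \<le> 1"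
      using nn_integral_mono[of \<nu> ?\<phi> "\<lambda>_. 1"] nu_UNIV by simp
    then have k: "?k < \<top>" using regen_fin[of x] by (auto simp: ennreal_mult_less_top intro: le_less_trans)
    have m: "(\<lambda>u. \<integral>\<^sup>+y. ?\<phi> y \<partial>total_trans M (x, u)) \<in> borel_measurable (w x)"
      by (rule measurable_compose[OF measurable_pair_u[OF w]])
        (rule nn_integral_measurable_subprob_algebra2[OF _ measurable_prob_algebraD[OF measurable_total_trans]], measurable)
    have eq: "AE u in w x. emeasure (split_kernel M B \<nu> \<delta> s u) C =
        1 / hold B \<delta> x * ((\<integral>\<^sup>+y. ?\<phi> y \<partial>total_trans M (x, u)) - ?k)"
      using AE_graph[OF w, of x] by eventually_elim (simp add: s False emeasure_split_kernel_False C)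
    have le: "AE u in w x. ?k \<le> (\<integral>\<^sup>+y. ?\<phi> y \<partial>total_trans M (x, u))"
      using AE_graph[OF w, of x]
    proof eventually_elim
      case (elim u)
      show ?case
      proof (cases "x \<in> B")
        case True
        have st: "sets (trans M (x, u)) = sets borel" using trans_prob[OF elim] by (simp add: space_prob_algebra)
        have "(\<integral>\<^sup>+y. ?\<phi> y \<partial>scale_measure (ennreal \<delta>) \<nu>) \<le> (\<integral>\<^sup>+y. ?\<phi> y \<partial>trans M (x, u))"
          using True elim minorization[OF elim] by (intro nn_integral_mono_measure) (auto simp: le_measure st snu)
        then show ?thesis using True elim
          by (simp add: total_trans_def regen_def nn_integral_scale_measure measurable_cong_sets[OF snu refl])
      qed (simp add: regen_def)
    qed
    have "(\<integral>\<^sup>+u. emeasure (split_kernel M B \<nu> \<delta> s u) C \<partial>w (fst s)) =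
        (\<integral>\<^sup>+u. 1 / hold B \<delta> x * ((\<integral>\<^sup>+y. ?\<phi> y \<partial>total_trans M (x, u)) - ?k) \<partial>w x)"
      unfolding s fst_conv using eq by (intro nn_integral_cong_AE) (simp add: s)
    also have "\<dots> = 1 / hold B \<delta> x * (\<integral>\<^sup>+u. (\<integral>\<^sup>+y. ?\<phi> y \<partial>total_trans M (x, u)) - ?k \<partial>w x)"
      by (rule nn_integral_cmult) (use m in measurable)
    also have "(\<integral>\<^sup>+u. (\<integral>\<^sup>+y. ?\<phi> y \<partial>total_trans M (x, u)) - ?k \<partial>w x) =
        (\<integral>\<^sup>+u. \<integral>\<^sup>+y. ?\<phi> y \<partial>total_trans M (x, u) \<partial>w x) - (\<integral>\<^sup>+u. ?k \<partial>w x)"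
      using k le by (intro nn_integral_diff m) (auto simp: W.emeasure_space_1)
    also have "(\<integral>\<^sup>+u. \<integral>\<^sup>+y. ?\<phi> y \<partial>total_trans M (x, u) \<partial>w x) = taboo ?\<phi> x + ?k"
      unfolding nn_integral_kernel_under[OF w measurable_split_weight[OF C], symmetric] taboo_def
      by (rule nn_integral_kernel_split[OF w measurable_split_weight[OF C]])
    finally show ?thesis
      using k by (simp add: W.emeasure_space_1 emeasure_split_chain C s False)
  qed
qed (simp_all add: sets_split_chain)

lemma measurable_split_chain: "split_chain \<in> split_algebra \<rightarrow>\<^sub>M prob_algebra split_algebra"
proof -
  have UNIV: "UNIV \<in> sets (split_algebra :: ('x \<times> bool) measure)" using sets.top[of split_algebra] by simp
  have one: "split_weight B \<delta> UNIV = (\<lambda>_. 1)" by (simp add: split_weight_def fun_eq_iff hold_add_regen)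
  have prob: "prob_space (split_chain s)" for s
  proof
    have "1 / hold B \<delta> x * taboo (\<lambda>_. 1) x = 1" for x
    proof -
      have "taboo (\<lambda>_. 1) x + regen B \<delta> x = hold B \<delta> x + regen B \<delta> x" by (simp add: taboo_one hold_add_regen)
      then have "regen B \<delta> x + taboo (\<lambda>_. 1) x = regen B \<delta> x + hold B \<delta> x" by (simp only: add.commute)
      then have "taboo (\<lambda>_. 1) x = hold B \<delta> x" using regen_fin[of x] by (simp only: ennreal_add_left_cancel) auto
      then show ?thesis using hold_pos[of x] hold_fin[of x] by (simp add: ennreal_divide_times ennreal_divide_self)
    qed
    then show "emeasure (split_chain s) (space (split_chain s)) = 1"
      by (simp add: sets_eq_imp_space_eq[OF sets_split_chain] emeasure_split_chain UNIV one nu_UNIV)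
  qed
  have "split_chain \<in> split_algebra \<rightarrow>\<^sub>M subprob_algebra split_algebra"
  proof (rule measurable_subprob_algebra)
    fix C :: "('x \<times> bool) set" assume [measurable]: "C \<in> sets split_algebra"
    show "(\<lambda>s. emeasure (split_chain s) C) \<in> borel_measurable split_algebra"
      by (simp add: emeasure_split_chain)
  qed (auto simp: sets_split_chain intro: prob_space_imp_subprob_space prob)
  then show ?thesis by (intro measurable_prob_algebraI prob)
qed

text \<open>Before its return, the split chain is \<open>T\<close> conjugated by the multiplication
  with \<open>hold\<close>: an arrival at \<open>y\<close> stays at level \<open>False\<close> with
  weight \<open>hold\<close>, and the level \<open>True\<close> over \<open>B\<close> is
  excluded.\<close>

lemma avoiding_split_chain:
  assumes f[measurable]: "f \<in> borel_measurable split_algebra"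
  shows "avoiding_kernel split_chain (B \<times> {True}) f (x, False) = 1 / hold B \<delta> x * taboo (\<lambda>y. hold B \<delta> y * f (y, False)) x"
proof -
  have BT[measurable]: "B \<times> {True} \<in> sets split_algebra" unfolding split_algebra_def by (intro pair_measureI) auto
  have m[measurable]: "(\<lambda>s. indicator (- (B \<times> {True})) s * f s) \<in> borel_measurable split_algebra"
    by measurable
  have "avoiding_kernel split_chain (B \<times> {True}) f (x, False) =
      1 / hold B \<delta> x * (\<integral>\<^sup>+s. indicator (- (B \<times> {True})) s * f s \<partial>lift_split B \<delta> (taboo_kernel M B \<nu> \<delta> w x))"
    unfolding avoiding_kernel_def split_chain_def
    by (simp add: nn_integral_scale_measure measurable_cong_sets[OF sets_lift_split[OF sets_T] refl])
  also have "(\<integral>\<^sup>+s. indicator (- (B \<times> {True})) s * f s \<partial>lift_split B \<delta> (taboo_kernel M B \<nu> \<delta> w x)) =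
      taboo (\<lambda>y. hold B \<delta> y * f (y, False)) x"
    unfolding nn_integral_lift_split[OF sets_T m] taboo_def
    by (intro nn_integral_cong) (auto simp: regen_def indicator_def)
  finally show ?thesis .
qed

text \<open>Between consecutive steps the conjugating factors \<open>hold\<close> and
  \<open>1 / hold\<close> cancel.\<close>

lemma avoiding_split_chain_iterate:
  assumes f: "f \<in> borel_measurable split_algebra"
  shows "(avoiding_kernel split_chain (B \<times> {True}) ^^ k) f (x, False) =
    1 / hold B \<delta> x * (taboo ^^ k) (\<lambda>y. hold B \<delta> y * f (y, False)) x"
proof -
  have BT: "B \<times> {True} \<in> sets split_algebra" unfolding split_algebra_def by (intro pair_measureI) auto
  have m: "(avoiding_kernel split_chain (B \<times> {True}) ^^ k) f \<in> borel_measurable split_algebra" for k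
    using measurable_avoiding_kernel[OF measurable_split_chain _ BT]
    by (induction k) (auto simp: f)
  show ?thesis
  proof (induction k arbitrary: x)
    case 0
    show ?case using hold_cancel[of x "f (x, False)"] by (simp add: ac_simps)
  next
    case (Suc k)
    have "(avoiding_kernel split_chain (B \<times> {True}) ^^ Suc k) f (x, False) =
        1 / hold B \<delta> x * taboo (\<lambda>y. hold B \<delta> y * (avoiding_kernel split_chain (B \<times> {True}) ^^ k) f (y, False)) x"
      by (simp add: avoiding_split_chain m)
    then show ?case by (simp add: Suc hold_cancel)
  qed
qed

text \<open>This removes path measures from the definition of the value function; from here on only
  potentials of \<open>T\<close> occur.\<close>

lemma expected_cycle_sum_eq:
  assumes f: "f \<in> borel_measurable split_algebra"
  shows "expected_cycle_sum M B \<nu> \<delta> w f (x, False) = 1 / hold B \<delta> x * potential (\<lambda>y. hold B \<delta> y * f (y, False)) x"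
proof -
  have BT: "B \<times> {True} \<in> sets split_algebra" unfolding split_algebra_def by (intro pair_measureI) auto
  have law: "split_law M B \<nu> \<delta> w (x, False) = path_measure split_algebra (markov_path_kernel split_algebra split_chain (x, False))"
    unfolding split_law_def markov_path_kernel_def[abs_def] split_kernel_under_eq ..
  have "expected_cycle_sum M B \<nu> \<delta> w f (x, False) = (\<Sum>k. (avoiding_kernel split_chain (B \<times> {True}) ^^ k) f (x, False))"
    unfolding expected_cycle_sum_def law return_time_less_iff
    by (rule nn_integral_path_avoiding[OF measurable_split_chain _ BT f]) simp
  then show ?thesis by (simp add: avoiding_split_chain_iterate[OF f] potential_def)
qed

end

end

section \<open>The value function\<close>

context minorized_chain
begin

text \<open>Iterating leaves the remainder \<open>T^k V\<close>. The bound \<open>V_le\<close> makes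
  it vanish, since \<open>U c\<close> and \<open>U 1\<close> are finite at \<open>x\<close>. In the
  application \<open>b\<close> is \<open>\<beta>\<close> and \<open>n\<close> is the
  \<open>\<nu>\<close>-integral of \<open>V\<close>, both up to shift.\<close>

lemma value_le_potential:
  assumes [measurable]: "V \<in> borel_measurable borel" "c \<in> borel_measurable borel"
    and le: "\<And>y. V y + b \<le> taboo V y + (c y + s y * n)"
    and b: "b < \<infinity>" and V_le: "\<And>y. V y \<le> potential c y + K" and K: "K < \<infinity>" and n: "n < \<infinity>"
    and fin: "potential c x < \<infinity>" "potential (\<lambda>_. 1) x < \<infinity>"
  shows "V x + b * potential (\<lambda>_. 1) x \<le> potential c x + n"
proof -
  let ?R = "\<lambda>k. ((taboo ^^ k) (potential c) x + K * (taboo ^^ k) (\<lambda>_. 1) x) + (potential c x + n * 1)"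
  have "V x + b * (\<Sum>j<k. (taboo ^^ j) (\<lambda>_. 1) x) \<le> ?R k" for k
  proof -
    have "V x + (\<Sum>j<k. (taboo ^^ j) (\<lambda>_. b * 1) x) \<le> (taboo ^^ k) V x + (\<Sum>j<k. (taboo ^^ j) (\<lambda>y. c y + n * s y) x)"
      using le by (intro unroll_le) (auto simp: mult.commute)
    also have "\<dots> \<le> (taboo ^^ k) (\<lambda>y. potential c y + K * 1) x + (\<Sum>j<k. (taboo ^^ j) (\<lambda>y. c y + n * s y) x)"
      by (intro add_mono order_refl taboo_iterate_mono) (simp add: V_le)
    also have "(taboo ^^ k) (\<lambda>y. potential c y + K * 1) x = (taboo ^^ k) (potential c) x + K * (taboo ^^ k) (\<lambda>_. 1) x"
    proof -
      have 1: "(taboo ^^ k) (\<lambda>_. K * 1) = (\<lambda>x. K * (taboo ^^ k) (\<lambda>_. 1) x)"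
        by (rule taboo_iterate_cmult) simp
      have "(taboo ^^ k) (\<lambda>y. potential c y + K * 1) =
          (\<lambda>x. (taboo ^^ k) (potential c) x + (taboo ^^ k) (\<lambda>_. K * 1) x)"
        by (rule taboo_iterate_add) auto
      then show ?thesis by (simp only: 1)
    qed
    also have "(\<Sum>j<k. (taboo ^^ j) (\<lambda>y. c y + n * s y) x) = (\<Sum>j<k. (taboo ^^ j) c x) + n * (\<Sum>j<k. (taboo ^^ j) s x)"
      by (simp add: taboo_iterate_add taboo_iterate_cmult sum.distrib sum_distrib_left)
    also have "(taboo ^^ k) (potential c) x + K * (taboo ^^ k) (\<lambda>_. 1) x + \<dots> \<le> ?R k"
      by (intro add_mono order_refl mult_left_mono partial_sums_le_potential
          order_trans[OF partial_sums_le_potential potential_s_le]) auto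
    also have "(\<Sum>j<k. (taboo ^^ j) (\<lambda>_. b * 1) x) = b * (\<Sum>j<k. (taboo ^^ j) (\<lambda>_. 1) x)"
      unfolding taboo_iterate_cmult[OF borel_measurable_const] by (simp add: sum_distrib_left)
    finally show ?thesis .
  qed
  moreover have "?R \<longlonglongrightarrow> (0 + K * 0) + (potential c x + n * 1)"
    using K by (intro tendsto_add tendsto_const ennreal_tendsto_cmult taboo_iterate_potential_tendsto
        taboo_iterate_one_tendsto fin) auto
  moreover have "(\<lambda>k. V x + b * (\<Sum>j<k. (taboo ^^ j) (\<lambda>_. 1) x)) \<longlonglongrightarrow> V x + b * potential (\<lambda>_. 1) x"
    using b by (intro tendsto_add tendsto_const ennreal_tendsto_cmult partial_sums_tendsto_potential) simp
  ultimately show ?thesis by (intro LIMSEQ_le[of _ _ ?R]) auto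
qed

text \<open>The converse comparison: here the remainder is nonnegative on the smaller side and is
  dropped. The full \<open>n\<close> appears because \<open>U s = 1\<close>.\<close>

lemma potential_le_value:
  assumes [measurable]: "V \<in> borel_measurable borel" "c \<in> borel_measurable borel"
    and le: "\<And>y. taboo V y + (c y + s y * n) \<le> V y + b"
    and fin: "potential (\<lambda>_. 1) x < \<infinity>"
  shows "potential c x + n \<le> V x + b * potential (\<lambda>_. 1) x"
proof -
  have "(\<Sum>j<k. (taboo ^^ j) (\<lambda>y. c y + n * s y) x) \<le> V x + b * potential (\<lambda>_. 1) x" for k
  proof -
    have "(\<Sum>j<k. (taboo ^^ j) (\<lambda>y. c y + n * s y) x) \<le> (taboo ^^ k) V x + (\<Sum>j<k. (taboo ^^ j) (\<lambda>y. c y + n * s y) x)"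
      by (rule add_increasing) auto
    also have "\<dots> \<le> V x + (\<Sum>j<k. (taboo ^^ j) (\<lambda>_. b * 1) x)"
      using le by (intro unroll_ge) (auto simp: mult.commute)
    also have "(\<Sum>j<k. (taboo ^^ j) (\<lambda>_. b * 1) x) = b * (\<Sum>j<k. (taboo ^^ j) (\<lambda>_. 1) x)"
      unfolding taboo_iterate_cmult[OF borel_measurable_const] by (simp add: sum_distrib_left)
    also have "V x + \<dots> \<le> V x + b * potential (\<lambda>_. 1) x"
      by (intro add_mono order_refl mult_left_mono partial_sums_le_potential) auto
    finally show ?thesis .
  qed
  then have "potential (\<lambda>y. c y + n * s y) x \<le> V x + b * potential (\<lambda>_. 1) x"
    by (intro LIMSEQ_le_const2[OF partial_sums_tendsto_potential]) auto
  moreover have "potential (\<lambda>y. c y + n * s y) x = potential c x + n * potential s x"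
    by (simp add: potential_add potential_cmult)
  ultimately show ?thesis by (simp add: potential_s[OF fin])
qed

end

text \<open>The negative part of \<open>f\<close> integrates to at most \<open>K\<close>, so no
  difference of infinities occurs; pointwise, \<open>f + K\<close> plus the negative part equals the
  positive part plus \<open>K\<close>.\<close>

lemma ext_integral_shift:
  assumes "prob_space \<mu>" and f: "f \<in> borel_measurable \<mu>" and K: "0 \<le> K" "\<And>x. 0 \<le> f x + K"
  shows "ext_integral \<mu> f + ereal K = enn2ereal (\<integral>\<^sup>+x. ennreal (f x + K) \<partial>\<mu>)"
proof -
  interpret prob_space \<mu> by fact
  let ?P = "\<integral>\<^sup>+x. ennreal (f x) \<partial>\<mu>" and ?N = "\<integral>\<^sup>+x. ennreal (- f x) \<partial>\<mu>" and ?I = "\<integral>\<^sup>+x. ennreal (f x + K) \<partial>\<mu>"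
  have pw: "ennreal (f x + K) + ennreal (- f x) = ennreal (f x) + ennreal K" for x
    using K(1) K(2)[of x] by (cases "0 \<le> f x") (auto simp: ennreal_neg ennreal_plus[symmetric] simp del: ennreal_plus)
  have "?I + ?N = ?P + ennreal K"
    using f by (simp add: nn_integral_add[symmetric] pw) (simp add: nn_integral_add emeasure_space_1)
  moreover have "?N \<le> (\<integral>\<^sup>+x. ennreal K \<partial>\<mu>)"
  proof (intro nn_integral_mono ennreal_leI)
    show "- f x \<le> K" for x using K(2)[of x] by simp
  qed
  then have "?N \<le> ennreal K" by (simp add: emeasure_space_1)
  then have "?N \<noteq> \<top>" by (auto simp: top_unique)
  then obtain n where n: "?N = ennreal n" "0 \<le> n" by (cases ?N) auto
  ultimately show ?thesis unfolding ext_integral_def using K(1)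
    by (cases ?P; cases ?I) (auto simp: n enn2ereal_ennreal ennreal_plus[symmetric] simp del: ennreal_plus)
qed

context split_mdp
begin

text \<open>Adding \<open>beta M\<close> removes the subtraction and \<open>K\<close> passes through
  the probability kernel, so the Bellman expression becomes an \<open>ennreal\<close> sum.\<close>

lemma bellman_shift:
  assumes z: "(x, u) \<in> graphK M" and f: "f \<in> borel_measurable borel" and K: "0 \<le> K" "\<And>x. 0 \<le> f x + K"
  shows "bellman_rhs M f x u + ereal (K + beta M) =
    enn2ereal (cost M (x, u) + (\<integral>\<^sup>+y. ennreal (f y + K) \<partial>trans M (x, u)))"
proof -
  have p: "prob_space (trans M (x, u))" and st: "sets (trans M (x, u)) = sets borel"
    using trans_prob[OF z] by (auto simp: space_prob_algebra)
  have "f \<in> borel_measurable (trans M (x, u))" using f by (simp add: measurable_cong_sets[OF st refl])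
  from ext_integral_shift[OF p this K] show ?thesis
    unfolding bellman_rhs_def plus_ennreal.rep_eq
    by (cases "ext_integral (trans M (x, u)) f"; cases "enn2ereal (cost M (x, u))")
      (auto simp: algebra_simps dest: sym)
qed

end

text \<open>The shift \<open>K\<close> is a parameter because the comparison with the iterates uses
  the same \<open>V\<close> with two different shifts.\<close>

locale split_mdp_value = split_mdp M B \<nu> \<delta>
  for M :: "('x::polish_space, 'u::polish_space) mdp" and B \<nu> \<delta> +
  fixes V :: "'x \<Rightarrow> real" and K :: real
  assumes V[measurable]: "V \<in> borel_measurable borel" and K: "0 \<le> K" "\<And>x. 0 \<le> V x + K"
    and V_eq: "\<And>x. ereal (V x) = Vstar M B \<nu> \<delta> x"
    and V_opt: "solves_optimality_equation M V"
begin

definition V0 :: "'x \<Rightarrow> ennreal" where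
  "V0 x = ennreal (V x + K)"

lemma measurable_V0[measurable]: "V0 \<in> borel_measurable borel"
  unfolding V0_def[abs_def] by measurable

lemma V0_le:
  assumes z: "(x, u) \<in> graphK M"
  shows "V0 x + ennreal (beta M) \<le> cost M (x, u) + (\<integral>\<^sup>+y. V0 y \<partial>trans M (x, u))"
proof -
  have "ereal (V x) \<le> bellman_rhs M V x u"
    using V_opt z by (auto simp: solves_optimality_equation_def is_minimum_over_def graphK_def)
  then have "ereal (V x) + ereal (K + beta M) \<le> bellman_rhs M V x u + ereal (K + beta M)"
    by (rule add_right_mono)
  also have "\<dots> = enn2ereal (cost M (x, u) + (\<integral>\<^sup>+y. V0 y \<partial>trans M (x, u)))"
    unfolding V0_def by (rule bellman_shift[OF z V K])
  also have "ereal (V x) + ereal (K + beta M) = enn2ereal (V0 x + ennreal (beta M))"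
    using K(2)[of x] beta_nonneg by (simp add: V0_def plus_ennreal.rep_eq add.assoc)
  finally show ?thesis by (simp add: less_eq_ennreal.rep_eq)
qed

lemma V0_le_under:
  assumes w: "w \<in> stationary M"
  shows "V0 x + ennreal (beta M) \<le> cost_under M w x + (\<integral>\<^sup>+y. V0 y \<partial>kernel_under M w x)"
proof -
  interpret prob_space "w x" by (rule w_prob[OF w])
  have m: "(\<lambda>u. \<integral>\<^sup>+y. V0 y \<partial>total_trans M (x, u)) \<in> borel_measurable (w x)"
    by (rule measurable_compose[OF measurable_pair_u[OF w]])
      (rule nn_integral_measurable_subprob_algebra2[OF _ measurable_prob_algebraD[OF measurable_total_trans]], measurable)
  have m2: "(\<lambda>u. total_cost M (x, u)) \<in> borel_measurable (w x)"
    by (rule measurable_compose[OF measurable_pair_u[OF w] measurable_total_cost])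
  have "V0 x + ennreal (beta M) = (\<integral>\<^sup>+u. V0 x + ennreal (beta M) \<partial>w x)" by (simp add: emeasure_space_1)
  also have "\<dots> \<le> (\<integral>\<^sup>+u. total_cost M (x, u) + (\<integral>\<^sup>+y. V0 y \<partial>total_trans M (x, u)) \<partial>w x)"
    by (rule nn_integral_mono_AE)
      (use AE_graph[OF w, of x] in eventually_elim, simp add: total_trans_def total_cost_def V0_le)
  also have "\<dots> = cost_under M w x + (\<integral>\<^sup>+y. V0 y \<partial>kernel_under M w x)"
    by (simp add: nn_integral_add[OF m2 m] cost_under_def nn_integral_kernel_under[OF w measurable_V0])
  finally show ?thesis .
qed

lemma split_cost_under_eq:
  assumes w: "w \<in> stationary M"
  shows "split_cost_under M B \<delta> w s = (if snd s then 0 else 1 / hold B \<delta> (fst s) * cost_under M w (fst s))"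
proof -
  obtain x i where s: "s = (x, i)" by (cases s)
  interpret prob_space "w x" by (rule w_prob[OF w])
  have m: "(\<lambda>u. total_cost M (x, u)) \<in> borel_measurable (w x)"
    by (rule measurable_compose[OF measurable_pair_u[OF w] measurable_total_cost])
  have "(\<integral>\<^sup>+u. split_cost M B \<delta> (x, False) u \<partial>w x) = (\<integral>\<^sup>+u. 1 / hold B \<delta> x * total_cost M (x, u) \<partial>w x)"
  proof (rule nn_integral_cong_AE)
    show "AE u in w x. split_cost M B \<delta> (x, False) u = 1 / hold B \<delta> x * total_cost M (x, u)"
      using AE_graph[OF w, of x]
      by eventually_elim (cases "x \<in> B", simp_all add: split_cost_def total_cost_def hold_def ennreal_divide_times[of 1 "ennreal (1 - \<delta>)"])
  qed
  moreover have "split_cost M B \<delta> (x, True) = (\<lambda>_. 0)" by (simp add: split_cost_def fun_eq_iff)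
  ultimately show ?thesis
    by (cases i) (simp_all add: s split_cost_under_def nn_integral_cmult m cost_under_def)
qed

lemma cost_under_gap:
  assumes gap: "\<forall>z\<in>graphK M. fst z \<notin> B \<longrightarrow> ennreal c \<le> cost M z" and w: "w \<in> stationary M" and x: "x \<notin> B"
  shows "ennreal c \<le> cost_under M w x"
proof -
  interpret prob_space "w x" by (rule w_prob[OF w])
  have "ennreal c = (\<integral>\<^sup>+u. ennreal c \<partial>w x)" by (simp add: emeasure_space_1)
  also have "\<dots> \<le> cost_under M w x" unfolding cost_under_def
    by (rule nn_integral_mono_AE) (use AE_graph[OF w, of x] in eventually_elim, use gap x in \<open>auto simp: total_cost_def\<close>)
  finally show ?thesis .
qed

section \<open>Gain and deficit of one regeneration cycle\<close>

context
  fixes w :: "'x \<Rightarrow> 'u measure"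
  assumes w: "w \<in> stationary M"
begin

interpretation minorized_chain "taboo_kernel M B \<nu> \<delta> w" "regen B \<delta>" \<nu>
  by (rule minorized_chain[OF w])

lemma measurable_cost_under'[measurable]: "cost_under M w \<in> borel_measurable borel"
  by (rule measurable_cost_under[OF w])

text \<open>\<open>gain\<close> and \<open>deficit\<close> carry the positive and negative parts of
  the cycle cost after clearing the weights \<open>hold\<close>; the rate \<open>beta M\<close> is
  then charged in proportion to \<open>hold\<close>.\<close>

definition gain :: "'x \<Rightarrow> ennreal" where
  "gain = potential (\<lambda>y. cost_under M w y - ennreal (beta M) * hold B \<delta> y)"

definition deficit :: "'x \<Rightarrow> ennreal" where
  "deficit = potential (\<lambda>y. ennreal (beta M) * hold B \<delta> y - cost_under M w y)"

lemma split_value_eq: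
  "split_value M B \<nu> \<delta> w x = enn2ereal (1 / hold B \<delta> x * gain x) - enn2ereal (1 / hold B \<delta> x * deficit x)"
proof -
  let ?c = "split_cost_under M B \<delta> w"
  have c[measurable]: "?c \<in> borel_measurable split_algebra"
    unfolding split_cost_under_eq[OF w, abs_def] by measurable
  have 1: "hold B \<delta> y * (?c (y, False) - ennreal (beta M)) = cost_under M w y - ennreal (beta M) * hold B \<delta> y" for y
    using hold_fin[of y]
    by (simp add: split_cost_under_eq[OF w] ennreal_right_diff_distrib hold_cancel less_top[symmetric] mult.commute[of "ennreal (beta M)"])
  have 2: "hold B \<delta> y * (ennreal (beta M) - ?c (y, False)) = ennreal (beta M) * hold B \<delta> y - cost_under M w y" for y
    using hold_fin[of y]
    by (simp add: split_cost_under_eq[OF w] ennreal_right_diff_distrib hold_cancel less_top[symmetric] mult.commute[of "ennreal (beta M)"])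
  show ?thesis unfolding split_value_def gain_def deficit_def
    by (subst (1 2) expected_cycle_sum_eq[OF w]) (simp_all only: 1 2, measurable)
qed

lemma potential_B_le: "ennreal \<delta> * potential (indicator B) x \<le> 1"
  using potential_s_le[of x] potential_cmult[of "indicator B" "ennreal \<delta>" x] by (simp add: regen_def[abs_def])

lemma potential_B_fin: "potential (indicator B) x < \<top>"
proof (rule ccontr)
  assume "\<not> ?thesis"
  then have "potential (indicator B) x = \<top>" by (simp add: less_top[symmetric])
  then show False using potential_B_le[of x] delta_pos by (simp add: ennreal_mult_top top_unique)
qed

lemma cost_under_ge_beta: "x \<notin> B \<Longrightarrow> ennreal (beta M) \<le> cost_under M w x"
proof -
  obtain \<epsilon> where e: "0 < \<epsilon>" "\<forall>z\<in>graphK M. fst z \<notin> B \<longrightarrow> ennreal (beta M + \<epsilon>) \<le> cost M z"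
    using cost_gap by blast
  assume "x \<notin> B"
  have "ennreal (beta M) \<le> ennreal (beta M + \<epsilon>)" using e by (intro ennreal_leI) simp
  also have "\<dots> \<le> cost_under M w x" by (rule cost_under_gap[OF e(2) w \<open>x \<notin> B\<close>])
  finally show ?thesis .
qed

text \<open>Off \<open>B\<close> the cost is at least \<open>beta M\<close>, so the negative part
  lives on \<open>B\<close>, where a cycle spends expected time at most
  \<open>1 / \<delta>\<close>.\<close>

lemma deficit_fin: "deficit x < \<top>"
proof -
  have "deficit x \<le> potential (\<lambda>y. ennreal (beta M) * indicator B y) x"
    unfolding deficit_def
  proof (rule potential_mono)
    show "ennreal (beta M) * hold B \<delta> y - cost_under M w y \<le> ennreal (beta M) * indicator B y" for y
    proof (cases "y \<in> B")
      case True
      have "ennreal (beta M) * hold B \<delta> y \<le> ennreal (beta M) * 1"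
        using delta_pos by (intro mult_left_mono) (auto simp: hold_def)
      then show ?thesis using True by (auto intro: order_trans[OF diff_le_self_ennreal])
    next
      case False
      then show ?thesis using cost_under_ge_beta[OF False] by (simp add: hold_def diff_eq_0_ennreal beta_nonneg)
    qed
  qed
  also have "\<dots> = ennreal (beta M) * potential (indicator B) x" by (rule potential_cmult) simp
  also have "\<dots> < \<top>" using potential_B_fin by (simp add: ennreal_mult_less_top)
  finally show ?thesis .
qed

text \<open>Each visit off \<open>B\<close> adds at least the cost gap to the gain, and visits to
  \<open>B\<close> are always finite in mean.\<close>

lemma potential_one_fin_of_gain:
  assumes "gain x < \<top>"
  shows "potential (\<lambda>_. 1) x < \<top>"
proof -
  obtain \<epsilon> where e: "0 < \<epsilon>" "\<forall>z\<in>graphK M. fst z \<notin> B \<longrightarrow> ennreal (beta M + \<epsilon>) \<le> cost M z"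
    using cost_gap by blast
  have "ennreal \<epsilon> * potential (indicator (- B)) x = potential (\<lambda>y. ennreal \<epsilon> * indicator (- B) y) x"
    by (rule potential_cmult[symmetric]) simp
  also have "\<dots> \<le> gain x"
    unfolding gain_def
  proof (rule potential_mono)
    show "ennreal \<epsilon> * indicator (- B) y \<le> cost_under M w y - ennreal (beta M) * hold B \<delta> y" for y
    proof (cases "y \<in> B")
      case False
      have "ennreal \<epsilon> = ennreal (beta M + \<epsilon>) - ennreal (beta M)"
        using e beta_nonneg by (simp add: ennreal_minus)
      also have "\<dots> \<le> cost_under M w y - ennreal (beta M)"
        by (intro ennreal_minus_mono cost_under_gap[OF e(2) w False] order_refl)
      finally show ?thesis using False by (simp add: hold_def)
    qed simp
  qed
  finally have "ennreal \<epsilon> * potential (indicator (- B)) x < \<top>" using assms by (rule le_less_trans)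
  then have "potential (indicator (- B)) x < \<top>" using e(1) by (auto simp: ennreal_mult_less_top)
  moreover have "potential (\<lambda>_. 1) x = potential (indicator B) x + potential (indicator (- B)) x"
  proof -
    have "(\<lambda>_. 1) = (\<lambda>y. indicator B y + indicator (- B) y :: ennreal)" by (auto simp: indicator_def)
    then show ?thesis by (simp add: potential_add)
  qed
  ultimately show ?thesis using potential_B_fin by simp
qed

text \<open>The subtraction-free form of \<open>gain - deficit = U c - \<beta> U hold\<close>, valid
  for infinite values as well.\<close>

lemma gain_deficit:
  "potential (cost_under M w) x + deficit x = ennreal (beta M) * potential (hold B \<delta>) x + gain x"
proof -
  have *: "a + (b - a) = b + (a - b)" for a b :: ennreal
    by (cases a; cases b) (auto simp: ennreal_minus_if ennreal_plus[symmetric] simp del: ennreal_plus)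
  have "potential (cost_under M w) x + deficit x =
      potential (\<lambda>y. cost_under M w y + (ennreal (beta M) * hold B \<delta> y - cost_under M w y)) x"
    unfolding deficit_def by (subst potential_add) auto
  also have "\<dots> = potential (\<lambda>y. ennreal (beta M) * hold B \<delta> y + (cost_under M w y - ennreal (beta M) * hold B \<delta> y)) x"
    by (simp only: *)
  also have "\<dots> = ennreal (beta M) * potential (hold B \<delta>) x + gain x"
    unfolding gain_def by (subst potential_add) (auto simp: potential_cmult)
  finally show ?thesis .
qed

text \<open>The unit comes from \<open>U s = 1\<close>: it is the discrepancy that later becomes one
  \<open>beta M\<close>.\<close>

lemma potential_one_eq:
  assumes "potential (\<lambda>_. 1) x < \<top>"
  shows "potential (\<lambda>_. 1) x = potential (hold B \<delta>) x + 1"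
proof -
  have "(\<lambda>_. 1) = (\<lambda>y. hold B \<delta> y + regen B \<delta> y)" by (simp add: hold_add_regen)
  then have "potential (\<lambda>_. 1) x = potential (hold B \<delta>) x + potential (regen B \<delta>) x"
    by (simp add: potential_add)
  then show ?thesis using potential_s[of x] assms by simp
qed

end

end

section \<open>The integral of the value function under the regeneration measure\<close>

context split_mdp_value
begin

definition hold_real :: "'x \<Rightarrow> real" where
  "hold_real x = (if x \<in> B then 1 - \<delta> else 1)"

lemma hold_real: "hold B \<delta> x = ennreal (hold_real x)" "0 < hold_real x"
  using delta_less_1 by (auto simp: hold_def hold_real_def)

lemma hold_mult_split_value:
  assumes w: "w \<in> stationary M"
  shows "ereal (hold_real x) * split_value M B \<nu> \<delta> w x = enn2ereal (gain w x) - enn2ereal (deficit w x)"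
proof -
  have "1 / hold B \<delta> x = ennreal (1 / hold_real x)"
    using divide_ennreal[of 1 "hold_real x"] hold_real(2)[of x] by (simp add: hold_real(1))
  moreover obtain d where "deficit w x = ennreal d" "0 \<le> d"
    using deficit_fin[OF w, of x] by (cases "deficit w x") auto
  ultimately show ?thesis
    unfolding split_value_eq[OF w] using hold_real(2)[of x]
    by (cases "gain w x") (auto simp: ennreal_mult[symmetric] ennreal_mult_top field_simps)
qed

text \<open>The factor \<open>1 - \<delta>\<close> of \<open>Vstar\<close> on \<open>B\<close> is
  \<open>hold\<close> at the starting point and cancels the weight \<open>1 / hold\<close> of a
  cycle sum, so \<open>V\<close> is compared directly with gain minus deficit.\<close>

lemma V_eq_star: "ereal (V x) = ereal (hold_real x) * split_value_star M B \<nu> \<delta> x"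
  using V_eq[of x] by (simp add: Vstar_def hold_real_def one_ereal_def[symmetric])

lemma V_le_gain:
  assumes w: "w \<in> stationary M"
  shows "ereal (V x) \<le> enn2ereal (gain w x) - enn2ereal (deficit w x)"
  unfolding V_eq_star hold_mult_split_value[OF w, symmetric] split_value_star_def
  using hold_real(2)[of x] by (intro ereal_mult_left_mono INF_lower w) auto

lemma V_approx:
  assumes "0 < e"
  obtains w where "w \<in> stationary M" "enn2ereal (gain w x) - enn2ereal (deficit w x) < ereal (V x + e)"
proof -
  have h: "0 < hold_real x" by (rule hold_real)
  have "split_value_star M B \<nu> \<delta> x = ereal (V x / hold_real x)"
    using V_eq_star[of x] h by (cases "split_value_star M B \<nu> \<delta> x") (auto simp: field_simps)
  also have "\<dots> < ereal (V x / hold_real x + e / hold_real x)" using h assms by simp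
  finally obtain w where w: "w \<in> stationary M"
    "split_value M B \<nu> \<delta> w x < ereal (V x / hold_real x + e / hold_real x)"
    unfolding split_value_star_def by (auto simp: INF_less_iff)
  then have "ereal (hold_real x) * split_value M B \<nu> \<delta> w x < ereal (V x + e)"
    using h by (cases "split_value M B \<nu> \<delta> w x") (auto simp: field_simps)
  then show thesis using that w(1) by (simp add: hold_mult_split_value)
qed

lemma V0_le_taboo:
  assumes w: "w \<in> stationary M"
  shows "V0 y + ennreal (beta M) \<le> (\<integral>\<^sup>+z. V0 z \<partial>taboo_kernel M B \<nu> \<delta> w y) + (cost_under M w y + regen B \<delta> y * (\<integral>\<^sup>+z. V0 z \<partial>\<nu>))"
  using V0_le_under[OF w, of y] nn_integral_kernel_split[OF w measurable_V0, of y] by (simp add: ac_simps)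

text \<open>For an \<open>e\<close>-optimal \<open>w\<close> at some fixed \<open>x\<close>, the
  optimality inequality summed over a cycle gives
  \<open>V0 + \<beta> U 1 \<le> U c + \<nu>(V0)\<close>. Inserting
  \<open>U c - \<beta> U hold < V + e\<close> and \<open>U 1 = U hold + 1\<close> leaves
  \<open>\<beta> + K \<le> \<nu>(V0) + e\<close>.\<close>

lemma nu_V0_ge:
  assumes fin: "(\<integral>\<^sup>+y. V0 y \<partial>\<nu>) < \<top>"
  shows "ennreal (beta M + K) \<le> (\<integral>\<^sup>+y. V0 y \<partial>\<nu>)"
proof -
  obtain n where n: "(\<integral>\<^sup>+y. V0 y \<partial>\<nu>) = ennreal n" "0 \<le> n"
    using fin by (cases "\<integral>\<^sup>+y. V0 y \<partial>\<nu>") auto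
  fix x :: 'x
  have "beta M + K \<le> n + e" if e: "0 < e" for e
  proof -
    obtain w where w: "w \<in> stationary M" and lt: "enn2ereal (gain w x) - enn2ereal (deficit w x) < ereal (V x + e)"
      using V_approx[OF e] by blast
    interpret minorized_chain "taboo_kernel M B \<nu> \<delta> w" "regen B \<delta>" \<nu>
      by (rule minorized_chain[OF w])
    obtain d where d: "deficit w x = ennreal d" "0 \<le> d"
      using deficit_fin[OF w, of x] by (cases "deficit w x") auto
    obtain g where g: "gain w x = ennreal g" "0 \<le> g"
      using lt by (cases "gain w x") (auto simp: d)
    have one: "potential (\<lambda>_. 1) x < \<top>" by (rule potential_one_fin_of_gain[OF w]) (simp add: g)
    have one_eq: "potential (\<lambda>_. 1) x = potential (hold B \<delta>) x + 1" by (rule potential_one_eq[OF w one])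
    obtain p where p: "potential (hold B \<delta>) x = ennreal p" "0 \<le> p"
      using one unfolding one_eq by (cases "potential (hold B \<delta>) x") auto
    have gd: "potential (cost_under M w) x + deficit w x = ennreal (beta M) * potential (hold B \<delta>) x + gain w x"
      by (rule gain_deficit[OF w])
    have "ennreal (beta M) * ennreal p + ennreal g = ennreal (beta M * p + g)"
      using beta_nonneg p g by (simp add: ennreal_mult[symmetric] ennreal_plus[symmetric] del: ennreal_plus)
    then obtain c where c: "potential (cost_under M w) x = ennreal c" "0 \<le> c" "c + d = beta M * p + g"
      using gd beta_nonneg p(2) g(2) d(2) unfolding p d g
      by (cases "potential (cost_under M w) x") (auto simp: ennreal_plus[symmetric] simp del: ennreal_plus)
    have "V0 x + ennreal (beta M) * potential (\<lambda>_. 1) x \<le> potential (cost_under M w) x + ennreal n"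
    proof (rule value_le_potential[where K="ennreal K"])
      show "V0 y + ennreal (beta M) \<le> taboo V0 y + (cost_under M w y + regen B \<delta> y * ennreal n)" for y
        using V0_le_taboo[OF w, of y] by (simp add: taboo_def n)
      \<comment> \<open>The same \<open>w\<close> is a competitor in the infimum at every state, so
        its gain bounds \<open>V\<close> everywhere and controls the remainder.\<close>
      show "V0 y \<le> potential (cost_under M w) y + ennreal K" for y
      proof -
        have "ereal (V y) \<le> enn2ereal (gain w y)"
          using V_le_gain[OF w, of y] by (rule order_trans) (simp add: ereal_diff_le_self)
        then have "ereal (V y) + ereal K \<le> enn2ereal (gain w y) + ereal K" by (rule add_right_mono)
        then have "enn2ereal (V0 y) \<le> enn2ereal (gain w y + ennreal K)"
          using K(1) K(2)[of y] by (simp add: V0_def plus_ennreal.rep_eq)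
        then have "V0 y \<le> gain w y + ennreal K" by (simp add: less_eq_ennreal.rep_eq)
        also have "gain w y \<le> potential (cost_under M w) y"
          unfolding gain_def[OF w] by (intro potential_mono diff_le_self_ennreal)
        finally show ?thesis by (simp add: add_right_mono)
      qed
    qed (use w one c in \<open>auto intro: measurable_cost_under\<close>)
    then have "ennreal (V x + K + beta M * (p + 1)) \<le> ennreal (c + n)"
      unfolding one_eq using K(2)[of x] c(1,2) n p beta_nonneg
      by (simp add: V0_def ennreal_mult[symmetric] ennreal_plus[symmetric] ennreal_1[symmetric] del: ennreal_plus ennreal_1)
    then have "V x + K + beta M * (p + 1) \<le> c + n" using c(2) n(2) by (simp add: ennreal_plus[symmetric] ennreal_le_iff del: ennreal_plus)
    moreover have "g - d < V x + e" using lt by (simp add: g d)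
    ultimately show ?thesis using c(3) by (simp add: algebra_simps)
  qed
  then have "beta M + K \<le> n" by (rule field_le_epsilon)
  then show ?thesis by (simp add: n ennreal_leI)
qed

text \<open>The strategy attains the minimum in the optimality equation, stated for the shifted
  \<open>V0\<close> to stay in \<open>ennreal\<close>.\<close>

definition conserving :: "('x \<Rightarrow> 'u measure) \<Rightarrow> bool" where
  "conserving w \<longleftrightarrow> w \<in> stationary M \<and>
     (\<forall>y. cost_under M w y + (\<integral>\<^sup>+z. V0 z \<partial>kernel_under M w y) = V0 y + ennreal (beta M))"

context
  fixes w :: "'x \<Rightarrow> 'u measure"
  assumes cons: "conserving w"
begin

lemma conserving_stationary: "w \<in> stationary M"
  using cons by (simp add: conserving_def)

interpretation minorized_chain "taboo_kernel M B \<nu> \<delta> w" "regen B \<delta>" \<nu>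
  by (rule minorized_chain[OF conserving_stationary])

lemma conserving_taboo:
  "taboo V0 y + (cost_under M w y + regen B \<delta> y * (\<integral>\<^sup>+z. V0 z \<partial>\<nu>)) = V0 y + ennreal (beta M)"
proof -
  have "cost_under M w y + (\<integral>\<^sup>+z. V0 z \<partial>kernel_under M w y) = V0 y + ennreal (beta M)"
    using cons by (simp add: conserving_def)
  then show ?thesis
    unfolding nn_integral_kernel_split[OF conserving_stationary measurable_V0] taboo_def by (simp only: ac_simps)
qed

text \<open>\<open>V0\<close> is a Lyapunov function for \<open>T\<close>: off \<open>B\<close> it
  drops by the cost gap on average, and on \<open>B\<close> it rises by at most
  \<open>beta M\<close>.\<close>

lemma potential_one_bound:
  obtains \<epsilon> k :: real where "0 < \<epsilon>" "\<And>x. ennreal \<epsilon> * potential (\<lambda>_. 1) x \<le> V0 x + ennreal k"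
proof -
  obtain \<epsilon> where e: "0 < \<epsilon>" "\<forall>z\<in>graphK M. fst z \<notin> B \<longrightarrow> ennreal (beta M + \<epsilon>) \<le> cost M z"
    using cost_gap by blast
  \<comment> \<open>Chosen so that \<open>k\<close> times the regeneration probability on
    \<open>B\<close> pays for the rise \<open>beta M\<close> together with
    \<open>\<epsilon>\<close>.\<close>
  define k where "k = (beta M + \<epsilon>) / \<delta>"
  have kd: "ennreal k * ennreal \<delta> = ennreal (beta M + \<epsilon>)"
    using e(1) delta_pos beta_nonneg by (simp add: k_def ennreal_mult[symmetric])
  have split: "ennreal (beta M + \<epsilon>) = ennreal (beta M) + ennreal \<epsilon>"
    using e(1) beta_nonneg by simp
  have "taboo V0 y + ennreal \<epsilon> \<le> V0 y + ennreal k * regen B \<delta> y" for y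
  proof (cases "y \<in> B")
    case True
    have "taboo V0 y \<le> V0 y + ennreal (beta M)"
      unfolding conserving_taboo[of y, symmetric] by (rule add_increasing2) auto
    then have "taboo V0 y + ennreal \<epsilon> \<le> V0 y + ennreal (beta M) + ennreal \<epsilon>" by (rule add_right_mono)
    then show ?thesis using True by (simp add: regen_def kd split add.assoc)
  next
    case False
    have "ennreal (beta M) + (taboo V0 y + ennreal \<epsilon>) = taboo V0 y + ennreal (beta M + \<epsilon>)"
      unfolding split by (rule add.left_commute)
    also have "\<dots> \<le> taboo V0 y + (cost_under M w y + regen B \<delta> y * (\<integral>\<^sup>+z. V0 z \<partial>\<nu>))"
      by (intro add_left_mono add_increasing2 cost_under_gap[OF e(2) conserving_stationary False]) auto
    also have "\<dots> = ennreal (beta M) + V0 y" by (simp add: conserving_taboo add.commute)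
    finally show ?thesis using False by (simp add: ennreal_add_left_cancel_le regen_def)
  qed
  from Lyapunov_potential_bound[OF measurable_V0 this] show thesis by (rule that[OF e(1)])
qed

lemma potential_one_fin: "potential (\<lambda>_. 1) x < \<top>"
proof -
  obtain \<epsilon> k :: real where e: "0 < \<epsilon>" "\<And>x. ennreal \<epsilon> * potential (\<lambda>_. 1) x \<le> V0 x + ennreal k"
    using potential_one_bound by blast
  have "V0 x + ennreal k < \<top>" by (simp add: V0_def)
  with e(2)[of x] have "ennreal \<epsilon> * potential (\<lambda>_. 1) x < \<top>" by (rule le_less_trans)
  then show ?thesis using e(1) by (auto simp: ennreal_mult_less_top)
qed

text \<open>The balance of \<open>nu_V0_ge\<close> reversed: conservation sums to
  \<open>U c + \<nu>(V0) \<le> V0 + \<beta> U 1\<close>, while the strategy, as one competitor in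
  the infimum, gives \<open>V \<le> gain - deficit\<close>.\<close>

lemma nu_V0_le:
  assumes fin: "(\<integral>\<^sup>+y. V0 y \<partial>\<nu>) < \<top>"
  shows "(\<integral>\<^sup>+y. V0 y \<partial>\<nu>) \<le> ennreal (beta M + K)"
proof -
  note w = conserving_stationary
  obtain n where n: "(\<integral>\<^sup>+y. V0 y \<partial>\<nu>) = ennreal n" "0 \<le> n"
    using fin by (cases "\<integral>\<^sup>+y. V0 y \<partial>\<nu>") auto
  fix x :: 'x
  have one: "potential (\<lambda>_. 1) x < \<top>" by (rule potential_one_fin)
  have one_eq: "potential (\<lambda>_. 1) x = potential (hold B \<delta>) x + 1" by (rule potential_one_eq[OF w one])
  obtain p where p: "potential (hold B \<delta>) x = ennreal p" "0 \<le> p"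
    using one unfolding one_eq by (cases "potential (hold B \<delta>) x") auto
  obtain d where d: "deficit w x = ennreal d" "0 \<le> d"
    using deficit_fin[OF w, of x] by (cases "deficit w x") auto
  have le: "potential (cost_under M w) x + ennreal n \<le> V0 x + ennreal (beta M) * potential (\<lambda>_. 1) x"
    using conserving_taboo one by (intro potential_le_value) (auto simp: n measurable_cost_under[OF w])
  also have "\<dots> = ennreal (V x + K + beta M * (p + 1))"
    unfolding one_eq using K(2)[of x] p beta_nonneg
    by (simp add: V0_def ennreal_mult[symmetric] ennreal_plus[symmetric] ennreal_1[symmetric] del: ennreal_plus ennreal_1)
  finally have le': "potential (cost_under M w) x + ennreal n \<le> ennreal (V x + K + beta M * (p + 1))" .
  then obtain c where c: "potential (cost_under M w) x = ennreal c" "0 \<le> c"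
    by (cases "potential (cost_under M w) x") (auto simp: top_unique)
  have "0 \<le> beta M * (p + 1)" using beta_nonneg p(2) by simp
  then have le2: "c + n \<le> V x + K + beta M * (p + 1)"
    using le' n(2) c K(2)[of x] by (simp add: ennreal_plus[symmetric] ennreal_le_iff del: ennreal_plus)
  have "potential (cost_under M w) x + deficit w x = ennreal (beta M) * potential (hold B \<delta>) x + gain w x"
    by (rule gain_deficit[OF w])
  then have "ennreal (c + d) = ennreal (beta M * p) + gain w x"
    using c d p beta_nonneg by (simp add: ennreal_mult)
  then obtain g where g: "gain w x = ennreal g" "0 \<le> g" "c + d = beta M * p + g"
    using c d p beta_nonneg
    by (cases "gain w x") (auto simp: ennreal_plus[symmetric] simp del: ennreal_plus)
  have "V x \<le> g - d" using V_le_gain[OF w, of x] by (simp add: g d)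
  then have "n \<le> beta M + K" using le2 g(3) by (simp add: algebra_simps)
  then show ?thesis by (simp add: n ennreal_leI)
qed

text \<open>Integrating the Lyapunov bound under \<open>\<pi>\<close> makes the mean cycle length
  finite; this is where integrability of \<open>V\<close> enters.\<close>

lemma invariant_chain:
  assumes prob: "prob_space \<pi>" and sets: "sets \<pi> = sets borel"
    and inv: "\<And>A. A \<in> sets borel \<Longrightarrow> emeasure \<pi> A = (\<integral>\<^sup>+x. emeasure (kernel_under M w x) A \<partial>\<pi>)"
    and V_fin: "(\<integral>\<^sup>+x. V0 x \<partial>\<pi>) < \<infinity>"
  shows "invariant_chain (taboo_kernel M B \<nu> \<delta> w) (regen B \<delta>) \<nu> \<pi>"
proof
  note w = conserving_stationary
  interpret pi: prob_space \<pi> by (rule prob)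
  note [measurable_cong] = sets
  have space: "space \<pi> = UNIV" using sets_eq_imp_space_eq[OF sets] by simp
  show "sets \<pi> = sets borel" by (rule sets)
  show "emeasure \<pi> UNIV = 1" using pi.emeasure_space_1 by (simp add: space)
  have k: "kernel_under M w \<in> \<pi> \<rightarrow>\<^sub>M subprob_algebra borel"
    using measurable_prob_algebraD[OF measurable_kernel_under[OF w]] by (simp add: measurable_cong_sets[OF sets refl])
  have "\<pi> = \<pi> \<bind> kernel_under M w"
  proof (rule measure_eqI)
    show "sets \<pi> = sets (\<pi> \<bind> kernel_under M w)"
      unfolding sets by (rule sets_bind[symmetric]) (auto simp: sets_kernel_under[OF w] space)
    show "emeasure \<pi> A = emeasure (\<pi> \<bind> kernel_under M w) A" if "A \<in> sets \<pi>" for A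
      using that inv[of A] by (subst emeasure_bind[OF _ k]) (auto simp: sets space)
  qed
  then have pi_int: "(\<integral>\<^sup>+x. f x \<partial>\<pi>) = (\<integral>\<^sup>+x. \<integral>\<^sup>+y. f y \<partial>kernel_under M w x \<partial>\<pi>)" if "f \<in> borel_measurable borel" for f
    using nn_integral_bind[OF that k] by simp
  show "(\<integral>\<^sup>+x. f x \<partial>\<pi>) = (\<integral>\<^sup>+x. taboo f x \<partial>\<pi>) + (\<integral>\<^sup>+x. regen B \<delta> x \<partial>\<pi>) * (\<integral>\<^sup>+x. f x \<partial>\<nu>)"
    if f[measurable]: "f \<in> borel_measurable borel" for f
    unfolding pi_int[OF f] nn_integral_kernel_split[OF w f] taboo_def[symmetric]
    by (simp add: nn_integral_add nn_integral_multc)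
  have "(\<integral>\<^sup>+x. regen B \<delta> x \<partial>\<nu>) = ennreal \<delta>"
    using nu_B by (simp add: regen_def nn_integral_cmult)
  then show "0 < (\<integral>\<^sup>+x. regen B \<delta> x \<partial>\<nu>)" using delta_pos by simp
  show "potential (\<lambda>_. 1) x < \<infinity>" for x using potential_one_fin by simp
  obtain \<epsilon> k :: real where e: "0 < \<epsilon>" "\<And>x. ennreal \<epsilon> * potential (\<lambda>_. 1) x \<le> V0 x + ennreal k"
    using potential_one_bound by blast
  have "ennreal \<epsilon> * (\<integral>\<^sup>+x. potential (\<lambda>_. 1) x \<partial>\<pi>) = (\<integral>\<^sup>+x. ennreal \<epsilon> * potential (\<lambda>_. 1) x \<partial>\<pi>)"
    by (rule nn_integral_cmult[symmetric]) simp
  also have "\<dots> \<le> (\<integral>\<^sup>+x. V0 x + ennreal k \<partial>\<pi>)" by (intro nn_integral_mono e)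
  also have "\<dots> = (\<integral>\<^sup>+x. V0 x \<partial>\<pi>) + ennreal k" by (simp add: nn_integral_add pi.emeasure_space_1)
  also have "\<dots> < \<top>" using V_fin by simp
  finally show "(\<integral>\<^sup>+x. potential (\<lambda>_. 1) x \<partial>\<pi>) < \<infinity>" using e(1) by (auto simp: ennreal_mult_less_top)
qed

end

end

section \<open>Lower semicontinuity of the Bellman operator\<close>

text \<open>Supplies the compact set of states over which inf-compactness of the cost is applied
  along a convergent sequence.\<close>

lemma compact_insert_limit_range:
  fixes x :: "nat \<Rightarrow> 'a::topological_space"
  assumes x: "x \<longlonglongrightarrow> l"
  shows "compact (insert l (range x))"
  unfolding compact_eq_Heine_Borel
proof (intro allI impI, elim conjE)
  fix C assume C: "\<forall>c\<in>C. open c" "insert l (range x) \<subseteq> \<Union> C"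
  obtain T where T: "T \<in> C" "l \<in> T" using C(2) by blast
  then obtain N where N: "\<And>n. N \<le> n \<Longrightarrow> x n \<in> T"
    using topological_tendstoD[OF x, of T] C(1) by (auto simp: eventually_sequentially)
  have "\<forall>n. \<exists>S. S \<in> C \<and> x n \<in> S" using C(2) by blast
  then obtain S where S: "\<And>n. S n \<in> C" "\<And>n. x n \<in> S n" by metis
  have "x n \<in> \<Union> (insert T (S ` {..<N}))" for n
    using N[of n] S(2)[of n] by (cases "n < N") auto
  then show "\<exists>C'\<subseteq>C. finite C' \<and> insert l (range x) \<subseteq> \<Union> C'"
    using T S(1) by (intro exI[of _ "insert T (S ` {..<N})"]) auto
qed

context split_mdp
begin

lemma cost_le_limit:
  assumes z: "\<And>n. z n \<in> graphK M" "l \<in> graphK M" "z \<longlonglongrightarrow> l"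
    and le: "eventually (\<lambda>n. cost M (z n) \<le> t) sequentially"
  shows "cost M l \<le> t"
proof (rule ccontr)
  assume nle: "\<not> cost M l \<le> t"
  have "openin (top_of_set (graphK M)) {z \<in> graphK M. t < cost M z}"
    using basic by (auto simp: basic_assumption_def lsc_on_def)
  then obtain T where T: "open T" "{z \<in> graphK M. t < cost M z} = graphK M \<inter> T"
    by (auto simp: openin_open)
  have "l \<in> {z \<in> graphK M. t < cost M z}" using z(2) nle by simp
  then have "l \<in> T" unfolding T(2) by simp
  then have "eventually (\<lambda>n. z n \<in> T) sequentially" using topological_tendstoD[OF z(3) T(1)] by simp
  with le have "eventually (\<lambda>n. False) sequentially"
  proof eventually_elim
    case (elim n)
    then have "z n \<in> {z \<in> graphK M. t < cost M z}" unfolding T(2) using z(1)[of n] by simp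
    then have "t < cost M (z n)" by simp
    then show ?case using elim(1) by (simp add: not_less[symmetric])
  qed
  then show False by simp
qed

text \<open>Strong continuity concerns bounded functions only, so \<open>f\<close> is truncated at
  \<open>N\<close>: the truncated integrals converge along the sequence, the cost is lower
  semicontinuous, and monotone convergence removes \<open>N\<close>.\<close>

lemma bellman_limit:
  assumes z: "\<And>n. z n \<in> graphK M" "l \<in> graphK M" "z \<longlonglongrightarrow> l"
    and f[measurable]: "f \<in> borel_measurable borel" and f0: "\<And>x. 0 \<le> f x"
    and le: "\<And>n. cost M (z n) + (\<integral>\<^sup>+y. ennreal (f y) \<partial>trans M (z n)) \<le> ennreal a" and a: "0 \<le> a"
  shows "cost M l + (\<integral>\<^sup>+y. ennreal (f y) \<partial>trans M l) \<le> ennreal a"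
proof -
  define g where "g N y = min (real N) (f y)" for N y
  have g[measurable]: "g N \<in> borel_measurable borel" for N unfolding g_def[abs_def] by measurable
  have g0: "0 \<le> g N y" for N y using f0 by (simp add: g_def)
  define I where "I N z = (\<integral>y. g N y \<partial>trans M z)" for N z
  have I: "(\<integral>\<^sup>+y. ennreal (g N y) \<partial>trans M z) = ennreal (I N z)" "0 \<le> I N z" if z: "z \<in> graphK M" for N z
  proof -
    have st: "sets (trans M z) = sets borel" and "prob_space (trans M z)"
      using trans_prob[OF z] by (auto simp: space_prob_algebra)
    then interpret prob_space "trans M z" by simp
    have "g N \<in> borel_measurable (trans M z)" by (simp add: measurable_cong_sets[OF st refl])
    then have "integrable (trans M z) (g N)"
      using f0 by (intro integrable_const_bound[of _ "real N"]) (auto simp: g_def)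
    then show "(\<integral>\<^sup>+y. ennreal (g N y) \<partial>trans M z) = ennreal (I N z)"
      unfolding I_def using g0 by (intro nn_integral_eq_integral) auto
    show "0 \<le> I N z" unfolding I_def by (rule Bochner_Integration.integral_nonneg) (rule g0)
  qed
  have bound: "cost M l + ennreal (I N l) \<le> ennreal a" for N
  proof -
    have "bounded (range (g N))" using f0 by (auto simp: bounded_iff g_def intro!: exI[of _ "real N"])
    then have "continuous_on (graphK M) (I N)"
      using basic g[of N] unfolding basic_assumption_def I_def[abs_def] by blast
    then have lim: "(\<lambda>n. I N (z n)) \<longlonglongrightarrow> I N l"
      by (rule continuous_on_tendsto_compose[OF _ z(3,2)]) (simp add: z(1))
    have le_n: "cost M (z n) + ennreal (I N (z n)) \<le> ennreal a" for n
    proof -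
      have "cost M (z n) + ennreal (I N (z n)) \<le> cost M (z n) + (\<integral>\<^sup>+y. ennreal (f y) \<partial>trans M (z n))"
        unfolding I(1)[OF z(1), symmetric]
        by (intro add_left_mono nn_integral_mono ennreal_leI) (simp add: g_def)
      then show ?thesis using le by (rule order_trans)
    qed
    have "cost M l + ennreal (I N l) \<le> ennreal a + ennreal e" if e: "0 < e" for e
    proof -
      \<comment> \<open>Once \<open>I N (z n)\<close> exceeds \<open>I N l - e\<close>, the bound on
        the sum leaves at most this much for the cost at \<open>z n\<close>.\<close>
      let ?t = "a - I N l + e"
      have ev: "eventually (\<lambda>n. I N l - e < I N (z n)) sequentially"
        using order_tendstoD(1)[OF lim, of "I N l - e"] e by simp
      have *: "cost M (z n) \<le> ennreal ?t \<and> 0 \<le> ?t" if "I N l - e < I N (z n)" for n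
      proof -
        have "ennreal (I N (z n)) \<le> ennreal a"
          using le_n[of n] by (rule order_trans[rotated]) (simp add: add_increasing)
        then have Ia: "I N (z n) \<le> a" using a by (simp add: ennreal_le_iff)
        obtain c where c: "cost M (z n) = ennreal c" "0 \<le> c"
          using le_n[of n] by (cases "cost M (z n)") (auto simp: top_unique)
        have "c + I N (z n) \<le> a"
          using le_n[of n] c(2) I(2)[OF z(1)] a unfolding c(1)
          by (simp add: ennreal_plus[symmetric] ennreal_le_iff del: ennreal_plus)
        then show ?thesis using that Ia unfolding c(1) by (auto intro: ennreal_leI)
      qed
      have t0: "0 \<le> ?t" using eventually_happens[OF ev] * by auto
      have "cost M l \<le> ennreal ?t"
        by (rule cost_le_limit[OF z]) (use ev * in \<open>auto elim: eventually_mono\<close>)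
      then have "cost M l + ennreal (I N l) \<le> ennreal ?t + ennreal (I N l)" by (rule add_right_mono)
      also have "\<dots> = ennreal a + ennreal e"
        using t0 I(2)[OF z(2)] a e by (simp add: ennreal_plus[symmetric] del: ennreal_plus)
      finally show ?thesis .
    qed
    then show ?thesis by (rule ennreal_le_epsilon)
  qed
  have st: "sets (trans M l) = sets borel" using trans_prob[OF z(2)] by (simp add: space_prob_algebra)
  have "(\<integral>\<^sup>+y. ennreal (f y) \<partial>trans M l) = (SUP N. \<integral>\<^sup>+y. ennreal (g N y) \<partial>trans M l)"
  proof -
    have "(SUP N. ennreal (g N y)) = ennreal (f y)" for y
    proof (rule antisym)
      show "(SUP N. ennreal (g N y)) \<le> ennreal (f y)" by (intro SUP_least ennreal_leI) (simp add: g_def)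
      obtain N where "f y \<le> real N" using real_arch_simple by blast
      then have "ennreal (f y) = ennreal (g N y)" by (simp add: g_def)
      then show "ennreal (f y) \<le> (SUP N. ennreal (g N y))" by (metis SUP_upper UNIV_I)
    qed
    moreover have "(\<integral>\<^sup>+y. (SUP N. ennreal (g N y)) \<partial>trans M l) = (SUP N. \<integral>\<^sup>+y. ennreal (g N y) \<partial>trans M l)"
      by (intro nn_integral_monotone_convergence_SUP)
        (auto simp: incseq_def le_fun_def g_def measurable_cong_sets[OF st refl] intro!: ennreal_leI)
    ultimately show ?thesis by simp
  qed
  then have "(\<lambda>N. cost M l + ennreal (I N l)) \<longlonglongrightarrow> cost M l + (\<integral>\<^sup>+y. ennreal (f y) \<partial>trans M l)"
    unfolding I(1)[OF z(2)]
  proof -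
    assume eq: "(\<integral>\<^sup>+y. ennreal (f y) \<partial>trans M l) = (SUP N. ennreal (I N l))"
    have "incseq (\<lambda>N. ennreal (I N l))"
      unfolding I(1)[OF z(2), symmetric]
      by (auto simp: incseq_def g_def intro!: nn_integral_mono ennreal_leI)
    then have "(\<lambda>N. ennreal (I N l)) \<longlonglongrightarrow> (SUP N. ennreal (I N l))" by (rule LIMSEQ_SUP)
    then show ?thesis unfolding eq by (intro tendsto_add tendsto_const)
  qed
  then show ?thesis using bound by (intro LIMSEQ_le_const2) auto
qed

text \<open>The sublevel sets of \<open>g\<close> are in fact closed. Since minima are attained,
  membership means that some action has a small Bellman value; along a convergent sequence of states
  such actions have a limit point, and \<open>bellman_limit\<close> applies to it. Strong continuity
  lets \<open>f\<close> be merely measurable.\<close>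

lemma measurable_bellman_minimum:
  assumes cpt: "\<And>C (k::real). compact C \<Longrightarrow> compact {z \<in> graphK M. fst z \<in> C \<and> cost M z \<le> ennreal k}"
    and f[measurable]: "f \<in> borel_measurable borel" and K: "0 \<le> K" "\<And>x. 0 \<le> f x + K"
    and min: "\<And>x. is_minimum_over (acts M x) (bellman_rhs M f x) (ereal (g x))"
  shows "g \<in> borel_measurable borel"
  unfolding borel_measurable_iff_le
proof
  fix a
  let ?F = "\<lambda>z. cost M z + (\<integral>\<^sup>+y. ennreal (f y + K) \<partial>trans M z)"
  let ?A = "a + K + beta M"
  have F: "bellman_rhs M f x u + ereal (K + beta M) = enn2ereal (?F (x, u))" if "u \<in> acts M x" for x u
    using that by (intro bellman_shift f K) (simp add: graphK_def)
  have g0: "0 \<le> g x + K + beta M" and le_iff: "g x \<le> a \<longleftrightarrow> (\<exists>u\<in>acts M x. ?F (x, u) \<le> ennreal ?A)"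
    if A: "0 \<le> ?A \<or> a = g x" for x
  proof -
    have all: "ereal (g x) + ereal (K + beta M) \<le> enn2ereal (?F (x, u))" if "u \<in> acts M x" for u
      unfolding F[OF that, symmetric] using min[of x] that by (intro add_right_mono) (simp add: is_minimum_over_def)
    obtain u where u: "u \<in> acts M x" "enn2ereal (?F (x, u)) = ereal (g x + (K + beta M))"
      using min[of x] F by (fastforce simp: is_minimum_over_def)
    show g0: "0 \<le> g x + K + beta M"
      using enn2ereal_nonneg[of "?F (x, u)"] unfolding u(2) by (simp add: add.assoc)
    then have A0: "0 \<le> ?A" using A by auto
    show "g x \<le> a \<longleftrightarrow> (\<exists>u\<in>acts M x. ?F (x, u) \<le> ennreal ?A)"
    proof
      assume "g x \<le> a"
      then have "enn2ereal (?F (x, u)) \<le> enn2ereal (ennreal ?A)" unfolding u(2) using A0 by simp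
      then show "\<exists>u\<in>acts M x. ?F (x, u) \<le> ennreal ?A" using u(1) by (auto simp: less_eq_ennreal.rep_eq)
    next
      assume "\<exists>u\<in>acts M x. ?F (x, u) \<le> ennreal ?A"
      then obtain u where "u \<in> acts M x" "?F (x, u) \<le> ennreal ?A" by blast
      then have "ereal (g x) + ereal (K + beta M) \<le> enn2ereal (ennreal ?A)"
        using all[of u] by (auto simp: less_eq_ennreal.rep_eq intro: order_trans)
      then show "g x \<le> a" using A0 by simp
    qed
  qed
  show "{x \<in> space borel. g x \<le> a} \<in> sets borel"
  \<comment> \<open>A negative level would be truncated to 0 by \<open>ennreal\<close>; there the
    sublevel set is empty because \<open>?F\<close> is nonnegative.\<close>
  proof (cases "0 \<le> ?A")
    case False
    have "\<not> g x \<le> a" for x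
    proof
      assume "g x \<le> a"
      moreover obtain u where "u \<in> acts M x" "enn2ereal (?F (x, u)) = ereal (g x + (K + beta M))"
        using min[of x] F by (fastforce simp: is_minimum_over_def)
      then have "0 \<le> g x + (K + beta M)" using enn2ereal_nonneg[of "?F (x, u)"] by simp
      ultimately show False using False by simp
    qed
    then show ?thesis by simp
  next
    case True
    have "closed {x. g x \<le> a}"
      unfolding closed_sequential_limits
    proof (intro allI impI, elim conjE)
      fix x l assume x: "\<forall>n. x n \<in> {x. g x \<le> a}" and xl: "x \<longlonglongrightarrow> l"
      have "\<forall>n. \<exists>u. u \<in> acts M (x n) \<and> ?F (x n, u) \<le> ennreal ?A"
        using x le_iff True by blast
      then obtain u where u: "\<And>n. u n \<in> acts M (x n)" "\<And>n. ?F (x n, u n) \<le> ennreal ?A" by metis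
      let ?C = "{z \<in> graphK M. fst z \<in> insert l (range x) \<and> cost M z \<le> ennreal ?A}"
      have "compact ?C" using compact_insert_limit_range[OF xl] by (rule cpt)
      moreover have "(x n, u n) \<in> ?C" for n
        using u(1)[of n] order_trans[OF _ u(2)[of n], of "cost M (x n, u n)"] by (auto simp: graphK_def)
      ultimately obtain z h where z: "z \<in> ?C" "strict_mono h" "((\<lambda>n. (x n, u n)) \<circ> h) \<longlonglongrightarrow> z"
        using compact_def[of ?C] by meson
      have zh: "(\<lambda>n. (x (h n), u (h n))) \<longlonglongrightarrow> z" using z(3) by (simp add: comp_def)
      have "(\<lambda>n. x (h n)) \<longlonglongrightarrow> fst z" using tendsto_fst[OF zh] by simp
      moreover have "(\<lambda>n. x (h n)) \<longlonglongrightarrow> l" using LIMSEQ_subseq_LIMSEQ[OF xl z(2)] by (simp add: comp_def)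
      ultimately have "fst z = l" by (rule LIMSEQ_unique)
      moreover have "?F z \<le> ennreal ?A"
        by (rule bellman_limit[OF _ _ zh]) (use u z True K in \<open>auto simp: graphK_def\<close>)
      ultimately have "\<exists>u\<in>acts M l. ?F (l, u) \<le> ennreal ?A"
        using z(1) by (cases z) (auto simp: graphK_def)
      then show "l \<in> {x. g x \<le> a}" using le_iff[of l] True by simp
    qed
    then have "{x. g x \<le> a} \<in> sets borel" by (rule borel_closed)
    then show ?thesis unfolding space_borel by (simp only: UNIV_I simp_thms)
  qed
qed

text \<open>The second alternative of \<open>A1\<close> states this directly; in the first, a
  compact sublevel set is cut by the closed cylinder over \<open>C\<close>.\<close>

lemma compact_sublevel:
  assumes "A1 M iX iU" "compact C"
  shows "compact {z \<in> graphK M. fst z \<in> C \<and> cost M z \<le> ennreal k}"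
proof -
  have "compact {z \<in> graphK M. fst z \<in> C \<and> cost M z \<le> ennreal k}"
    if "compact {z \<in> graphK M. cost M z \<le> ennreal k}"
  proof -
    have "closed (C \<times> (UNIV :: 'u set))" using compact_imp_closed[OF assms(2)] by (intro closed_Times) auto
    from compact_Int_closed[OF that this] show ?thesis
      by (rule back_subst[of compact]) (auto simp: mem_Times_iff)
  qed
  then show ?thesis using assms by (auto simp: A1_def)
qed

end

section \<open>Convergence of value iteration\<close>

lemma lsc_borel_measurable:
  fixes f :: "'a::topological_space \<Rightarrow> real"
  assumes "lsc_on UNIV f"
  shows "f \<in> borel_measurable borel"
  unfolding borel_measurable_iff_greater
proof
  fix a
  have "open {z. a < f z}" using assms by (simp add: lsc_on_def)
  then have "{z. a < f z} \<in> sets borel" by (rule borel_open)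
  then show "{z \<in> space borel. a < f z} \<in> sets borel" unfolding space_borel by (simp only: UNIV_I simp_thms)
qed

text \<open>Scheffe's argument: \<open>\<bar>g - l\<bar>\<close> is \<open>g - l\<close> plus twice
  the positive part of \<open>l - g\<close>, and the latter is dominated by the constant
  \<open>l\<close>.\<close>

lemma L1_convergence_of_integral_convergence:
  fixes g :: "nat \<Rightarrow> 'a \<Rightarrow> real"
  assumes "prob_space \<pi>" and int: "\<And>n. integrable \<pi> (g n)" and nonneg: "\<And>n x. 0 \<le> g n x"
    and ae: "AE x in \<pi>. (\<lambda>n. g n x) \<longlonglongrightarrow> l" and lim: "(\<lambda>n. \<integral>x. g n x \<partial>\<pi>) \<longlonglongrightarrow> l"
  shows "(\<lambda>n. \<integral>x. \<bar>g n x - l\<bar> \<partial>\<pi>) \<longlonglongrightarrow> 0"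
proof -
  interpret prob_space \<pi> by fact
  have [measurable]: "g n \<in> borel_measurable \<pi>" for n using int by auto
  have "0 \<le> l" using lim nonneg by (intro LIMSEQ_le_const[OF lim]) (auto intro!: exI Bochner_Integration.integral_nonneg)
  have bound: "\<bar>max 0 (l - g n x)\<bar> \<le> l" for n x using nonneg[of n x] \<open>0 \<le> l\<close> by (auto simp: max_def)
  have i: "integrable \<pi> (\<lambda>x. max 0 (l - g n x))" for n
    using bound by (intro integrable_const_bound[of _ l]) auto
  have "(\<lambda>n. \<integral>x. max 0 (l - g n x) \<partial>\<pi>) \<longlonglongrightarrow> (\<integral>x. 0 \<partial>\<pi>)"
  proof (rule integral_dominated_convergence[where w="\<lambda>_. l"])
    show "AE x in \<pi>. (\<lambda>n. max 0 (l - g n x)) \<longlonglongrightarrow> 0"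
      using ae
    proof eventually_elim
      case (elim x)
      have "(\<lambda>n. max 0 (l - g n x)) \<longlonglongrightarrow> max 0 (l - l)"
        using elim by (intro tendsto_max tendsto_diff tendsto_const)
      then show ?case by simp
    qed
  qed (use bound in auto)
  then have "(\<lambda>n. (\<integral>x. g n x \<partial>\<pi>) - l + 2 * (\<integral>x. max 0 (l - g n x) \<partial>\<pi>)) \<longlonglongrightarrow> l - l + 2 * 0"
    using lim by (intro tendsto_intros) simp_all
  moreover have "(\<integral>x. \<bar>g n x - l\<bar> \<partial>\<pi>) = (\<integral>x. g n x \<partial>\<pi>) - l + 2 * (\<integral>x. max 0 (l - g n x) \<partial>\<pi>)" for n
  proof -
    have "\<bar>g n x - l\<bar> = g n x - l + 2 * max 0 (l - g n x)" for x by (auto simp: max_def)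
    then show ?thesis using int i by (simp add: prob_space)
  qed
  ultimately show ?thesis by simp
qed

section \<open>One Bellman step compared with the value function\<close>

context split_mdp_value
begin

lemma stationary_selector:
  assumes "v \<in> borel_measurable borel" "\<And>x. v x \<in> acts M x"
  shows "(\<lambda>x. return borel (v x)) \<in> stationary M"
proof -
  have "(\<lambda>x. return borel (v x)) \<in> borel \<rightarrow>\<^sub>M prob_algebra borel"
    by (rule measurable_compose[OF assms(1) measurable_return_prob_space])
  moreover have "emeasure (return borel (v x)) (acts M x) = 1" for x
    using assms(2)[of x] by (simp add: emeasure_return)
  ultimately show ?thesis unfolding stationary_def by blast
qed

lemma kernel_under_selector: "kernel_under M (\<lambda>x. return borel (v x)) x = total_trans M (x, v x)"
proof -
  have "(\<lambda>u. total_trans M (x, u)) \<in> borel \<rightarrow>\<^sub>M subprob_algebra borel"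
    by (rule measurable_compose[OF _ measurable_prob_algebraD[OF measurable_total_trans]])
      (intro borel_measurable_continuous_onI continuous_intros)
  then show ?thesis unfolding kernel_under_def by (intro bind_return) auto
qed

lemma cost_under_selector: "cost_under M (\<lambda>x. return borel (v x)) x = total_cost M (x, v x)"
proof -
  have "(\<lambda>u. total_cost M (x, u)) \<in> borel_measurable borel"
    by (rule measurable_compose[OF _ measurable_total_cost]) (intro borel_measurable_continuous_onI continuous_intros)
  then show ?thesis unfolding cost_under_def by (intro nn_integral_return) auto
qed

lemma V0_selector:
  assumes v: "minimizing_selector M V v"
  shows "v x \<in> acts M x" "cost M (x, v x) + (\<integral>\<^sup>+y. V0 y \<partial>trans M (x, v x)) = V0 x + ennreal (beta M)"
proof -
  have arg: "is_arg_min (bellman_rhs M V x) (\<lambda>u. u \<in> acts M x) (v x)" using v by (simp add: minimizing_selector_def)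
  then show vx: "v x \<in> acts M x" by (simp add: is_arg_min_def)
  then have z: "(x, v x) \<in> graphK M" by (simp add: graphK_def)
  obtain u where u: "u \<in> acts M x" "bellman_rhs M V x u = ereal (V x)"
    and le: "\<And>u. u \<in> acts M x \<Longrightarrow> ereal (V x) \<le> bellman_rhs M V x u"
    using V_opt by (auto simp: solves_optimality_equation_def is_minimum_over_def)
  have "bellman_rhs M V x (v x) \<le> bellman_rhs M V x u"
    using arg u(1) by (auto simp: is_arg_min_def not_less)
  then have "bellman_rhs M V x (v x) = ereal (V x)" using le[OF vx] u(2) by simp
  then have "ereal (V x) + ereal (K + beta M) = enn2ereal (cost M (x, v x) + (\<integral>\<^sup>+y. V0 y \<partial>trans M (x, v x)))"
    using bellman_shift[OF z V K] by (simp add: V0_def)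
  also have "ereal (V x) + ereal (K + beta M) = enn2ereal (V0 x + ennreal (beta M))"
    using K(2)[of x] beta_nonneg by (simp add: V0_def plus_ennreal.rep_eq add.assoc)
  finally show "cost M (x, v x) + (\<integral>\<^sup>+y. V0 y \<partial>trans M (x, v x)) = V0 x + ennreal (beta M)"
    by (simp add: enn2ereal_inject)
qed

lemma conserving_selector:
  assumes v: "minimizing_selector M V v"
  shows "conserving (\<lambda>x. return borel (v x))"
  unfolding conserving_def
proof (intro conjI allI)
  show "(\<lambda>x. return borel (v x)) \<in> stationary M"
    using v V0_selector(1)[OF v] by (intro stationary_selector) (auto simp: minimizing_selector_def)
  fix y
  have "(y, v y) \<in> graphK M" using V0_selector(1)[OF v] by (simp add: graphK_def)
  then show "cost_under M (\<lambda>x. return borel (v x)) y + (\<integral>\<^sup>+z. V0 z \<partial>kernel_under M (\<lambda>x. return borel (v x)) y) = V0 y + ennreal (beta M)"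
    using V0_selector(2)[OF v, of y]
    by (simp add: cost_under_selector kernel_under_selector total_cost_def total_trans_def)
qed

text \<open>Monotonicity: at a minimizing action for \<open>f\<close>, the optimality inequality for
  \<open>V\<close> applies. Shifting \<open>V\<close> by \<open>K - \<kappa>\<close> and
  \<open>f\<close> by \<open>K\<close> turns the hypothesis into an order of nonnegative
  functions.\<close>

lemma bellman_step_lower:
  assumes f[measurable]: "f \<in> borel_measurable borel" and le: "\<And>x. V x - \<kappa> \<le> f x"
    and \<kappa>: "0 \<le> K - \<kappa>" "\<And>x. 0 \<le> V x + (K - \<kappa>)"
    and min: "is_minimum_over (acts M x) (bellman_rhs M f x) (ereal m)"
  shows "V x - \<kappa> \<le> m"
proof -
  obtain u where u: "u \<in> acts M x" "bellman_rhs M f x u = ereal m"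
    using min by (auto simp: is_minimum_over_def)
  then have z: "(x, u) \<in> graphK M" by (simp add: graphK_def)
  have fK: "0 \<le> f y + K" for y using le[of y] \<kappa>(2)[of y] by simp
  have "ereal (V x) \<le> bellman_rhs M V x u"
    using V_opt u(1) by (auto simp: solves_optimality_equation_def is_minimum_over_def)
  then have "ereal (V x) + ereal (K - \<kappa> + beta M) \<le> bellman_rhs M V x u + ereal (K - \<kappa> + beta M)"
    by (rule add_right_mono)
  also have "\<dots> = enn2ereal (cost M (x, u) + (\<integral>\<^sup>+y. ennreal (V y + (K - \<kappa>)) \<partial>trans M (x, u)))"
    by (rule bellman_shift[OF z V \<kappa>])
  also have "\<dots> \<le> enn2ereal (cost M (x, u) + (\<integral>\<^sup>+y. ennreal (f y + K) \<partial>trans M (x, u)))"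
    unfolding less_eq_ennreal.rep_eq[symmetric]
  proof (intro add_left_mono nn_integral_mono ennreal_leI)
    show "V y + (K - \<kappa>) \<le> f y + K" for y using le[of y] by simp
  qed
  also have "\<dots> = ereal m + ereal (K + beta M)"
    using bellman_shift[OF z f K(1) fK] u(2) by simp
  finally show ?thesis by simp
qed

text \<open>The selector of \<open>V\<close> is only a competitor for \<open>f\<close>, but it gives
  equality for \<open>V\<close>; subtracting cancels cost and \<open>beta M\<close> and leaves the
  kernel acting on the difference.\<close>

lemma bellman_step_upper:
  assumes v: "minimizing_selector M V v"
    and f[measurable]: "f \<in> borel_measurable borel" and le: "\<And>x. V x - \<kappa> \<le> f x"
    and \<kappa>: "0 \<le> K - \<kappa>" "\<And>x. 0 \<le> V x + (K - \<kappa>)"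
    and min: "is_minimum_over (acts M x) (bellman_rhs M f x) (ereal m)" and m: "V x - \<kappa> \<le> m"
  shows "ennreal (m - V x + \<kappa>) \<le> (\<integral>\<^sup>+y. ennreal (f y - V y + \<kappa>) \<partial>trans M (x, v x))"
proof -
  let ?T = "trans M (x, v x)"
  have z: "(x, v x) \<in> graphK M" using V0_selector(1)[OF v] by (simp add: graphK_def)
  have [measurable_cong]: "sets ?T = sets borel" using trans_prob[OF z] by (simp add: space_prob_algebra)
  \<comment> \<open>With shift \<open>K - \<kappa>\<close>, \<open>f + K\<close> splits into the
    shifted \<open>V\<close> plus \<open>f - V + \<kappa>\<close>, both nonnegative, so the
    cancellation concerns a finite term.\<close>
  interpret shifted: split_mdp_value M B \<nu> \<delta> V "K - \<kappa>"
    using \<kappa> by unfold_locales (auto simp: V V_eq V_opt is_mdp basic A0)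
  have fK: "0 \<le> f y + K" for y using le[of y] \<kappa>(2)[of y] by simp
  have g0: "0 \<le> f y - V y + \<kappa>" for y using le[of y] by simp
  have "ereal m + ereal (K + beta M) \<le> bellman_rhs M f x (v x) + ereal (K + beta M)"
    using min V0_selector(1)[OF v] by (intro add_right_mono) (auto simp: is_minimum_over_def)
  also have "\<dots> = enn2ereal (cost M (x, v x) + (\<integral>\<^sup>+y. ennreal (f y + K) \<partial>?T))"
    by (rule bellman_shift[OF z f K(1) fK])
  also have "(\<integral>\<^sup>+y. ennreal (f y + K) \<partial>?T) = (\<integral>\<^sup>+y. ennreal (V y + (K - \<kappa>)) + ennreal (f y - V y + \<kappa>) \<partial>?T)"
    using \<kappa>(2) g0 by (intro nn_integral_cong) (simp add: ennreal_plus[symmetric] add.commute del: ennreal_plus)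
  also have "\<dots> = (\<integral>\<^sup>+y. ennreal (V y + (K - \<kappa>)) \<partial>?T) + (\<integral>\<^sup>+y. ennreal (f y - V y + \<kappa>) \<partial>?T)"
    by (rule nn_integral_add) measurable
  also have "cost M (x, v x) + \<dots> = ennreal (V x + (K - \<kappa>)) + ennreal (beta M) + (\<integral>\<^sup>+y. ennreal (f y - V y + \<kappa>) \<partial>?T)"
    using shifted.V0_selector(2)[OF v, of x] by (simp only: shifted.V0_def add.assoc[symmetric])
  finally have le2: "ereal (m + K + beta M) \<le> enn2ereal (ennreal (V x + (K - \<kappa>)) + ennreal (beta M) + (\<integral>\<^sup>+y. ennreal (f y - V y + \<kappa>) \<partial>?T))"
    by (simp add: add.assoc)
  let ?a = "V x + (K - \<kappa>) + beta M"
  have a: "0 \<le> ?a" using \<kappa>(2)[of x] beta_nonneg by simp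
  have m0: "0 \<le> m - V x + \<kappa>" using m by simp
  have "ennreal ?a + ennreal (m - V x + \<kappa>) = ennreal (m + K + beta M)"
    using a m0 by (simp add: ennreal_plus[symmetric] del: ennreal_plus)
  moreover have "0 \<le> m + K + beta M" using a m0 by simp
  moreover have "ennreal ?a = ennreal (V x + (K - \<kappa>)) + ennreal (beta M)"
    using \<kappa>(2)[of x] beta_nonneg by simp
  ultimately have "ennreal ?a + ennreal (m - V x + \<kappa>) \<le> ennreal ?a + (\<integral>\<^sup>+y. ennreal (f y - V y + \<kappa>) \<partial>?T)"
    using le2 by (simp add: less_eq_ennreal.rep_eq)
  then show ?thesis by (simp add: ennreal_add_left_cancel_le)
qed

end

lemma integrable_of_shift:
  assumes "prob_space \<mu>" "f \<in> borel_measurable \<mu>" "\<And>x. 0 \<le> f x + c" "(\<integral>\<^sup>+x. ennreal (f x + c) \<partial>\<mu>) < \<infinity>"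
  shows "integrable \<mu> f"
proof -
  interpret prob_space \<mu> by fact
  have "integrable \<mu> (\<lambda>x. f x + c)" using assms by (intro integrableI_nonneg) auto
  then have "integrable \<mu> (\<lambda>x. f x + c - c)" by (intro Bochner_Integration.integrable_diff) auto
  then show ?thesis by simp
qed

text \<open>A Bochner integral of a non-integrable function is 0, so the integrability conjuncts are
  what give the stated limits their intended meaning.\<close>

theorem theorem4p1:
  fixes M :: "('x::polish_space, 'u::polish_space) mdp"
    and B :: "'x set" and \<nu> :: "'x measure" and \<delta> :: real
    and iX :: "'x \<Rightarrow> 'xs::polish_space" and iU :: "'u \<Rightarrow> 'us::polish_space"
    and V :: "'x \<Rightarrow> real" and v :: "'x \<Rightarrow> 'u" and \<pi> :: "'x measure"
    and \<kappa> :: real and \<Phi> :: "nat \<Rightarrow> 'x \<Rightarrow> real"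
  assumes "is_mdp M"
    and "basic_assumption M"
    and "A0 M B \<nu> \<delta>"
    and "A1 M iX iU"
    and "A2 M B \<nu> \<delta>"
    and "\<And>x. ereal (V x) = Vstar M B \<nu> \<delta> x"
    and "V \<in> lsc_bounded_below"
    and "solves_optimality_equation M V"
    and "minimizing_selector M V v"
    and "is_optimal M (stationary_strategy (\<lambda>x. return borel (v x)))"
    and "invariant_under M v \<pi>"
    and "ext_integral \<pi> V < \<infinity>"
    and "\<Phi> 0 \<in> init_class V \<pi> \<kappa>"
    and "value_iteration M \<Phi>"
  shows "integrable \<pi> V \<and> (\<forall>n. integrable \<pi> (\<Phi> n)) \<and> (\<forall>n. integrable \<nu> (\<Phi> n)) \<and>
    (\<exists>L::real.
       (\<lambda>n. \<integral>x. \<Phi> n x - V x \<partial>\<pi>) \<longlonglongrightarrow> L \<and>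
       (\<lambda>n. \<integral>x. \<bar>\<Phi> n x - (V x + L)\<bar> \<partial>\<pi>) \<longlonglongrightarrow> 0 \<and>
       (AE x in \<pi>. (\<lambda>n. \<Phi> n x) \<longlonglongrightarrow> V x + L)) \<and>
    (\<lambda>n. \<bar>(\<integral>x. \<Phi> n x \<partial>\<nu>) - (\<integral>x. \<Phi> n x - V x \<partial>\<pi>)\<bar>) \<longlonglongrightarrow> beta M"
proof -
  obtain b where b: "\<And>x. b \<le> V x" using assms(7) by (auto simp: lsc_bounded_below_def)
  \<comment> \<open>Large enough for both shifts \<open>K\<close> and \<open>K - \<kappa>\<close> to
    be nonnegative and to make \<open>V\<close> nonnegative, whatever the sign of
    \<open>\<kappa>\<close>.\<close>
  define K where "K = \<bar>b\<bar> + \<bar>\<kappa>\<bar>"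
  have KK: "0 \<le> K" "0 \<le> V x + K" "0 \<le> K - \<kappa>" "0 \<le> V x + (K - \<kappa>)" for x
    using b[of x] by (auto simp: K_def)
  have V[measurable]: "V \<in> borel_measurable borel"
    using assms(7) by (auto simp: lsc_bounded_below_def intro: lsc_borel_measurable)
  interpret split_mdp_value M B \<nu> \<delta> V K
    using assms V KK by unfold_locales auto
  let ?w = "\<lambda>x. return borel (v x)"
  have cons: "conserving ?w" by (rule conserving_selector[OF assms(9)])
  have v_graph: "(x, v x) \<in> graphK M" for x using V0_selector(1)[OF assms(9)] by (simp add: graphK_def)
  have pi: "prob_space \<pi>" and sets_pi[measurable_cong]: "sets \<pi> = sets borel"
    using assms(11) by (auto simp: invariant_under_def prob_measures_def space_prob_algebra)
  note sets_nu[measurable_cong]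
  have m_pi: "f \<in> borel_measurable \<pi>" and m_nu: "f \<in> borel_measurable \<nu>"
    if "f \<in> borel_measurable borel" for f :: "'x \<Rightarrow> real" using that by auto
  have fin_of_ext: "(\<integral>\<^sup>+x. ennreal (f x + K) \<partial>\<pi>) < \<infinity>"
    if "f \<in> borel_measurable borel" "\<And>x. 0 \<le> f x + K" "ext_integral \<pi> f < \<infinity>" for f
  proof -
    have "enn2ereal (\<integral>\<^sup>+x. ennreal (f x + K) \<partial>\<pi>) = ext_integral \<pi> f + ereal K"
      using ext_integral_shift[OF pi m_pi[OF that(1)] KK(1) that(2)] by simp
    then have "enn2ereal (\<integral>\<^sup>+x. ennreal (f x + K) \<partial>\<pi>) \<noteq> \<infinity>" using that(3) by (cases "ext_integral \<pi> f") auto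
    then show ?thesis by (simp add: less_top[symmetric])
  qed
  have V_fin: "(\<integral>\<^sup>+x. V0 x \<partial>\<pi>) < \<infinity>"
    unfolding V0_def by (rule fin_of_ext[OF V KK(2) assms(12)])
  interpret C: invariant_chain "taboo_kernel M B \<nu> \<delta> ?w" "regen B \<delta>" \<nu> \<pi>
  proof (rule invariant_chain[OF cons pi sets_pi _ V_fin])
    show "emeasure \<pi> A = (\<integral>\<^sup>+x. emeasure (kernel_under M ?w x) A \<partial>\<pi>)" if "A \<in> sets borel" for A
      using assms(11) that v_graph
      by (simp add: invariant_under_def kernel_under_selector total_trans_def)
  qed
  have V_int: "integrable \<pi> V"
    using V_fin unfolding V0_def by (intro integrable_of_shift[OF pi m_pi[OF V] KK(2)])
  have nu_fin: "(\<integral>\<^sup>+x. f x \<partial>\<nu>) < \<infinity>"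
    if "f \<in> borel_measurable borel" "(\<integral>\<^sup>+x. f x \<partial>\<pi>) < \<infinity>" for f
    by (rule C.finite_of_pi_s_mult[OF C.nu_le that(2)]) (rule that(1))
  have nu_V_fin: "(\<integral>\<^sup>+x. V0 x \<partial>\<nu>) < \<top>" using nu_fin[OF measurable_V0 V_fin] by simp
  have nu_V_int: "integrable \<nu> V"
    using nu_V_fin unfolding V0_def by (intro integrable_of_shift[OF prob_nu m_nu[OF V] KK(2)]) simp
  \<comment> \<open>The two opposite bounds meet; both need a finite \<open>\<nu>\<close>-integral,
    inherited from \<open>\<pi>\<close> since
    \<open>\<pi>(s) \<nu>(f) \<le> \<pi>(f)\<close>.\<close>
  have nu_V: "(\<integral>x. V x \<partial>\<nu>) = beta M"
  proof -
    interpret nu: prob_space \<nu> by (rule prob_nu)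
    have "ennreal (\<integral>x. V x + K \<partial>\<nu>) = (\<integral>\<^sup>+x. V0 x \<partial>\<nu>)"
      unfolding V0_def using nu_V_int KK(2) by (intro nn_integral_eq_integral[symmetric]) auto
    also have "\<dots> = ennreal (beta M + K)"
      by (intro antisym nu_V0_le[OF cons] nu_V0_ge nu_V_fin)
    finally have "(\<integral>x. V x + K \<partial>\<nu>) = beta M + K"
      using KK(1,2) beta_nonneg by (subst (asm) ennreal_inj) (auto intro: Bochner_Integration.integral_nonneg)
    then show ?thesis using nu_V_int by (simp add: measure_def nu_UNIV)
  qed

  have \<Phi>0: "\<Phi> 0 \<in> borel_measurable borel" "\<And>x. V x - \<kappa> \<le> \<Phi> 0 x" "ext_integral \<pi> (\<Phi> 0) \<le> ereal (\<kappa> + 1)"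
  proof -
    have "\<Phi> 0 \<in> lsc_bounded_below" "\<forall>x. V x - \<kappa> \<le> \<Phi> 0 x" "ext_integral \<pi> (\<Phi> 0) \<le> ereal (\<kappa> + 1)"
      using assms(13) unfolding init_class_def by blast+
    then show "\<Phi> 0 \<in> borel_measurable borel" "\<And>x. V x - \<kappa> \<le> \<Phi> 0 x" "ext_integral \<pi> (\<Phi> 0) \<le> ereal (\<kappa> + 1)"
      by (auto simp: lsc_bounded_below_def intro: lsc_borel_measurable)
  qed
  have min: "is_minimum_over (acts M x) (bellman_rhs M (\<Phi> n) x) (ereal (\<Phi> (Suc n) x))" for n x
    using assms(14) by (simp add: value_iteration_def)
  \<comment> \<open>Measurability and the lower bound go through the induction together: the Bellman
    step preserves the first only for functions bounded below.\<close>
  have \<Phi>: "\<Phi> n \<in> borel_measurable borel \<and> (\<forall>x. V x - \<kappa> \<le> \<Phi> n x)" for n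
  proof (induction n)
    case 0
    show ?case using \<Phi>0 by simp
  next
    case (Suc n)
    have "0 \<le> \<Phi> n x + K" for x using spec[OF Suc[THEN conjunct2], of x] KK(4)[of x] by simp
    then have "\<Phi> (Suc n) \<in> borel_measurable borel"
      using Suc by (intro measurable_bellman_minimum[OF compact_sublevel[OF assms(4)] _ KK(1) _ min]) auto
    moreover have "V x - \<kappa> \<le> \<Phi> (Suc n) x" for x
      using Suc by (intro bellman_step_lower[OF _ _ KK(3,4) min]) auto
    ultimately show ?case by simp
  qed
  have \<Phi>_meas[measurable]: "\<Phi> n \<in> borel_measurable borel" for n using \<Phi> by simp
  define g where "g n x = \<Phi> n x - V x + \<kappa>" for n x
  have g0: "0 \<le> g n x" for n x
    using spec[OF \<Phi>[of n, THEN conjunct2], of x] by (simp add: g_def)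
  have g_meas[measurable]: "g n \<in> borel_measurable borel" for n unfolding g_def[abs_def] by measurable
  obtain l where l: "0 \<le> l" "\<And>n. (\<integral>\<^sup>+x. ennreal (g n x) \<partial>\<pi>) < \<infinity>"
    "AE x in \<pi>. (\<lambda>n. ennreal (g n x)) \<longlonglongrightarrow> ennreal l"
    "(\<lambda>n. \<integral>\<^sup>+x. ennreal (g n x) \<partial>\<pi>) \<longlonglongrightarrow> ennreal l"
    "(\<lambda>n. \<integral>\<^sup>+x. ennreal (g n x) \<partial>\<nu>) \<longlonglongrightarrow> ennreal l"
  proof (rule C.value_iteration_convergence[of "\<lambda>n x. ennreal (g n x)"])
    show "ennreal (g (Suc n) x) \<le> C.taboo (\<lambda>x. ennreal (g n x)) x + regen B \<delta> x * (\<integral>\<^sup>+y. ennreal (g n y) \<partial>\<nu>)" for n x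
    proof -
      have "ennreal (g (Suc n) x) \<le> (\<integral>\<^sup>+y. ennreal (g n y) \<partial>trans M (x, v x))"
        unfolding g_def using \<Phi>[of n] \<Phi>[of "Suc n"]
        by (intro bellman_step_upper[OF assms(9) _ _ KK(3,4) min]) auto
      also have "\<dots> = (\<integral>\<^sup>+y. ennreal (g n y) \<partial>kernel_under M ?w x)"
        using v_graph[of x] by (simp add: kernel_under_selector total_trans_def)
      also have "\<dots> = C.taboo (\<lambda>x. ennreal (g n x)) x + regen B \<delta> x * (\<integral>\<^sup>+y. ennreal (g n y) \<partial>\<nu>)"
        unfolding C.taboo_def by (rule nn_integral_kernel_split[OF conserving_stationary[OF cons]]) measurable
      finally show ?thesis .
    qed
    have "(\<integral>\<^sup>+x. ennreal (g 0 x) \<partial>\<pi>) \<le> (\<integral>\<^sup>+x. ennreal (\<Phi> 0 x + K) \<partial>\<pi>)"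
    proof (intro nn_integral_mono ennreal_leI)
      show "g 0 x \<le> \<Phi> 0 x + K" for x using KK(4)[of x] by (simp add: g_def)
    qed
    also have "\<dots> < \<infinity>"
    proof (rule fin_of_ext[OF \<Phi>0(1)])
      show "0 \<le> \<Phi> 0 x + K" for x using \<Phi>0(2)[of x] KK(4)[of x] by simp
      show "ext_integral \<pi> (\<Phi> 0) < \<infinity>" using \<Phi>0(3) by (rule le_less_trans) simp
    qed
    finally show "(\<integral>\<^sup>+x. ennreal (g 0 x) \<partial>\<pi>) < \<infinity>" .
  qed auto
  have g_int: "integrable \<pi> (g n)" for n
    using l(2)[of n] g0 by (intro integrableI_nonneg m_pi) auto
  have g_nu: "integrable \<nu> (g n)" for n
    using nu_fin[OF _ l(2), of n] g0 by (intro integrableI_nonneg m_nu) auto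
  have g_ae: "AE x in \<pi>. (\<lambda>n. g n x) \<longlonglongrightarrow> l"
    using l(3) by eventually_elim (use l(1) g0 in simp)
  have g_lim: "(\<lambda>n. \<integral>x. g n x \<partial>\<pi>) \<longlonglongrightarrow> l"
  proof -
    have "(\<lambda>n. ennreal (\<integral>x. g n x \<partial>\<pi>)) \<longlonglongrightarrow> ennreal l"
      using l(4) g_int g0 by (simp add: nn_integral_eq_integral)
    then show ?thesis using l(1) g0 by (subst (asm) tendsto_ennreal_iff) auto
  qed
  have g_nu_lim: "(\<lambda>n. \<integral>x. g n x \<partial>\<nu>) \<longlonglongrightarrow> l"
  proof -
    have "(\<lambda>n. ennreal (\<integral>x. g n x \<partial>\<nu>)) \<longlonglongrightarrow> ennreal l"
      using l(5) g_nu g0 by (simp add: nn_integral_eq_integral)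
    then show ?thesis using l(1) g0 by (subst (asm) tendsto_ennreal_iff) auto
  qed
  interpret pi: prob_space \<pi> by (rule pi)
  interpret nu: prob_space \<nu> by (rule prob_nu)
  have \<Phi>_eq: "\<Phi> n = (\<lambda>x. g n x + V x - \<kappa>)" for n by (auto simp: g_def)
  have diff_eq: "(\<integral>x. \<Phi> n x - V x \<partial>\<pi>) = (\<integral>x. g n x \<partial>\<pi>) - \<kappa>" for n
  proof -
    have "(\<integral>x. \<Phi> n x - V x \<partial>\<pi>) = (\<integral>x. g n x - \<kappa> \<partial>\<pi>)" by (simp add: g_def)
    then show ?thesis using g_int by (simp add: measure_def C.pi_space)
  qed
  have nu_eq: "(\<integral>x. \<Phi> n x \<partial>\<nu>) = (\<integral>x. g n x \<partial>\<nu>) + beta M - \<kappa>" for n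
    unfolding \<Phi>_eq using g_nu nu_V_int by (simp add: measure_def nu_UNIV nu_V)
  have int_pi: "integrable \<pi> (\<Phi> n)" for n unfolding \<Phi>_eq using g_int V_int by simp
  have int_nu: "integrable \<nu> (\<Phi> n)" for n unfolding \<Phi>_eq using g_nu nu_V_int by simp
  \<comment> \<open>The limit constant is \<open>l - \<kappa>\<close>, because \<open>g\<close>
    carries the shift \<open>\<kappa>\<close>.\<close>
  have lim1: "(\<lambda>n. \<integral>x. \<Phi> n x - V x \<partial>\<pi>) \<longlonglongrightarrow> l - \<kappa>"
    unfolding diff_eq by (intro tendsto_intros g_lim)
  have lim2: "(\<lambda>n. \<integral>x. \<bar>\<Phi> n x - (V x + (l - \<kappa>))\<bar> \<partial>\<pi>) \<longlonglongrightarrow> 0"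
  proof -
    have eq: "\<Phi> n x - (V x + (l - \<kappa>)) = g n x - l" for n x by (simp add: g_def)
    show ?thesis unfolding eq by (rule L1_convergence_of_integral_convergence[OF pi g_int g0 g_ae g_lim])
  qed
  have lim3: "AE x in \<pi>. (\<lambda>n. \<Phi> n x) \<longlonglongrightarrow> V x + (l - \<kappa>)"
    using g_ae
  proof eventually_elim
    case (elim x)
    have "(\<lambda>n. g n x + V x - \<kappa>) \<longlonglongrightarrow> l + V x - \<kappa>" by (intro tendsto_intros elim)
    then show ?case by (simp add: g_def algebra_simps)
  qed
  \<comment> \<open>The means of \<open>g\<close> under \<open>\<nu>\<close> and
    \<open>\<pi>\<close> share the limit \<open>l\<close>, so only the \<open>\<nu>\<close>-integral
    of \<open>V\<close> survives; it is nonnegative, which disposes of the absolute value.\<close>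
  have lim4: "(\<lambda>n. \<bar>(\<integral>x. \<Phi> n x \<partial>\<nu>) - (\<integral>x. \<Phi> n x - V x \<partial>\<pi>)\<bar>) \<longlonglongrightarrow> beta M"
  proof -
    have "(\<lambda>n. \<bar>(\<integral>x. g n x \<partial>\<nu>) + beta M - \<kappa> - ((\<integral>x. g n x \<partial>\<pi>) - \<kappa>)\<bar>) \<longlonglongrightarrow> \<bar>l + beta M - \<kappa> - (l - \<kappa>)\<bar>"
      by (intro tendsto_intros g_lim g_nu_lim)
    then show ?thesis using beta_nonneg by (simp add: nu_eq diff_eq)
  qed
  show ?thesis using V_int int_pi int_nu lim1 lim2 lim3 lim4 by blast
qed

end
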